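(* Let $n,m\ge 2$ be integers and $q\in\mathbb{C}$ with $|q|=1$. The ideal $\mathcal{M}_q\subset\mathcal{E}_{n,m}^q$ is the unique largest ideal of $\mathcal{E}_{n,m}^q$, i.e. it is a proper closed two-sided ideal which contains every proper closed two-sided ideal of $\mathcal{E}_{n,m}^q$.
   Context: For $q\in\mathbb{C}$, $|q|=1$, $\mathcal{E}_{n,m}^q$ denotes the universal unital $C^*$-algebra generated by elements $s_1,\dots,s_n,t_1,\dots,t_m$ subject to the relations $s_i^*s_j=\delta_{ij}\mathbf 1$, $t_r^*t_l=\delta_{rl}\mathbf 1$, $s_j^*t_r=q\,t_rs_j^*$ for all $i,j\in\{1,\dots,n\}$, $r,l\in\{1,\dots,m\}$. Put $Q=\sum_{j=1}^n s_js_j^*$ and $P=\sum_{r=1}^m t_rt_r^*$. $\mathcal M_q$ is the closed two-sided ideal of $\mathcal{E}_{n,m}^q$ generated by $\mathbf 1-P$ and $\mathbf 1-Q$. *)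

theory Defs
  imports "HOL-Analysis.Analysis" "HOL-Algebra.QuotRing" "HOL-Algebra.Module"
begin

section \<open>Unital C*-algebras\<close>

text \<open>
  The algebras carry the ring structure of HOL-Algebra, so that ideals, ring homomorphisms and
  finite sums are the ones of that library. The scalar multiplication \<^const>\<open>smult\<close> comes from the
  record of modules. Its axioms are written out below for the type \<^typ>\<open>complex\<close>, since the locale
  \<open>algebra\<close> of HOL-Algebra is about commutative algebras.
\<close>

record 'a cstar = "(complex, 'a) module" +
  adj :: "'a \<Rightarrow> 'a"
  cnorm :: "'a \<Rightarrow> real"

text \<open>
  The locale \<^locale>\<open>Metric_space\<close> asks for nonnegativity and symmetry also outside the carrier,
  hence the case distinction.
\<close>

definition cdist :: "'a cstar \<Rightarrow> 'a \<Rightarrow> 'a \<Rightarrow> real" where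
  "cdist A x y = (if x \<in> carrier A \<and> y \<in> carrier A then cnorm A (x \<ominus>\<^bsub>A\<^esub> y) else 0)"

abbreviation ctopology :: "'a cstar \<Rightarrow> 'a topology" where
  "ctopology A \<equiv> Metric_space.mtopology (carrier A) (cdist A)"

locale unital_cstar_algebra = ring A for A :: "'a cstar" (structure) +
  assumes smult_closed: "x \<in> carrier A \<Longrightarrow> c \<odot> x \<in> carrier A"
    and smult_one: "x \<in> carrier A \<Longrightarrow> 1 \<odot> x = x"
    and smult_smult: "x \<in> carrier A \<Longrightarrow> c \<odot> (d \<odot> x) = (c * d) \<odot> x"
    and smult_add_left: "x \<in> carrier A \<Longrightarrow> (c + d) \<odot> x = c \<odot> x \<oplus> d \<odot> x"
    and smult_add_right:
      "\<lbrakk>x \<in> carrier A; y \<in> carrier A\<rbrakk> \<Longrightarrow> c \<odot> (x \<oplus> y) = c \<odot> x \<oplus> c \<odot> y"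
    and smult_mult_left:
      "\<lbrakk>x \<in> carrier A; y \<in> carrier A\<rbrakk> \<Longrightarrow> (c \<odot> x) \<otimes> y = c \<odot> (x \<otimes> y)"
    and smult_mult_right:
      "\<lbrakk>x \<in> carrier A; y \<in> carrier A\<rbrakk> \<Longrightarrow> x \<otimes> (c \<odot> y) = c \<odot> (x \<otimes> y)"
    and adj_closed: "x \<in> carrier A \<Longrightarrow> adj A x \<in> carrier A"
    and adj_adj: "x \<in> carrier A \<Longrightarrow> adj A (adj A x) = x"
    and adj_add:
      "\<lbrakk>x \<in> carrier A; y \<in> carrier A\<rbrakk> \<Longrightarrow> adj A (x \<oplus> y) = adj A x \<oplus> adj A y"
    and adj_smult: "x \<in> carrier A \<Longrightarrow> adj A (c \<odot> x) = cnj c \<odot> adj A x"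
    and adj_mult:
      "\<lbrakk>x \<in> carrier A; y \<in> carrier A\<rbrakk> \<Longrightarrow> adj A (x \<otimes> y) = adj A y \<otimes> adj A x"
    and cnorm_nonneg: "x \<in> carrier A \<Longrightarrow> 0 \<le> cnorm A x"
    and cnorm_eq_0_iff: "x \<in> carrier A \<Longrightarrow> cnorm A x = 0 \<longleftrightarrow> x = \<zero>"
    and cnorm_smult: "x \<in> carrier A \<Longrightarrow> cnorm A (c \<odot> x) = cmod c * cnorm A x"
    and cnorm_triangle:
      "\<lbrakk>x \<in> carrier A; y \<in> carrier A\<rbrakk> \<Longrightarrow> cnorm A (x \<oplus> y) \<le> cnorm A x + cnorm A y"
    and cnorm_mult:
      "\<lbrakk>x \<in> carrier A; y \<in> carrier A\<rbrakk> \<Longrightarrow> cnorm A (x \<otimes> y) \<le> cnorm A x * cnorm A y"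
    and cstar_identity: "x \<in> carrier A \<Longrightarrow> cnorm A (adj A x \<otimes> x) = (cnorm A x)\<^sup>2"
    and complete: "Metric_space.mcomplete (carrier A) (cdist A)"
begin

lemma smult_minus_one:
  assumes "x \<in> carrier A" shows "(-1) \<odot> x = \<ominus> x"
proof -
  have "0 \<odot> x \<oplus> 0 \<odot> x = 0 \<odot> x"
    using smult_add_left[OF assms, of 0 0] by simp
  then have "0 \<odot> x = \<zero>"
    using smult_closed[OF assms] by (simp add: add.l_cancel_one)
  then have "(-1) \<odot> x \<oplus> x = \<zero>"
    using smult_add_left[OF assms, of "-1" 1] smult_one[OF assms] by simp
  then show ?thesis
    using assms smult_closed minus_equality by metis
qed

lemma Metric_space_cdist: "Metric_space (carrier A) (cdist A)"
proof
  fix x y z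
  show "0 \<le> cdist A x y"
    by (simp add: cdist_def cnorm_nonneg)
  show "cdist A x y = cdist A y x"
  proof (cases "x \<in> carrier A \<and> y \<in> carrier A")
    case True
    then have "x \<ominus> y = (-1) \<odot> (y \<ominus> x)"
      by (simp add: smult_minus_one a_minus_def minus_add a_comm)
    then show ?thesis
      using True cnorm_smult[of "y \<ominus> x" "-1"] by (simp add: cdist_def)
  qed (auto simp: cdist_def)
  show "cdist A x y = 0 \<longleftrightarrow> x = y" if "x \<in> carrier A" "y \<in> carrier A"
  proof -
    have "x \<ominus> y = \<zero> \<longleftrightarrow> x = y"
      using that by (metis a_minus_def minus_equality minus_minus r_neg a_inv_closed)
    then show ?thesis
      using that by (simp add: cdist_def cnorm_eq_0_iff)
  qed
  show "cdist A x z \<le> cdist A x y + cdist A y z"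
    if "x \<in> carrier A" "y \<in> carrier A" "z \<in> carrier A"
  proof -
    have "x \<ominus> z = (x \<ominus> y) \<oplus> (y \<ominus> z)"
      using that by (simp add: a_minus_def a_assoc r_neg1)
    then show ?thesis
      using that cnorm_triangle[of "x \<ominus> y" "y \<ominus> z"] by (simp add: cdist_def)
  qed
qed

end

definition star_hom :: "'a cstar \<Rightarrow> 'b cstar \<Rightarrow> ('a \<Rightarrow> 'b) set" where
  "star_hom A B = {h \<in> ring_hom A B. \<forall>x \<in> carrier A.
     (\<forall>c. h (c \<odot>\<^bsub>A\<^esub> x) = c \<odot>\<^bsub>B\<^esub> h x) \<and> h (adj A x) = adj B (h x)}"

definition unital_cstar_subalgebra :: "'a set \<Rightarrow> 'a cstar \<Rightarrow> bool" where
  "unital_cstar_subalgebra C A \<longleftrightarrow>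
     closedin (ctopology A) C \<and> \<one>\<^bsub>A\<^esub> \<in> C \<and>
     (\<forall>x \<in> C. \<forall>y \<in> C. x \<oplus>\<^bsub>A\<^esub> y \<in> C \<and> x \<otimes>\<^bsub>A\<^esub> y \<in> C) \<and>
     (\<forall>x \<in> C. adj A x \<in> C \<and> (\<forall>c. c \<odot>\<^bsub>A\<^esub> x \<in> C))"

definition cstar_generated_by :: "'a cstar \<Rightarrow> 'a set \<Rightarrow> bool" where
  "cstar_generated_by A X \<longleftrightarrow>
     X \<subseteq> carrier A \<and> (\<forall>C. unital_cstar_subalgebra C A \<and> X \<subseteq> C \<longrightarrow> C = carrier A)"

text \<open>
  A ring ideal of a unital complex algebra is automatically a complex subspace, because
  \<open>c \<odot> x = (c \<odot> \<one>) \<otimes> x\<close>.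
\<close>

definition closed_ideal :: "'a set \<Rightarrow> 'a cstar \<Rightarrow> bool" where
  "closed_ideal J A \<longleftrightarrow> ideal J A \<and> closedin (ctopology A) J"

definition closed_ideal_generated :: "'a cstar \<Rightarrow> 'a set \<Rightarrow> 'a set" where
  "closed_ideal_generated A X = \<Inter> {J. closed_ideal J A \<and> X \<subseteq> J}"

section \<open>The algebras in question\<close>

definition E_relations ::
    "nat \<Rightarrow> nat \<Rightarrow> complex \<Rightarrow> 'a cstar \<Rightarrow> (nat \<Rightarrow> 'a) \<Rightarrow> (nat \<Rightarrow> 'a) \<Rightarrow> bool" where
  "E_relations n m q A s t \<longleftrightarrow>
     s ` {1..n} \<subseteq> carrier A \<and> t ` {1..m} \<subseteq> carrier A \<and>
     (\<forall>i \<in> {1..n}. \<forall>j \<in> {1..n}. adj A (s i) \<otimes>\<^bsub>A\<^esub> s j = (if i = j then \<one>\<^bsub>A\<^esub> else \<zero>\<^bsub>A\<^esub>)) \<and>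
     (\<forall>r \<in> {1..m}. \<forall>l \<in> {1..m}. adj A (t r) \<otimes>\<^bsub>A\<^esub> t l = (if r = l then \<one>\<^bsub>A\<^esub> else \<zero>\<^bsub>A\<^esub>)) \<and>
     (\<forall>j \<in> {1..n}. \<forall>r \<in> {1..m}.
        adj A (s j) \<otimes>\<^bsub>A\<^esub> t r = q \<odot>\<^bsub>A\<^esub> (t r \<otimes>\<^bsub>A\<^esub> adj A (s j)))"

definition E_universal_for ::
    "'b itself \<Rightarrow> nat \<Rightarrow> nat \<Rightarrow> complex \<Rightarrow> 'a cstar \<Rightarrow> (nat \<Rightarrow> 'a) \<Rightarrow> (nat \<Rightarrow> 'a) \<Rightarrow> bool" where
  "E_universal_for TYPE('b) n m q A s t \<longleftrightarrow>
     (\<forall>(B :: 'b cstar) s' t'. unital_cstar_algebra B \<and> E_relations n m q B s' t' \<longrightarrow>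
        (\<exists>h \<in> star_hom A B. (\<forall>i \<in> {1..n}. h (s i) = s' i) \<and> (\<forall>r \<in> {1..m}. h (t r) = t' r)))"

text \<open>
  \<open>is_E n m q A s t\<close>: the unital C*-algebra \<open>A\<close> with the elements \<open>s 1, \<dots>, s n, t 1, \<dots>, t m\<close>
  is the universal unital C*-algebra generated by elements subject to the relations above.

  A formula of HOL cannot quantify over types, so the universal property is stated for all
  C*-algebras whose carrier is a set of elements of one of two types. This is no restriction.
  A C*-algebra that is generated by finitely many elements is separable, hence isomorphic to a
  C*-algebra of bounded operators on the Hilbert space of square-summable sequences, i.e. of
  infinite matrices, and so it has a copy whose carrier is a set in
  \<^typ>\<open>nat \<Rightarrow> nat \<Rightarrow> complex\<close>. Applied to the C*-subalgebra generated by the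
  images of the generators, this shows that the universal property for this type implies the one
  for arbitrary unital C*-algebras, in particular for those over the type of \<open>A\<close>.

  Homomorphisms are determined by their values on the generators, because \<open>A\<close> is generated by
  them and *-homomorphisms of C*-algebras are continuous. Hence existence is all that
  needs to be required.
\<close>

definition is_E ::
    "nat \<Rightarrow> nat \<Rightarrow> complex \<Rightarrow> 'a cstar \<Rightarrow> (nat \<Rightarrow> 'a) \<Rightarrow> (nat \<Rightarrow> 'a) \<Rightarrow> bool" where
  "is_E n m q A s t \<longleftrightarrow>
     unital_cstar_algebra A \<and>
     E_relations n m q A s t \<and>
     cstar_generated_by A (s ` {1..n} \<union> t ` {1..m}) \<and>
     E_universal_for TYPE('a) n m q A s t \<and>
     E_universal_for TYPE(nat \<Rightarrow> nat \<Rightarrow> complex) n m q A s t"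

definition range_sum :: "'a cstar \<Rightarrow> nat \<Rightarrow> (nat \<Rightarrow> 'a) \<Rightarrow> 'a" where
  "range_sum A n s = (\<Oplus>\<^bsub>A\<^esub>j \<in> {1..n}. s j \<otimes>\<^bsub>A\<^esub> adj A (s j))"

text \<open>Here \<open>Q = range_sum A n s\<close> and \<open>P = range_sum A m t\<close>.\<close>

definition M_ideal ::
    "nat \<Rightarrow> nat \<Rightarrow> 'a cstar \<Rightarrow> (nat \<Rightarrow> 'a) \<Rightarrow> (nat \<Rightarrow> 'a) \<Rightarrow> 'a set" where
  "M_ideal n m A s t =
     closed_ideal_generated A {\<one>\<^bsub>A\<^esub> \<ominus>\<^bsub>A\<^esub> range_sum A m t, \<one>\<^bsub>A\<^esub> \<ominus>\<^bsub>A\<^esub> range_sum A n s}"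

end

theory Submission
  imports Defs
begin

text \<open>
  Why the theorem holds. The relations force \<open>t r\<close> and \<open>s j\<close> themselves to commute up to the
  scalar \<open>q\<close> (lemma \<open>t_s\<close>). So the products of a monomial \<open>s\<^sub>\<mu> s\<^sub>\<nu>\<^sup>\<star>\<close> in the first family and a
  monomial \<open>t\<^sub>\<alpha> t\<^sub>\<beta>\<^sup>\<star>\<close> in the second span a dense *-subalgebra, graded by pairs of integers through
  the differences of the word lengths. Write \<open>M\<close> for the ideal of the theorem; modulo \<open>M\<close>
  both \<open>Q\<close> and \<open>P\<close> are the unit.

  Let \<open>J\<close> be a proper closed ideal and let \<open>b\<close> be a polynomial in words of length at most \<open>N\<close>. The
  argument of Cuntz for the simplicity of his algebras gives a contraction \<open>V\<close>, built
  from the isometries \<open>T\<^sub>p = s\<^sub>u t\<^sub>v\<close> with \<open>u\<close> and \<open>v\<close> of length \<open>N\<close>, such that \<open>V\<^sup>\<star> b V\<close> lies in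
  the matrix algebra spanned by the \<open>T\<^sub>p T\<^sub>p\<^sub>'\<^sup>\<star>\<close> and agrees modulo \<open>M\<close> with the part of \<open>b\<close> of degree
  zero. On this matrix algebra the distance to \<open>J\<close> is the norm (\<open>corner_norm_le\<close>). Hence
  the degree zero part of \<open>b\<close> is as close to \<open>M\<close> as \<open>b\<close> is to \<open>J\<close> (\<open>expectation_near\<close>).

  The universal property supplies gauge automorphisms \<open>s j \<mapsto> z s j\<close>, \<open>t r \<mapsto> w t r\<close>. Averaging them
  against characters extracts the Fourier modes of an arbitrary element. After multiplication by
  isometries every mode becomes the one of degree zero, so the previous step shows that all modes
  of an element of \<open>J\<close> lie in \<open>M\<close> (\<open>mode_near\<close>). Since the gauge automorphisms are contractive, an
  element is the limit of its Fejer means, which are finite combinations of its modes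
  (\<open>fejer_mean_poly\<close>). Therefore \<open>J \<subseteq> M\<close> (\<open>proper_ideal_subset\<close>). Recovering
  an element from all its modes takes the place of the faithfulness of the conditional expectation,
  and averages over roots of unity take the place of integrals over the torus.

  That \<open>M\<close> is proper is seen in a representation by operators on a Hilbert space in which both range
  sums are the unit (\<open>full_representation\<close>): the kernel of the homomorphism from the universal
  algebra is a closed ideal that contains both generators of \<open>M\<close> and omits \<open>1\<close>.
\<close>

section \<open>Elementary facts on C*-algebras\<close>

context unital_cstar_algebra
begin

abbreviation star :: "'a \<Rightarrow> 'a" ("_\<^sup>\<star>" [1000] 999) where "x\<^sup>\<star> \<equiv> adj A x"

declare smult_closed [simp] adj_closed [simp] adj_adj [simp] smult_one [simp]

lemma smult_zero_left [simp]: "x \<in> carrier A \<Longrightarrow> 0 \<odot> x = \<zero>"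
proof -
  assume x: "x \<in> carrier A"
  have "0 \<odot> x \<oplus> 0 \<odot> x = 0 \<odot> x" using smult_add_left[OF x, of 0 0] by simp
  then show "0 \<odot> x = \<zero>" using smult_closed[OF x] by (simp add: add.l_cancel_one)
qed

lemma smult_zero_right [simp]: "c \<odot> \<zero> = \<zero>"
proof -
  have "c \<odot> \<zero> \<oplus> c \<odot> \<zero> = c \<odot> \<zero>" using smult_add_right[of \<zero> \<zero> c] by simp
  then show ?thesis using smult_closed[of \<zero> c] by (simp add: add.l_cancel_one)
qed

lemma smult_uminus: "x \<in> carrier A \<Longrightarrow> (- c) \<odot> x = \<ominus> (c \<odot> x)"
  using smult_smult[of x "-1" c] smult_minus_one[of "c \<odot> x"] by simp

lemma smult_a_inv: "x \<in> carrier A \<Longrightarrow> c \<odot> (\<ominus> x) = \<ominus> (c \<odot> x)"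
  using smult_smult[of x c "-1"] smult_minus_one[of x] smult_uminus[of x c] by simp

lemma smult_diff_right:
  "\<lbrakk>x \<in> carrier A; y \<in> carrier A\<rbrakk> \<Longrightarrow> c \<odot> (x \<ominus> y) = c \<odot> x \<ominus> c \<odot> y"
  by (simp add: a_minus_def smult_add_right smult_a_inv)

lemma smult_diff_left: "x \<in> carrier A \<Longrightarrow> (c - d) \<odot> x = c \<odot> x \<ominus> d \<odot> x"
  using smult_add_left[of x c "-d"] by (simp add: a_minus_def smult_uminus)

lemma adj_zero [simp]: "\<zero>\<^sup>\<star> = \<zero>"
  using adj_smult[of \<zero> 0] by simp

lemma adj_one [simp]: "\<one>\<^sup>\<star> = \<one>"
  using adj_mult[of "\<one>" "\<one>\<^sup>\<star>"] by simp

lemma adj_a_inv: "x \<in> carrier A \<Longrightarrow> (\<ominus> x)\<^sup>\<star> = \<ominus> (x\<^sup>\<star>)"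
  using adj_smult[of x "-1"] by (simp add: smult_minus_one)

lemma adj_diff: "\<lbrakk>x \<in> carrier A; y \<in> carrier A\<rbrakk> \<Longrightarrow> (x \<ominus> y)\<^sup>\<star> = x\<^sup>\<star> \<ominus> y\<^sup>\<star>"
  by (simp add: a_minus_def adj_add adj_a_inv)

lemma cnorm_zero [simp]: "cnorm A \<zero> = 0"
  by (simp add: cnorm_eq_0_iff)

lemma cnorm_a_inv [simp]: "x \<in> carrier A \<Longrightarrow> cnorm A (\<ominus> x) = cnorm A x"
  using cnorm_smult[of x "-1"] by (simp add: smult_minus_one)

lemma minus_minus_swap: "\<lbrakk>x \<in> carrier A; y \<in> carrier A\<rbrakk> \<Longrightarrow> \<ominus> (x \<ominus> y) = y \<ominus> x"
  by (simp add: a_minus_def minus_add a_comm)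

lemma cnorm_minus_commute:
  "\<lbrakk>x \<in> carrier A; y \<in> carrier A\<rbrakk> \<Longrightarrow> cnorm A (x \<ominus> y) = cnorm A (y \<ominus> x)"
  using cnorm_a_inv[of "x \<ominus> y"] by (simp add: minus_minus_swap)

lemma cnorm_diff_triangle:
  assumes "x \<in> carrier A" "y \<in> carrier A" "z \<in> carrier A"
  shows "cnorm A (x \<ominus> z) \<le> cnorm A (x \<ominus> y) + cnorm A (y \<ominus> z)"
proof -
  have "x \<ominus> z = (x \<ominus> y) \<oplus> (y \<ominus> z)" using assms by (simp add: a_minus_def a_assoc r_neg1)
  then show ?thesis using assms cnorm_triangle[of "x \<ominus> y" "y \<ominus> z"] by simp
qed

lemma minus_plus_cancel: "\<lbrakk>x \<in> carrier A; y \<in> carrier A\<rbrakk> \<Longrightarrow> (x \<ominus> y) \<oplus> y = x"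
  by (simp add: a_minus_def a_assoc l_neg)

lemma diff_self [simp]: "x \<in> carrier A \<Longrightarrow> x \<ominus> x = \<zero>"
  by (simp add: a_minus_def r_neg)

lemma diff_eq_zero_iff: "\<lbrakk>x \<in> carrier A; y \<in> carrier A\<rbrakk> \<Longrightarrow> x \<ominus> y = \<zero> \<longleftrightarrow> x = y"
  by (metis a_minus_def minus_equality minus_minus r_neg a_inv_closed)

lemma cnorm_le_diff:
  "\<lbrakk>x \<in> carrier A; y \<in> carrier A\<rbrakk> \<Longrightarrow> cnorm A x \<le> cnorm A (x \<ominus> y) + cnorm A y"
  using cnorm_triangle[of "x \<ominus> y" y] by (simp add: minus_plus_cancel)

lemma diff_diff_add:
  assumes "x \<in> carrier A" "y \<in> carrier A" "u \<in> carrier A" "v \<in> carrier A"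
  shows "(x \<oplus> y) \<ominus> (u \<oplus> v) = (x \<ominus> u) \<oplus> (y \<ominus> v)"
  using assms by (simp add: a_minus_def minus_add a_ac)

lemma minus_minus_eq:
  "\<lbrakk>x \<in> carrier A; y \<in> carrier A; z \<in> carrier A\<rbrakk> \<Longrightarrow> (x \<ominus> y) \<ominus> z = x \<ominus> (y \<oplus> z)"
  by (simp add: a_minus_def minus_add a_ac)

lemma l_distr_diff:
  "\<lbrakk>x \<in> carrier A; y \<in> carrier A; z \<in> carrier A\<rbrakk> \<Longrightarrow> (x \<ominus> y) \<otimes> z = x \<otimes> z \<ominus> y \<otimes> z"
  by (simp add: a_minus_def l_distr l_minus)

lemma r_distr_diff:
  "\<lbrakk>x \<in> carrier A; y \<in> carrier A; z \<in> carrier A\<rbrakk> \<Longrightarrow> z \<otimes> (x \<ominus> y) = z \<otimes> x \<ominus> z \<otimes> y"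
  by (simp add: a_minus_def r_distr r_minus)

lemma cnorm_adj [simp]:
  assumes x: "x \<in> carrier A" shows "cnorm A (x\<^sup>\<star>) = cnorm A x"
proof -
  have le: "cnorm A y \<le> cnorm A (y\<^sup>\<star>)" if y: "y \<in> carrier A" for y
  proof (cases "cnorm A y = 0")
    case True then show ?thesis using cnorm_nonneg[of "y\<^sup>\<star>"] y by simp
  next
    case False
    have "cnorm A y * cnorm A y \<le> cnorm A (y\<^sup>\<star>) * cnorm A y"
      using cstar_identity[OF y] cnorm_mult[of "y\<^sup>\<star>" y] y by (simp add: power2_eq_square)
    then show ?thesis using False cnorm_nonneg[OF y] by simp
  qed
  show ?thesis using le[OF x] le[of "x\<^sup>\<star>"] x by simp
qed

lemma isometry_cnorm_le_one:
  assumes "v \<in> carrier A" "v\<^sup>\<star> \<otimes> v = \<one>" shows "cnorm A v \<le> 1"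
proof -
  have "(cnorm A \<one>)\<^sup>2 = cnorm A \<one>" using cstar_identity[of \<one>] by simp
  then have "cnorm A \<one> \<le> 1" by (cases "cnorm A \<one> = 0") (auto simp: power2_eq_square)
  then have "(cnorm A v)\<^sup>2 \<le> 1" using cstar_identity[of v] assms by simp
  then show ?thesis using power2_le_imp_le[of "cnorm A v" 1] by simp
qed

lemma cnorm_one_le: "cnorm A \<one> \<le> 1"
  by (rule isometry_cnorm_le_one) auto

lemma projection_cnorm_le_one:
  assumes "p \<in> carrier A" "p\<^sup>\<star> \<otimes> p = p" shows "cnorm A p \<le> 1"
proof -
  have "(cnorm A p)\<^sup>2 = cnorm A p" using cstar_identity[of p] assms by simp
  then show ?thesis by (cases "cnorm A p = 0") (auto simp: power2_eq_square)
qed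

lemma cnorm_mult_contraction:
  assumes "x \<in> carrier A" "y \<in> carrier A"
  shows "cnorm A x \<le> 1 \<Longrightarrow> cnorm A (x \<otimes> y) \<le> cnorm A y"
    and "cnorm A x \<le> 1 \<Longrightarrow> cnorm A (y \<otimes> x) \<le> cnorm A y"
  using cnorm_mult[OF assms] cnorm_mult[OF assms(2,1)] cnorm_nonneg[OF assms(2)]
    mult_right_mono[of "cnorm A x" 1 "cnorm A y"] mult_left_mono[of "cnorm A x" 1 "cnorm A y"] by simp_all

lemma finsum_induct_set:
  assumes "finite I" "f \<in> I \<rightarrow> carrier A" and "P \<zero>"
    and "\<And>x i. \<lbrakk>i \<in> I; x \<in> carrier A; P x\<rbrakk> \<Longrightarrow> P (f i \<oplus> x)"
  shows "P (finsum A f I)"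
  using assms
proof (induct I rule: finite_induct)
  case (insert i I)
  then have "f \<in> I \<rightarrow> carrier A" "f i \<in> carrier A" by auto
  with insert show ?case by (simp add: Pi_def)
qed simp

lemma cnorm_finsum:
  assumes "finite I" "f \<in> I \<rightarrow> carrier A"
  shows "cnorm A (finsum A f I) \<le> (\<Sum>i\<in>I. cnorm A (f i))"
  using assms
proof (induct I rule: finite_induct)
  case (insert i I)
  then have f: "f \<in> I \<rightarrow> carrier A" "f i \<in> carrier A" by auto
  have "cnorm A (f i \<oplus> finsum A f I) \<le> cnorm A (f i) + cnorm A (finsum A f I)"
    using f by (intro cnorm_triangle) auto
  with insert f show ?case by (simp add: Pi_def)
qed simp

lemma adj_finsum:
  assumes "finite I" "f \<in> I \<rightarrow> carrier A"
  shows "(finsum A f I)\<^sup>\<star> = finsum A (\<lambda>i. (f i)\<^sup>\<star>) I"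
  using assms by (induct I rule: finite_induct) (auto simp: Pi_def adj_add)

lemma smult_finsum:
  assumes "finite I" "f \<in> I \<rightarrow> carrier A"
  shows "c \<odot> (finsum A f I) = finsum A (\<lambda>i. c \<odot> f i) I"
  using assms by (induct I rule: finite_induct) (auto simp: Pi_def smult_add_right)

lemma finsum_smult_const:
  assumes "finite I" "x \<in> carrier A"
  shows "finsum A (\<lambda>i. c i \<odot> x) I = (\<Sum>i\<in>I. c i) \<odot> x"
  using assms by (induct I rule: finite_induct) (auto simp: Pi_def smult_add_left)

lemma finsum_single:
  assumes "finite I" "j \<in> I" "x \<in> carrier A"
  shows "finsum A (\<lambda>i. if i = j then x else \<zero>) I = x"
  using finsum_singleton[of j I "\<lambda>_. x"] assms by (simp add: eq_commute)

text \<open>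
  Closedness enters all later arguments in this form.
\<close>

lemma closedin_iff_approx:
  "closedin (ctopology A) C \<longleftrightarrow> C \<subseteq> carrier A \<and>
     (\<forall>x\<in>carrier A. (\<forall>e>0. \<exists>y\<in>C. cnorm A (x \<ominus> y) < e) \<longrightarrow> x \<in> C)"
proof -
  interpret M: Metric_space "carrier A" "cdist A" by (rule Metric_space_cdist)
  have "disjnt C (M.mball x r) \<longleftrightarrow> (\<forall>y\<in>C. \<not> cnorm A (x \<ominus> y) < r)"
    if "C \<subseteq> carrier A" "x \<in> carrier A" for x r
    using that by (fastforce simp: disjnt_iff M.in_mball cdist_def)
  then show ?thesis unfolding M.closedin_metric
    by (auto; metis)
qed

text \<open>Completeness enters the theory only through this lemma.\<close>

lemma geometric_sequence_converges:
  assumes x: "\<And>k. x k \<in> carrier A" and r: "0 \<le> r" "r < 1"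
    and d: "\<And>k. cnorm A (x (Suc k) \<ominus> x k) \<le> c * r ^ k"
  obtains l where "l \<in> carrier A" "(\<lambda>k. cnorm A (x k \<ominus> l)) \<longlonglongrightarrow> 0"
proof -
  interpret M: Metric_space "carrier A" "cdist A" by (rule Metric_space_cdist)
  have c: "0 \<le> c" using order_trans[OF cnorm_nonneg d[of 0]] x by simp
  have step: "cnorm A (x (k + j) \<ominus> x k) \<le> c * r ^ k / (1 - r)" for k j
  proof -
    have "cnorm A (x (k + j) \<ominus> x k) \<le> (\<Sum>i<j. c * r ^ (k + i))"
    proof (induct j)
      case 0 then show ?case using x[of k] by (simp add: a_minus_def r_neg)
    next
      case (Suc j)
      have "cnorm A (x (k + Suc j) \<ominus> x k) \<le>
        cnorm A (x (k + Suc j) \<ominus> x (k + j)) + cnorm A (x (k + j) \<ominus> x k)"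
        using x by (intro cnorm_diff_triangle)
      with Suc d[of "k + j"] show ?case by simp
    qed
    also have "\<dots> = c * r ^ k * (\<Sum>i<j. r ^ i)" by (simp add: power_add sum_distrib_left mult.assoc)
    also have "\<dots> \<le> c * r ^ k * (1 / (1 - r))"
    proof (rule mult_left_mono)
      have "(\<Sum>i<j. r ^ i) \<le> (\<Sum>i. r ^ i)" using r by (intro sum_le_suminf summable_geometric) auto
      then show "(\<Sum>i<j. r ^ i) \<le> 1 / (1 - r)" using r suminf_geometric[of r] by simp
    qed (use c r in auto)
    finally show ?thesis by simp
  qed
  have "M.MCauchy x" unfolding M.MCauchy_def
  proof (intro conjI allI impI)
    show "range x \<subseteq> carrier A" using x by auto
    fix e :: real assume e: "0 < e"
    have "(\<lambda>k. c * r ^ k / (1 - r)) \<longlonglongrightarrow> c * 0 / (1 - r)"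
      using r by (intro tendsto_intros LIMSEQ_realpow_zero) auto
    then obtain N where N: "c * r ^ N / (1 - r) < e / 2"
      using e order_tendstoD(2)[of _ 0 sequentially "e/2"] by (fastforce simp: eventually_sequentially)
    show "\<exists>N. \<forall>n n'. N \<le> n \<longrightarrow> N \<le> n' \<longrightarrow> cdist A (x n) (x n') < e"
    proof (intro exI[of _ N] allI impI)
      fix n n' assume "N \<le> n" "N \<le> n'"
      then have "cnorm A (x n \<ominus> x N) < e/2" "cnorm A (x n' \<ominus> x N) < e/2"
        using le_less_trans[OF step[of N "n - N"] N] le_less_trans[OF step[of N "n' - N"] N] by simp_all
      then show "cdist A (x n) (x n') < e"
        using cnorm_diff_triangle[of "x n" "x N" "x n'"] cnorm_minus_commute[of "x N" "x n'"] x by (simp add: cdist_def)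
    qed
  qed
  then obtain l where "limitin M.mtopology x l sequentially" using complete M.mcomplete_def by blast
  then have "l \<in> carrier A" "(\<lambda>k. cdist A (x k) l) \<longlonglongrightarrow> 0" by (auto simp: M.limitin_metric_dist_null)
  then show thesis using that[of l] x by (simp add: cdist_def)
qed

text \<open>
  \<open>near J x r\<close> is the relational form of the bound \<open>r\<close> on the distance of \<open>x\<close> to \<open>J\<close>. For an ideal
  this distance is a submultiplicative seminorm, so estimates in the quotient by \<open>J\<close> can be carried
  out in \<open>A\<close>.
\<close>

definition near :: "'a set \<Rightarrow> 'a \<Rightarrow> real \<Rightarrow> bool" where
  "near J x r \<longleftrightarrow> (\<exists>j\<in>J. cnorm A (x \<ominus> j) \<le> r)"

context
  fixes J assumes J: "ideal J A"
begin

lemma ideal_mem [simp]: "j \<in> J \<Longrightarrow> j \<in> carrier A"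
  using J ideal.Icarr by metis

lemma ideal_add: "\<lbrakk>x \<in> J; y \<in> J\<rbrakk> \<Longrightarrow> x \<oplus> y \<in> J"
  using J by (simp add: additive_subgroup.a_closed ideal_def)

lemma ideal_mult_left: "\<lbrakk>x \<in> carrier A; y \<in> J\<rbrakk> \<Longrightarrow> x \<otimes> y \<in> J"
  using J ideal.I_l_closed by metis

lemma ideal_mult_right: "\<lbrakk>x \<in> carrier A; y \<in> J\<rbrakk> \<Longrightarrow> y \<otimes> x \<in> J"
  using J ideal.I_r_closed by metis

lemma ideal_zero: "\<zero> \<in> J"
  using J by (simp add: additive_subgroup.zero_closed ideal_def)

lemma ideal_smult: "x \<in> J \<Longrightarrow> c \<odot> x \<in> J"
  using ideal_mult_left[of "c \<odot> \<one>" x] smult_mult_left[of \<one> x c] by simp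

lemma ideal_finsum: "\<lbrakk>finite I; f \<in> I \<rightarrow> J\<rbrakk> \<Longrightarrow> finsum A f I \<in> J"
  by (induct I rule: finite_induct) (auto simp: Pi_def ideal_zero ideal_add)

lemma near_mem: "x \<in> J \<Longrightarrow> 0 \<le> r \<Longrightarrow> near J x r"
  unfolding near_def by (rule bexI[of _ x]) (auto simp: diff_self)

lemma near_norm: "x \<in> carrier A \<Longrightarrow> cnorm A x \<le> r \<Longrightarrow> near J x r"
  unfolding near_def by (rule bexI[of _ \<zero>]) (auto simp: a_minus_def ideal_zero)

lemma near_add:
  assumes "near J x r" "near J y r'" "x \<in> carrier A" "y \<in> carrier A"
  shows "near J (x \<oplus> y) (r + r')"
proof -
  obtain i j where ij: "i \<in> J" "j \<in> J" "cnorm A (x \<ominus> i) \<le> r" "cnorm A (y \<ominus> j) \<le> r'"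
    using assms by (auto simp: near_def)
  have "cnorm A ((x \<oplus> y) \<ominus> (i \<oplus> j)) \<le> r + r'"
    using cnorm_triangle[of "x \<ominus> i" "y \<ominus> j"] ij assms by (simp add: diff_diff_add)
  then show ?thesis using ij ideal_add near_def by blast
qed

lemma near_smult:
  assumes "near J x r" "x \<in> carrier A"
  shows "near J (c \<odot> x) (cmod c * r)"
proof -
  obtain j where j: "j \<in> J" "cnorm A (x \<ominus> j) \<le> r" using assms by (auto simp: near_def)
  have "cnorm A (c \<odot> x \<ominus> c \<odot> j) \<le> cmod c * r"
    using j assms mult_left_mono[of _ r "cmod c"] by (simp flip: smult_diff_right add: cnorm_smult)
  then show ?thesis using j ideal_smult near_def by blast
qed

lemma near_mult:
  assumes "near J x r" "near J y r'" "x \<in> carrier A" "y \<in> carrier A"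
  shows "near J (x \<otimes> y) (r * r')"
proof -
  obtain i j where ij: "i \<in> J" "j \<in> J" "cnorm A (x \<ominus> i) \<le> r" "cnorm A (y \<ominus> j) \<le> r'"
    using assms by (auto simp: near_def)
  have car: "i \<in> carrier A" "j \<in> carrier A" using ij by auto
  \<comment> \<open>the element of \<open>J\<close> for which \<open>x y - k\<close> factors as \<open>(x - i) (y - j)\<close>\<close>
  define k where "k = x \<otimes> j \<oplus> i \<otimes> (y \<ominus> j)"
  have "k \<in> J" unfolding k_def
    using ij assms car by (intro ideal_add ideal_mult_left ideal_mult_right) auto
  have "(x \<otimes> y) \<ominus> k = (x \<ominus> i) \<otimes> (y \<ominus> j)"
    using assms car unfolding k_def
    by (simp only: l_distr_diff[of x i] r_distr_diff[of y j x] minus_minus_eq m_closed minus_closed)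
  moreover have "cnorm A ((x \<ominus> i) \<otimes> (y \<ominus> j)) \<le> r * r'"
  proof (rule order_trans[OF cnorm_mult mult_mono])
    show "0 \<le> r" using order_trans[OF cnorm_nonneg ij(3)] assms car by simp
  qed (use assms car ij in \<open>auto simp: cnorm_nonneg\<close>)
  ultimately show ?thesis using \<open>k \<in> J\<close> near_def by metis
qed

lemma near_mono: "near J x r \<Longrightarrow> r \<le> r' \<Longrightarrow> near J x r'"
  unfolding near_def by force

lemma near_nonneg: "near J x r \<Longrightarrow> x \<in> carrier A \<Longrightarrow> 0 \<le> r"
  unfolding near_def by (meson cnorm_nonneg ideal_mem minus_closed order_trans)

lemma near_mult_left:
  "\<lbrakk>near J x r; x \<in> carrier A; v \<in> carrier A; cnorm A v \<le> 1\<rbrakk> \<Longrightarrow> near J (v \<otimes> x) r"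
  using near_mult[OF near_norm[of v 1], of x r] by simp

lemma near_mult_right:
  "\<lbrakk>near J x r; x \<in> carrier A; v \<in> carrier A; cnorm A v \<le> 1\<rbrakk> \<Longrightarrow> near J (x \<otimes> v) r"
  using near_mult[of x r v 1] near_norm[of v 1] by simp

lemma near_perturb:
  assumes "near J x r" "x \<in> carrier A" "y \<in> carrier A" "cnorm A (y \<ominus> x) \<le> e"
  shows "near J y (e + r)"
  using near_add[OF near_norm[of "y \<ominus> x" e] assms(1)] assms by (simp add: minus_plus_cancel)

lemma near_congr:
  assumes "near J x r" "x \<in> carrier A" "y \<in> carrier A" "y \<ominus> x \<in> J"
  shows "near J y r"
  using near_add[OF near_mem[of "y \<ominus> x" 0] assms(1)] assms by (simp add: minus_plus_cancel)

end

lemma closed_ideal_memI: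
  assumes "closed_ideal J A" "x \<in> carrier A" "\<And>e. e > 0 \<Longrightarrow> near J x e"
  shows "x \<in> J"
proof -
  have "\<exists>y\<in>J. cnorm A (x \<ominus> y) < e" if "e > 0" for e
  proof -
    obtain y where "y \<in> J" "cnorm A (x \<ominus> y) \<le> e / 2" using assms(3)[of "e/2", unfolded near_def] \<open>0 < e\<close> half_gt_zero by blast
    then show ?thesis using that by (intro bexI[of _ y]) simp_all
  qed
  then show ?thesis using assms closedin_iff_approx unfolding closed_ideal_def by blast
qed

text \<open>
  Any positive bound is as good as the true distance, which is one: the constant disappears in
  \<open>corner_norm_le\<close>.
\<close>

lemma closed_proper_ideal_one:
  assumes J: "closed_ideal J A" "J \<noteq> carrier A"
  obtains d where "d > 0" "\<And>r. near J \<one> r \<Longrightarrow> d \<le> r"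
proof -
  have "\<one> \<notin> J" using J ideal.one_imp_carrier closed_ideal_def by blast
  then obtain e where e: "e > 0" "\<not> near J \<one> e" using closed_ideal_memI[of J \<one>] J by auto
  have id: "ideal J A" using J closed_ideal_def by blast
  have "e \<le> r" if "near J \<one> r" for r
  proof (rule ccontr)
    assume "\<not> e \<le> r"
    then have "near J \<one> e" by (intro near_mono[OF id that]) simp
    then show False using e by simp
  qed
  then show thesis using that[of e] e by blast
qed

lemma near_scalar:
  assumes J: "ideal J A" and d: "\<And>r. near J \<one> r \<Longrightarrow> d \<le> r" and c: "near J (c \<odot> \<one>) r"
  shows "cmod c * d \<le> r"
proof (cases "c = 0")
  case True then show ?thesis using near_nonneg[OF J c] by simp
next
  case False
  then have "(1 / c) \<odot> (c \<odot> \<one>) = \<one>" by (simp add: smult_smult)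
  then have "near J \<one> (cmod (1 / c) * r)" using near_smult[OF J c, of "1/c"] by simp
  then show ?thesis using d[of "cmod (1 / c) * r"] False by (simp add: norm_divide field_simps)
qed

end

section \<open>Contractivity of *-homomorphisms\<close>

context unital_cstar_algebra
begin

lemma eq_by_limit:
  assumes "x \<in> carrier A" "y \<in> carrier A" "\<And>k. cnorm A (x \<ominus> y) \<le> g k" "g \<longlonglongrightarrow> 0"
  shows "x = y"
proof -
  have "cnorm A (x \<ominus> y) \<le> 0" using assms(3,4) by (intro LIMSEQ_le_const) auto
  then show ?thesis using cnorm_nonneg[of "x \<ominus> y"] cnorm_eq_0_iff[of "x \<ominus> y"] assms(1,2)
    by (simp add: diff_eq_zero_iff)
qed

text \<open>
  A square root of \<open>1 - x\<^sup>2\<close>, found as a fixed point: \<open>y = 1 - z\<close> works if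
  \<open>z = (x\<^sup>2 + z\<^sup>2) / 2\<close>. This map is a contraction of the ball of radius \<open>r = 1 - sqrt (1 - \<parallel>x\<parallel>\<^sup>2)\<close>,
  because \<open>\<parallel>x\<parallel>\<^sup>2 + r\<^sup>2 = 2 r\<close> and \<open>r < 1\<close>, and it preserves self-adjointness and commutation with \<open>x\<close>;
  so its fixed point inherits both.
\<close>

lemma exists_complementary_square:
  assumes x: "x \<in> carrier A" "x\<^sup>\<star> = x" "cnorm A x < 1"
  obtains y where "y \<in> carrier A" "y\<^sup>\<star> = y" "x \<otimes> y = y \<otimes> x" "x \<otimes> x \<oplus> y \<otimes> y = \<one>"
proof -
  define b where "b = x \<otimes> x"
  define \<rho> where "\<rho> = (cnorm A x)\<^sup>2"
  define r where "r = 1 - sqrt (1 - \<rho>)"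
  have \<rho>: "0 \<le> \<rho>" "\<rho> < 1" using x cnorm_nonneg[of x] by (simp_all add: \<rho>_def power_less_one_iff)
  have r: "0 \<le> r" "r < 1" and rr: "\<rho> + r * r = 2 * r"
  proof -
    show "0 \<le> r" "r < 1" using \<rho> by (simp_all add: r_def)
    have "sqrt (1 - \<rho>) * sqrt (1 - \<rho>) = 1 - \<rho>" using \<rho> by simp
    then show "\<rho> + r * r = 2 * r" unfolding r_def by (simp add: algebra_simps)
  qed
  have b: "b \<in> carrier A" "b\<^sup>\<star> = b" "x \<otimes> b = b \<otimes> x"
    using x by (simp_all add: b_def adj_mult m_assoc)
  have nb: "cnorm A b \<le> \<rho>" using cnorm_mult[of x x] x by (simp add: b_def \<rho>_def power2_eq_square)
  define f where "f z = (1/2) \<odot> (b \<oplus> z \<otimes> z)" for z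
  define S where "S = {z \<in> carrier A. z\<^sup>\<star> = z \<and> x \<otimes> z = z \<otimes> x \<and> cnorm A z \<le> r}"
  have fS: "f z \<in> S" if "z \<in> S" for z
  proof -
    from that have z: "z \<in> carrier A" "z\<^sup>\<star> = z" "x \<otimes> z = z \<otimes> x" "cnorm A z \<le> r" by (auto simp: S_def)
    have "x \<otimes> (z \<otimes> z) = (z \<otimes> z) \<otimes> x" using z x by (metis m_assoc)
    then have "x \<otimes> f z = f z \<otimes> x"
      using b z x by (simp add: f_def smult_mult_left smult_mult_right l_distr r_distr)
    moreover have "cnorm A (b \<oplus> z \<otimes> z) \<le> \<rho> + r * r"
      using cnorm_triangle[of b "z \<otimes> z"] cnorm_mult[of z z] nb b z
        mult_mono[of "cnorm A z" r "cnorm A z" r] cnorm_nonneg[of z] r by simp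
    ultimately show ?thesis
      using z b rr by (simp add: S_def f_def adj_smult adj_add adj_mult cnorm_smult)
  qed
  have lip: "cnorm A (f z \<ominus> f w) \<le> r * cnorm A (z \<ominus> w)"
    if "z \<in> carrier A" "w \<in> carrier A" "cnorm A z \<le> r" "cnorm A w \<le> r" for z w
  proof -
    have "z \<otimes> z \<ominus> w \<otimes> w = z \<otimes> (z \<ominus> w) \<oplus> (z \<ominus> w) \<otimes> w"
      using that by (simp add: l_distr_diff r_distr_diff) (simp add: a_minus_def a_assoc r_neg1)
    moreover have "cnorm A (z \<otimes> (z \<ominus> w)) \<le> r * cnorm A (z \<ominus> w)"
      using that by (intro order_trans[OF cnorm_mult mult_right_mono]) (auto simp: cnorm_nonneg)
    moreover have "cnorm A ((z \<ominus> w) \<otimes> w) \<le> r * cnorm A (z \<ominus> w)"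
      using that by (subst mult.commute, intro order_trans[OF cnorm_mult mult_left_mono]) (auto simp: cnorm_nonneg)
    moreover have "cnorm A (z \<otimes> (z \<ominus> w) \<oplus> (z \<ominus> w) \<otimes> w)
        \<le> cnorm A (z \<otimes> (z \<ominus> w)) + cnorm A ((z \<ominus> w) \<otimes> w)"
      using that by (intro cnorm_triangle) auto
    ultimately have *: "cnorm A (z \<otimes> z \<ominus> w \<otimes> w) \<le> 2 * (r * cnorm A (z \<ominus> w))" by simp
    have "f z \<ominus> f w = (1/2) \<odot> (z \<otimes> z \<ominus> w \<otimes> w)"
      using that b by (simp add: f_def diff_diff_add flip: smult_diff_right)
    then show ?thesis using * that by (simp add: cnorm_smult)
  qed
  define zs where "zs k = (f ^^ k) \<zero>" for k
  have zsS: "zs k \<in> S" for k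
  proof (induct k)
    case 0 then show ?case using x r by (simp add: zs_def S_def)
  next
    case (Suc k) then show ?case using fS by (simp add: zs_def)
  qed
  then have zsc: "zs k \<in> carrier A" "cnorm A (zs k) \<le> r" "(zs k)\<^sup>\<star> = zs k"
      "x \<otimes> zs k = zs k \<otimes> x" for k by (auto simp: S_def)
  have zsSuc: "zs (Suc k) = f (zs k)" for k by (simp add: zs_def)
  define c where "c = cnorm A (zs 1 \<ominus> zs 0)"
  have "cnorm A (zs (Suc k) \<ominus> zs k) \<le> c * r ^ k" for k
  proof (induct k)
    case 0 then show ?case by (simp add: c_def)
  next
    case (Suc k)
    have "cnorm A (zs (Suc (Suc k)) \<ominus> zs (Suc k)) \<le> r * cnorm A (zs (Suc k) \<ominus> zs k)"
      using lip[OF zsc(1) zsc(1) zsc(2) zsc(2), of "Suc k" k] by (simp only: zsSuc[symmetric])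
    also have "\<dots> \<le> r * (c * r ^ k)" using Suc r by (intro mult_left_mono)
    finally show ?case by (simp add: mult_ac)
  qed
  then obtain z where z: "z \<in> carrier A" and lim: "(\<lambda>k. cnorm A (zs k \<ominus> z)) \<longlonglongrightarrow> 0"
    using geometric_sequence_converges[of zs r c] zsc(1) r by blast
  have nz: "cnorm A z \<le> r"
  proof (rule LIMSEQ_le_const)
    show "(\<lambda>k. cnorm A (zs k \<ominus> z) + r) \<longlonglongrightarrow> r" using tendsto_add[OF lim tendsto_const[of r]] by simp
    show "\<exists>N. \<forall>n\<ge>N. cnorm A z \<le> cnorm A (zs n \<ominus> z) + r"
    proof (intro exI allI impI)
      fix k
      show "cnorm A z \<le> cnorm A (zs k \<ominus> z) + r"
        using cnorm_le_diff[of z "zs k"] cnorm_minus_commute[of z "zs k"] z zsc[of k] by simp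
    qed
  qed
  have fz: "f z = z"
  proof (rule eq_by_limit)
    show "f z \<in> carrier A" "z \<in> carrier A" using z b by (simp_all add: f_def)
    show "cnorm A (f z \<ominus> z) \<le> r * cnorm A (zs k \<ominus> z) + cnorm A (zs (Suc k) \<ominus> z)" for k
      using cnorm_diff_triangle[of "f z" "zs (Suc k)" z] lip[of "zs k" z] z nz zsc[of k] zsc[of "Suc k"] b
        cnorm_minus_commute[of "f z" "f (zs k)"] by (simp add: zsSuc f_def)
    show "(\<lambda>k. r * cnorm A (zs k \<ominus> z) + cnorm A (zs (Suc k) \<ominus> z)) \<longlonglongrightarrow> 0"
      using tendsto_add[OF tendsto_mult_right_zero[OF lim, of r] LIMSEQ_Suc[OF lim]] by simp
  qed
  have za: "z\<^sup>\<star> = z"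
  proof (rule eq_by_limit)
    fix k
    have "cnorm A (z\<^sup>\<star> \<ominus> zs k) = cnorm A (zs k \<ominus> z)"
      using cnorm_adj[of "z \<ominus> zs k"] cnorm_minus_commute[of z "zs k"] z zsc[of k] by (simp add: adj_diff)
    then show "cnorm A (z\<^sup>\<star> \<ominus> z) \<le> 2 * cnorm A (zs k \<ominus> z)"
      using cnorm_diff_triangle[of "z\<^sup>\<star>" "zs k" z] z zsc[of k] by simp
  qed (use z tendsto_mult_right_zero[OF lim, of 2] in auto)
  have zx: "x \<otimes> z = z \<otimes> x"
  proof (rule eq_by_limit)
    fix k
    have "cnorm A (x \<otimes> z \<ominus> x \<otimes> zs k) \<le> cnorm A (zs k \<ominus> z)"
      using cnorm_mult_contraction(1)[of x "z \<ominus> zs k"] cnorm_minus_commute[of z "zs k"] x z zsc[of k]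
      by (simp add: r_distr_diff)
    moreover have "cnorm A (zs k \<otimes> x \<ominus> z \<otimes> x) \<le> cnorm A (zs k \<ominus> z)"
      using cnorm_mult_contraction(2)[of x "zs k \<ominus> z"] x z zsc[of k] by (simp add: l_distr_diff)
    ultimately show "cnorm A (x \<otimes> z \<ominus> z \<otimes> x) \<le> 2 * cnorm A (zs k \<ominus> z)"
      using cnorm_diff_triangle[of "x \<otimes> z" "x \<otimes> zs k" "z \<otimes> x"] x z zsc[of k] by simp
  qed (use x z tendsto_mult_right_zero[OF lim, of 2] in auto)
  have "z \<oplus> z = 2 \<odot> z" using smult_add_left[of z 1 1] z by simp
  also have "\<dots> = b \<oplus> z \<otimes> z" using smult_smult[of "b \<oplus> z \<otimes> z" 2 "1/2"] fz b z by (simp add: f_def)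
  finally have zz: "z \<oplus> z = b \<oplus> z \<otimes> z" .
  have sq: "(\<one> \<ominus> z) \<otimes> (\<one> \<ominus> z) = (\<one> \<oplus> z \<otimes> z) \<ominus> (z \<oplus> z)"
    using z by (simp add: l_distr_diff r_distr_diff) (simp add: a_minus_def minus_add a_ac)
  have "b \<oplus> (\<one> \<ominus> z) \<otimes> (\<one> \<ominus> z) = \<one>"
    unfolding sq zz using z b by (simp add: a_minus_def minus_add a_ac r_neg r_neg1 r_neg2)
      (simp add: a_lcomm[of b \<one> "\<ominus> b"] r_neg)
  then show thesis using that[of "\<one> \<ominus> z"] x z zx za
    by (simp add: b_def adj_diff l_distr_diff r_distr_diff)
qed

text \<open>
  With \<open>x\<^sup>2 + y\<^sup>2 = 1\<close> for commuting self-adjoint \<open>x\<close> and \<open>y\<close>, the element \<open>x + \<i> y\<close> is an isometry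
  whose real part is \<open>x\<close>.
\<close>

lemma selfadjoint_unitary_average:
  assumes x: "x \<in> carrier A" "x\<^sup>\<star> = x" "cnorm A x < 1"
  obtains u where "u \<in> carrier A" "u\<^sup>\<star> \<otimes> u = \<one>" "x = (1/2) \<odot> (u \<oplus> u\<^sup>\<star>)"
proof -
  obtain y where y: "y \<in> carrier A" "y\<^sup>\<star> = y" "x \<otimes> y = y \<otimes> x" "x \<otimes> x \<oplus> y \<otimes> y = \<one>"
    using exists_complementary_square[OF x] by blast
  define w where "w = \<i> \<odot> y"
  have w: "w \<in> carrier A" "w\<^sup>\<star> = \<ominus> w" "x \<otimes> w = w \<otimes> x" "w \<otimes> w = \<ominus> (y \<otimes> y)"
    using y x smult_uminus[of y \<i>]
    by (simp_all add: w_def adj_smult smult_mult_left smult_mult_right smult_smult smult_minus_one)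
  have "(x \<oplus> w)\<^sup>\<star> \<otimes> (x \<oplus> w) = x \<otimes> x \<oplus> y \<otimes> y"
  proof -
    have "(x \<oplus> w)\<^sup>\<star> \<otimes> (x \<oplus> w) = (x \<otimes> x \<oplus> w \<otimes> x) \<oplus> (\<ominus> (w \<otimes> x) \<oplus> \<ominus> (w \<otimes> w))"
    proof -
      have "(x \<oplus> w)\<^sup>\<star> = x \<oplus> \<ominus> w" using x w(1,2) by (simp only: adj_add)
      then have "(x \<oplus> w)\<^sup>\<star> \<otimes> (x \<oplus> w) = x \<otimes> (x \<oplus> w) \<oplus> (\<ominus> w) \<otimes> (x \<oplus> w)"
        using x(1) w(1) by (simp only: l_distr a_inv_closed a_closed)
      then show ?thesis using x(1) w(1) w(3) by (simp only: r_distr l_minus a_inv_closed)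
    qed
    also have "\<dots> = x \<otimes> x \<oplus> y \<otimes> y"
      unfolding w(4) using x(1) y(1) w(1) by (simp add: a_assoc r_neg2)
    finally show ?thesis .
  qed
  moreover have "(1/2) \<odot> ((x \<oplus> w) \<oplus> (x \<oplus> w)\<^sup>\<star>) = x"
  proof -
    have "(x \<oplus> w) \<oplus> (x \<oplus> w)\<^sup>\<star> = x \<oplus> x" using x w(1,2)
      by (simp add: adj_add a_assoc) (simp add: a_lcomm[of w x] r_neg)
    also have "\<dots> = 2 \<odot> x" using smult_add_left[of x 1 1] x by simp
    finally show ?thesis using x by (simp add: smult_smult)
  qed
  ultimately show thesis using that[of "x \<oplus> w"] x y w by simp
qed

end

text \<open>
  A unital *-homomorphism maps isometries to isometries, hence the real parts of isometries into the
  unit ball. By the previous lemma these include all self-adjoint elements of norm less than one,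
  and the C*-identity reduces the general case to self-adjoint elements.
\<close>

lemma star_hom_contractive:
  assumes A: "unital_cstar_algebra A" and B: "unital_cstar_algebra B"
    and h: "h \<in> star_hom A B" and x: "x \<in> carrier A"
  shows "cnorm B (h x) \<le> cnorm A x"
proof -
  interpret A: unital_cstar_algebra A by fact
  interpret B: unital_cstar_algebra B by fact
  have rh: "h \<in> ring_hom A B" and hs: "\<And>x c. x \<in> carrier A \<Longrightarrow> h (c \<odot>\<^bsub>A\<^esub> x) = c \<odot>\<^bsub>B\<^esub> h x"
    and ha: "\<And>x. x \<in> carrier A \<Longrightarrow> h (adj A x) = adj B (h x)"
    using h by (auto simp: star_hom_def)
  note hc = ring_hom_closed[OF rh] ring_hom_mult[OF rh] ring_hom_add[OF rh] ring_hom_one[OF rh]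
  have unit_ball: "cnorm B (h x) \<le> 1" if x: "x \<in> carrier A" "adj A x = x" "cnorm A x < 1" for x
  proof -
    obtain u where u: "u \<in> carrier A" "adj A u \<otimes>\<^bsub>A\<^esub> u = \<one>\<^bsub>A\<^esub>" "x = (1/2) \<odot>\<^bsub>A\<^esub> (u \<oplus>\<^bsub>A\<^esub> adj A u)"
      using A.selfadjoint_unitary_average[OF x] by blast
    have hu: "h u \<in> carrier B" using u hc by blast
    have "cnorm B (h u) \<le> 1"
    proof (rule B.isometry_cnorm_le_one[OF hu])
      show "adj B (h u) \<otimes>\<^bsub>B\<^esub> h u = \<one>\<^bsub>B\<^esub>" using u hc hs ha by (metis A.adj_closed)
    qed
    moreover have "h x = (1/2) \<odot>\<^bsub>B\<^esub> (h u \<oplus>\<^bsub>B\<^esub> adj B (h u))"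
      using u hc hs ha by simp
    ultimately show ?thesis
      using B.cnorm_triangle[of "h u" "adj B (h u)"] hu by (simp add: B.cnorm_smult)
  qed
  have selfadj: "cnorm B (h x) \<le> cnorm A x" if x: "x \<in> carrier A" "adj A x = x" for x
  proof (rule dense_ge)
    fix r assume r: "cnorm A x < r"
    then have r0: "0 < r" using A.cnorm_nonneg[OF x(1)] by linarith
    define y where "y = (1 / complex_of_real r) \<odot>\<^bsub>A\<^esub> x"
    have "cnorm B (h y) \<le> 1"
      using x r r0 by (intro unit_ball) (auto simp: y_def A.adj_smult A.cnorm_smult norm_divide)
    moreover have "cnorm B (h y) = cnorm B (h x) / r"
      using x r0 hc hs by (simp add: y_def B.cnorm_smult norm_divide)
    ultimately show "cnorm B (h x) \<le> r" using r0 by simp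
  qed
  have "(cnorm B (h x))\<^sup>2 = cnorm B (h (adj A x \<otimes>\<^bsub>A\<^esub> x))"
    using x hc ha B.cstar_identity[of "h x"] by simp
  also have "\<dots> \<le> (cnorm A x)\<^sup>2"
  proof -
    have "adj A (adj A x \<otimes>\<^bsub>A\<^esub> x) = adj A x \<otimes>\<^bsub>A\<^esub> x" using x by (simp add: A.adj_mult)
    then show ?thesis using selfadj[of "adj A x \<otimes>\<^bsub>A\<^esub> x"] x
      unfolding A.cstar_identity[OF x] by (metis A.adj_closed A.m_closed)
  qed
  finally show ?thesis using A.cnorm_nonneg[OF x] by (rule power2_le_imp_le)
qed

section \<open>Matrix algebras spanned by isometries with orthogonal ranges\<close>

locale isometry_family = unital_cstar_algebra A for A :: "'a cstar" (structure) +
  fixes I :: "'i set" and T :: "'i \<Rightarrow> 'a"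
  assumes finite_I: "finite I"
    and T_closed [simp]: "i \<in> I \<Longrightarrow> T i \<in> carrier A"
    and T_orth: "\<lbrakk>i \<in> I; j \<in> I\<rbrakk> \<Longrightarrow> (T i)\<^sup>\<star> \<otimes> T j = (if i = j then \<one> else \<zero>)"
begin

lemma T_norm: "i \<in> I \<Longrightarrow> cnorm A (T i) \<le> 1"
  by (rule isometry_cnorm_le_one) (auto simp: T_orth)

text \<open>
  The amplification of \<open>w\<close>: the matrix with \<open>w\<close> in each diagonal entry with respect to the matrix
  units \<open>T i (T j)\<^sup>\<star>\<close>. In particular \<open>amp \<one>\<close> is the sum of the range projections.
\<close>

definition amp :: "'a \<Rightarrow> 'a" where
  "amp w = (\<Oplus>i\<in>I. T i \<otimes> w \<otimes> (T i)\<^sup>\<star>)"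

lemma amp_closed [simp]: "w \<in> carrier A \<Longrightarrow> amp w \<in> carrier A"
  unfolding amp_def by (rule finsum_closed) auto

lemma adj_amp: "w \<in> carrier A \<Longrightarrow> (amp w)\<^sup>\<star> = amp (w\<^sup>\<star>)"
  unfolding amp_def
  by (subst adj_finsum) (auto simp: finite_I adj_mult m_assoc intro!: finsum_cong')

lemma adj_T_amp:
  assumes "w \<in> carrier A" "j \<in> I" shows "(T j)\<^sup>\<star> \<otimes> amp w = w \<otimes> (T j)\<^sup>\<star>"
proof -
  have "(T j)\<^sup>\<star> \<otimes> amp w = (\<Oplus>i\<in>I. (T j)\<^sup>\<star> \<otimes> (T i \<otimes> w \<otimes> (T i)\<^sup>\<star>))"
    unfolding amp_def using assms finite_I by (subst finsum_rdistr) auto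
  also have "\<dots> = (\<Oplus>i\<in>I. if i = j then w \<otimes> (T j)\<^sup>\<star> else \<zero>)"
    using assms by (intro finsum_cong') (auto simp: T_orth simp flip: m_assoc)
  finally show ?thesis using assms finite_I by (simp add: finsum_single)
qed

lemma amp_T:
  assumes "w \<in> carrier A" "j \<in> I" shows "amp w \<otimes> T j = T j \<otimes> w"
proof -
  have "amp w \<otimes> T j = ((T j)\<^sup>\<star> \<otimes> amp (w\<^sup>\<star>))\<^sup>\<star>" using assms by (simp add: adj_mult adj_amp)
  then show ?thesis using assms by (simp add: adj_T_amp adj_mult)
qed

lemma amp_mult:
  assumes "w \<in> carrier A" "w' \<in> carrier A" shows "amp w \<otimes> amp w' = amp (w \<otimes> w')"
proof -
  have "amp w \<otimes> amp w' = (\<Oplus>i\<in>I. amp w \<otimes> (T i \<otimes> w' \<otimes> (T i)\<^sup>\<star>))"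
    unfolding amp_def[of w'] using assms finite_I by (subst finsum_rdistr) auto
  also have "\<dots> = amp (w \<otimes> w')"
  proof -
    have "amp w \<otimes> (T i \<otimes> w' \<otimes> (T i)\<^sup>\<star>) = T i \<otimes> (w \<otimes> w') \<otimes> (T i)\<^sup>\<star>" if "i \<in> I" for i
    proof -
      have "amp w \<otimes> (T i \<otimes> w' \<otimes> (T i)\<^sup>\<star>) = (amp w \<otimes> T i) \<otimes> w' \<otimes> (T i)\<^sup>\<star>"
        using assms that by (simp add: m_assoc)
      then show ?thesis using assms that by (simp add: amp_T m_assoc)
    qed
    then show ?thesis unfolding amp_def[of "w \<otimes> w'"] using assms by (intro finsum_cong') auto
  qed
  finally show ?thesis .
qed

lemma amp_isometry_norm:
  assumes "w \<in> carrier A" "w\<^sup>\<star> \<otimes> w = \<one>" shows "cnorm A (amp w) \<le> 1"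
proof -
  have "cnorm A (amp \<one>) \<le> 1"
    by (rule projection_cnorm_le_one) (auto simp: adj_amp amp_mult)
  moreover have "(cnorm A (amp w))\<^sup>2 = cnorm A (amp \<one>)"
    using assms cstar_identity[of "amp w"] by (simp add: adj_amp amp_mult)
  ultimately show ?thesis using power2_le_imp_le[of "cnorm A (amp w)" 1] by simp
qed

text \<open>
  The linear span of the matrix units \<open>T i (T j)\<^sup>\<star>\<close>, described by the entries of its elements.
\<close>

definition corner :: "'a set" where
  "corner = {y \<in> carrier A. amp \<one> \<otimes> y = y \<and> y \<otimes> amp \<one> = y \<and>
     (\<forall>i\<in>I. \<forall>j\<in>I. \<exists>c. (T i)\<^sup>\<star> \<otimes> y \<otimes> T j = c \<odot> \<one>)}"

lemma corner_adj: assumes y: "y \<in> corner" shows "y\<^sup>\<star> \<in> corner"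
proof -
  have y': "y \<in> carrier A" "amp \<one> \<otimes> y = y" "y \<otimes> amp \<one> = y" using y by (auto simp: corner_def)
  have "amp \<one> \<otimes> y\<^sup>\<star> = (y \<otimes> amp \<one>)\<^sup>\<star>" "y\<^sup>\<star> \<otimes> amp \<one> = (amp \<one> \<otimes> y)\<^sup>\<star>"
    using y'(1) by (simp_all add: adj_mult adj_amp)
  then have "amp \<one> \<otimes> y\<^sup>\<star> = y\<^sup>\<star>" "y\<^sup>\<star> \<otimes> amp \<one> = y\<^sup>\<star>" using y' by auto
  moreover have "\<exists>c. (T i)\<^sup>\<star> \<otimes> y\<^sup>\<star> \<otimes> T j = c \<odot> \<one>" if ij: "i \<in> I" "j \<in> I" for i j
  proof -
    obtain c where c: "(T j)\<^sup>\<star> \<otimes> y \<otimes> T i = c \<odot> \<one>" using y ij by (auto simp: corner_def)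
    have "(T i)\<^sup>\<star> \<otimes> y\<^sup>\<star> \<otimes> T j = ((T j)\<^sup>\<star> \<otimes> y \<otimes> T i)\<^sup>\<star>"
      using y'(1) ij by (simp add: adj_mult m_assoc)
    then show ?thesis unfolding c by (metis adj_one adj_smult one_closed)
  qed
  ultimately show ?thesis using y' by (simp add: corner_def)
qed

lemma compress_mult:
  assumes "y \<in> carrier A" "z \<in> carrier A" "y \<otimes> amp \<one> = y" "i \<in> I" "j \<in> I"
  shows "(T i)\<^sup>\<star> \<otimes> (y \<otimes> z) \<otimes> T j = (\<Oplus>l\<in>I. ((T i)\<^sup>\<star> \<otimes> y \<otimes> T l) \<otimes> ((T l)\<^sup>\<star> \<otimes> z \<otimes> T j))"
proof -
  let ?a = "(T i)\<^sup>\<star> \<otimes> y" and ?b = "z \<otimes> T j"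
  have "(T i)\<^sup>\<star> \<otimes> (y \<otimes> z) \<otimes> T j = ?a \<otimes> (amp \<one> \<otimes> ?b)"
    using assms by (metis (no_types, lifting) T_closed adj_closed amp_closed m_assoc m_closed one_closed)
  also have "amp \<one> \<otimes> ?b = (\<Oplus>l\<in>I. (T l \<otimes> \<one> \<otimes> (T l)\<^sup>\<star>) \<otimes> ?b)"
    unfolding amp_def using assms finite_I by (subst finsum_ldistr) auto
  also have "?a \<otimes> \<dots> = (\<Oplus>l\<in>I. ?a \<otimes> ((T l \<otimes> \<one> \<otimes> (T l)\<^sup>\<star>) \<otimes> ?b))"
    using assms finite_I by (subst finsum_rdistr) auto
  also have "\<dots> = (\<Oplus>l\<in>I. (?a \<otimes> T l) \<otimes> ((T l)\<^sup>\<star> \<otimes> z \<otimes> T j))"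
    using assms by (intro finsum_cong') (auto simp: m_assoc)
  finally show ?thesis .
qed

lemma corner_mult: assumes y: "y \<in> corner" and z: "z \<in> corner" shows "y \<otimes> z \<in> corner"
proof -
  have y': "y \<in> carrier A" "amp \<one> \<otimes> y = y" "y \<otimes> amp \<one> = y" using y by (auto simp: corner_def)
  have z': "z \<in> carrier A" "amp \<one> \<otimes> z = z" "z \<otimes> amp \<one> = z" using z by (auto simp: corner_def)
  have e: "amp \<one> \<in> carrier A" by simp
  have "amp \<one> \<otimes> (y \<otimes> z) = y \<otimes> z" using m_assoc[OF e y'(1) z'(1)] y' by simp
  moreover have "(y \<otimes> z) \<otimes> amp \<one> = y \<otimes> z" using m_assoc[OF y'(1) z'(1) e] z' by simp
  moreover have "\<exists>c. (T i)\<^sup>\<star> \<otimes> (y \<otimes> z) \<otimes> T j = c \<odot> \<one>" if ij: "i \<in> I" "j \<in> I" for i j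
    unfolding compress_mult[OF y'(1) z'(1) y'(3) ij]
  proof (rule finsum_induct_set[where P = "\<lambda>x. \<exists>c. x = c \<odot> \<one>"])
    show "\<exists>c. \<zero> = c \<odot> \<one>" by (rule exI[of _ 0]) simp
    fix x l assume l: "l \<in> I" and "\<exists>c. x = c \<odot> \<one>"
    then obtain c where c: "x = c \<odot> \<one>" by blast
    obtain d where d: "(T i)\<^sup>\<star> \<otimes> y \<otimes> T l = d \<odot> \<one>" using y l ij by (auto simp: corner_def)
    obtain e where e: "(T l)\<^sup>\<star> \<otimes> z \<otimes> T j = e \<odot> \<one>" using z l ij by (auto simp: corner_def)
    show "\<exists>c. ((T i)\<^sup>\<star> \<otimes> y \<otimes> T l) \<otimes> ((T l)\<^sup>\<star> \<otimes> z \<otimes> T j) \<oplus> x = c \<odot> \<one>"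
      unfolding c d e by (rule exI[of _ "d * e + c"]) (simp add: smult_mult_left smult_smult smult_add_left)
  qed (use finite_I y' z' ij in auto)
  ultimately show ?thesis using y' z' by (simp add: corner_def)
qed

lemma corner_norm_le_sum:
  assumes "y \<in> corner"
  shows "cnorm A y \<le> (\<Sum>j\<in>I. \<Sum>i\<in>I. cnorm A ((T i)\<^sup>\<star> \<otimes> y \<otimes> T j))"
proof -
  have y: "y \<in> carrier A" "amp \<one> \<otimes> y = y" "y \<otimes> amp \<one> = y" using assms by (auto simp: corner_def)
  have contr: "cnorm A (u \<otimes> (T j)\<^sup>\<star>) \<le> cnorm A u" "cnorm A (T j \<otimes> u) \<le> cnorm A u"
    if "j \<in> I" "u \<in> carrier A" for j u
    using that T_norm by (auto intro: cnorm_mult_contraction)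
  have "y = (\<Oplus>j\<in>I. y \<otimes> T j \<otimes> (T j)\<^sup>\<star>)"
  proof -
    have "y = (\<Oplus>j\<in>I. y \<otimes> (T j \<otimes> \<one> \<otimes> (T j)\<^sup>\<star>))"
      using finsum_rdistr[OF finite_I y(1), of "\<lambda>j. T j \<otimes> \<one> \<otimes> (T j)\<^sup>\<star>"] y(3) by (simp add: amp_def)
    also have "\<dots> = (\<Oplus>j\<in>I. y \<otimes> T j \<otimes> (T j)\<^sup>\<star>)"
      using y(1) by (intro finsum_cong') (auto simp: m_assoc)
    finally show ?thesis .
  qed
  then have "cnorm A y \<le> (\<Sum>j\<in>I. cnorm A (y \<otimes> T j \<otimes> (T j)\<^sup>\<star>))"
    using cnorm_finsum[OF finite_I, of "\<lambda>j. y \<otimes> T j \<otimes> (T j)\<^sup>\<star>"] y by (simp add: Pi_def)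
  also have "\<dots> \<le> (\<Sum>j\<in>I. \<Sum>i\<in>I. cnorm A ((T i)\<^sup>\<star> \<otimes> y \<otimes> T j))"
  proof (rule sum_mono)
    fix j assume j: "j \<in> I"
    have "y \<otimes> T j = (amp \<one> \<otimes> y) \<otimes> T j" using y by simp
    also have "\<dots> = (\<Oplus>i\<in>I. T i \<otimes> \<one> \<otimes> (T i)\<^sup>\<star> \<otimes> y \<otimes> T j)"
      unfolding amp_def using j y(1) finite_I by (simp add: finsum_ldistr Pi_def)
    also have "\<dots> = (\<Oplus>i\<in>I. T i \<otimes> ((T i)\<^sup>\<star> \<otimes> y \<otimes> T j))"
      using j y(1) by (intro finsum_cong') (auto simp: m_assoc)
    finally have "y \<otimes> T j = (\<Oplus>i\<in>I. T i \<otimes> ((T i)\<^sup>\<star> \<otimes> y \<otimes> T j))" .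
    then have "cnorm A (y \<otimes> T j) \<le> (\<Sum>i\<in>I. cnorm A (T i \<otimes> ((T i)\<^sup>\<star> \<otimes> y \<otimes> T j)))"
      using cnorm_finsum[OF finite_I, of "\<lambda>i. T i \<otimes> ((T i)\<^sup>\<star> \<otimes> y \<otimes> T j)"] y j by (simp add: Pi_def)
    also have "\<dots> \<le> (\<Sum>i\<in>I. cnorm A ((T i)\<^sup>\<star> \<otimes> y \<otimes> T j))"
      using y j by (intro sum_mono contr) auto
    finally show "cnorm A (y \<otimes> T j \<otimes> (T j)\<^sup>\<star>) \<le> (\<Sum>i\<in>I. cnorm A ((T i)\<^sup>\<star> \<otimes> y \<otimes> T j))"
      using contr(1)[OF j, of "y \<otimes> T j"] y j by simp
  qed
  finally show ?thesis .
qed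

text \<open>
  Since the entries are scalars and a scalar near \<open>J\<close> is small, distance to \<open>J\<close> controls the entries
  and with them, up to a constant depending on the size of the matrices, the norm.
\<close>

lemma corner_norm_le_near:
  assumes J: "closed_ideal J A" "J \<noteq> carrier A"
  obtains C where "\<And>y r. \<lbrakk>y \<in> corner; near J y r\<rbrakk> \<Longrightarrow> cnorm A y \<le> C * r"
proof -
  obtain d where d: "d > 0" "\<And>r. near J \<one> r \<Longrightarrow> d \<le> r" using closed_proper_ideal_one[OF J] by blast
  have id: "ideal J A" using J closed_ideal_def by blast
  show thesis
  proof (rule that[of "of_nat (card I) * (of_nat (card I) * (1 / d))"])
    fix y r assume y: "y \<in> corner" and n: "near J y r"
    have yc: "y \<in> carrier A" using y by (simp add: corner_def)
    have entry: "cnorm A ((T i)\<^sup>\<star> \<otimes> y \<otimes> T j) \<le> r / d" if ij: "i \<in> I" "j \<in> I" for i j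
    proof -
      obtain c where c: "(T i)\<^sup>\<star> \<otimes> y \<otimes> T j = c \<odot> \<one>" using y ij by (auto simp: corner_def)
      have "near J (c \<odot> \<one>) r"
        unfolding c[symmetric] using ij yc T_norm
        by (intro near_mult_right[OF id] near_mult_left[OF id] n) auto
      then have "cmod c * d \<le> r" using near_scalar[OF id d(2)] by blast
      moreover have "cnorm A (c \<odot> \<one>) \<le> cmod c * 1"
        using cnorm_one_le by (simp only: cnorm_smult one_closed) (rule mult_left_mono, auto)
      ultimately show ?thesis using c d(1) by (simp add: field_simps mult_left_mono order_trans)
    qed
    have "cnorm A y \<le> (\<Sum>j\<in>I. \<Sum>i\<in>I. r / d)"
      by (rule order_trans[OF corner_norm_le_sum[OF y]]) (intro sum_mono entry)
    then show "cnorm A y \<le> of_nat (card I) * (of_nat (card I) * (1 / d)) * r" by simp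
  qed
qed

text \<open>
  The constant \<open>C\<close> of the previous lemma is removed by applying it to \<open>(y\<^sup>\<star> y) ^ (2 ^ k)\<close>. The norm of this element is
  \<open>\<parallel>y\<parallel> ^ (2 * 2 ^ k)\<close> by the C*-identity, and its distance from \<open>J\<close> is at most
  \<open>(\<parallel>y\<parallel> * r) ^ (2 ^ k)\<close>. For \<open>r < \<parallel>y\<parallel>\<close> the quotient is unbounded in \<open>k\<close>.
\<close>

lemma corner_norm_le:
  assumes J: "closed_ideal J A" "J \<noteq> carrier A" and y: "y \<in> corner" and n: "near J y r"
  shows "cnorm A y \<le> r"
proof (rule ccontr)
  assume "\<not> cnorm A y \<le> r"
  then have r: "r < cnorm A y" by simp
  have id: "ideal J A" using J closed_ideal_def by blast
  have yc: "y \<in> carrier A" using y by (simp add: corner_def)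
  have r0: "0 \<le> r" using near_nonneg[OF id n yc] .
  obtain C where C: "\<And>y r. \<lbrakk>y \<in> corner; near J y r\<rbrakk> \<Longrightarrow> cnorm A y \<le> C * r"
    using corner_norm_le_near[OF J] by blast
  define N where "N = cnorm A y"
  have N: "0 < N" using r r0 N_def by simp
  \<comment> \<open>\<open>p = (y\<^sup>\<star> y) ^ (2 ^ k)\<close>, obtained by repeated squaring\<close>
  have "\<exists>p\<in>corner. p\<^sup>\<star> = p \<and> cnorm A p = (N * N) ^ (2 ^ k) \<and> near J p ((N * r) ^ (2 ^ k))" for k
  proof (induct k)
    case 0
    have "near J (y\<^sup>\<star> \<otimes> y) (N * r)"
      using yc n by (intro near_mult[OF id near_norm[OF id] n]) (auto simp: N_def)
    moreover have "cnorm A (y\<^sup>\<star> \<otimes> y) = N * N" using cstar_identity[OF yc] by (simp add: N_def power2_eq_square)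
    moreover have "(y\<^sup>\<star> \<otimes> y)\<^sup>\<star> = y\<^sup>\<star> \<otimes> y" using yc by (simp add: adj_mult)
    moreover have "y\<^sup>\<star> \<otimes> y \<in> corner" using y by (intro corner_mult corner_adj)
    ultimately show ?case by auto
  next
    case (Suc k)
    then obtain p where p: "p \<in> corner" "p\<^sup>\<star> = p" "cnorm A p = (N * N) ^ (2 ^ k)" "near J p ((N * r) ^ (2 ^ k))"
      by blast
    have pc: "p \<in> carrier A" using p by (simp add: corner_def)
    have "cnorm A (p \<otimes> p) = ((N * N) ^ (2 ^ k))\<^sup>2" using cstar_identity[OF pc] p by simp
    then have "cnorm A (p \<otimes> p) = (N * N) ^ (2 ^ Suc k)" by (simp flip: power_mult add: mult.commute)
    moreover have "near J (p \<otimes> p) ((N * r) ^ (2 ^ Suc k))"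
      using near_mult[OF id p(4) p(4) pc pc] by (simp add: mult_2 power_add)
    moreover have "(p \<otimes> p)\<^sup>\<star> = p \<otimes> p" using pc p by (simp add: adj_mult)
    moreover have "p \<otimes> p \<in> corner" using p by (intro corner_mult)
    ultimately show ?case by blast
  qed
  then have pow: "(N * N) ^ (2 ^ k) \<le> C * (N * r) ^ (2 ^ k)" for k using C by metis
  show False
  proof (cases "r = 0")
    case True then show False using pow[of 0] mult_pos_pos[OF N N] by simp
  next
    case False
    then have r1: "0 < r" using r0 by simp
    have q: "1 < N / r" using r r1 by (simp add: N_def)
    have "(N / r) ^ (2 ^ k) \<le> C" for k
    proof -
      have "(N * N) ^ (2 ^ k) = (N / r) ^ (2 ^ k) * (N * r) ^ (2 ^ k)" using r1 by (simp flip: power_mult_distrib)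
      then have "(N / r) ^ (2 ^ k) * (N * r) ^ (2 ^ k) \<le> C * (N * r) ^ (2 ^ k)" using pow[of k] by simp
      then show ?thesis using N r1 by simp
    qed
    moreover obtain k where "C < (N / r) ^ k" using real_arch_pow[OF q] by blast
    moreover have "(N / r) ^ k \<le> (N / r) ^ (2 ^ k)" using q by (intro power_increasing) auto
    ultimately show False by (meson le_less_trans less_le_not_le)
  qed
qed

end

section \<open>Linear spans, commutation up to scalars and words\<close>

context unital_cstar_algebra
begin

text \<open>
  The span is generated one summand at a time, which makes rule induction the way to prove linear
  statements about polynomials.
\<close>

inductive_set lspan :: "'a set \<Rightarrow> 'a set" for B where
  zero: "\<zero> \<in> lspan B"
| step: "\<lbrakk>x \<in> B; y \<in> lspan B\<rbrakk> \<Longrightarrow> c \<odot> x \<oplus> y \<in> lspan B"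

lemma lspan_closed: "\<lbrakk>x \<in> lspan B; B \<subseteq> carrier A\<rbrakk> \<Longrightarrow> x \<in> carrier A"
  by (induct rule: lspan.induct) auto

lemma lspan_base: "\<lbrakk>x \<in> B; B \<subseteq> carrier A\<rbrakk> \<Longrightarrow> x \<in> lspan B"
  using lspan.step[of x B \<zero> 1] lspan.zero by (auto simp: subset_iff)

lemma lspan_add:
  assumes "x \<in> lspan B" "y \<in> lspan B" and B: "B \<subseteq> carrier A" shows "x \<oplus> y \<in> lspan B"
  using assms(1,2)
proof (induct rule: lspan.induct)
  case zero then show ?case using lspan_closed[OF _ B] by simp
next
  case (step x z c)
  then have "c \<odot> x \<oplus> (z \<oplus> y) \<in> lspan B" by (intro lspan.step) auto
  moreover have "c \<odot> x \<oplus> z \<oplus> y = c \<odot> x \<oplus> (z \<oplus> y)"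
    using step lspan_closed[OF _ B] B by (intro a_assoc) auto
  ultimately show ?case by simp
qed

lemma lspan_smult:
  assumes "x \<in> lspan B" and B: "B \<subseteq> carrier A" shows "c \<odot> x \<in> lspan B"
  using assms(1)
proof (induct rule: lspan.induct)
  case zero then show ?case by (simp add: lspan.zero)
next
  case (step x z d)
  have "x \<in> carrier A" "z \<in> carrier A" using step lspan_closed[OF _ B] B by auto
  then have "c \<odot> (d \<odot> x \<oplus> z) = (c * d) \<odot> x \<oplus> c \<odot> z" by (simp add: smult_add_right smult_smult)
  then show ?case using step by (simp add: lspan.step)
qed

lemma lspan_mono: "\<lbrakk>x \<in> lspan B; B \<subseteq> B'\<rbrakk> \<Longrightarrow> x \<in> lspan B'"
  by (induct rule: lspan.induct) (auto intro: lspan.intros)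

lemma lspan_linear_image:
  assumes "x \<in> lspan B" and B: "B \<subseteq> carrier A" "B' \<subseteq> carrier A"
    and f: "f \<zero> = \<zero>"
      "\<And>c x y. \<lbrakk>x \<in> carrier A; y \<in> carrier A\<rbrakk> \<Longrightarrow> f (c \<odot> x \<oplus> y) = g c \<odot> f x \<oplus> f y"
      "\<And>x. x \<in> B \<Longrightarrow> f x \<in> lspan B'"
  shows "f x \<in> lspan B'"
  using assms(1)
proof (induct rule: lspan.induct)
  case zero then show ?case by (simp add: f lspan.zero)
next
  case (step x z d)
  have "x \<in> carrier A" "z \<in> carrier A" using step lspan_closed[OF _ B(1)] B by auto
  then show ?case using step f B by (auto intro!: lspan_add lspan_smult)
qed

text \<open>
  The elements that can be approximated from a *-subalgebra form a C*-subalgebra.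
\<close>

lemma dense_of_generated:
  assumes gen: "cstar_generated_by A X" and P: "P \<subseteq> carrier A" "X \<subseteq> P" "\<one> \<in> P"
    and cl: "\<And>x y. \<lbrakk>x \<in> P; y \<in> P\<rbrakk> \<Longrightarrow> x \<oplus> y \<in> P" "\<And>x y. \<lbrakk>x \<in> P; y \<in> P\<rbrakk> \<Longrightarrow> x \<otimes> y \<in> P"
      "\<And>x. x \<in> P \<Longrightarrow> x\<^sup>\<star> \<in> P" "\<And>x c. x \<in> P \<Longrightarrow> c \<odot> x \<in> P"
    and a: "a \<in> carrier A" and e: "0 < e"
  obtains p where "p \<in> P" "cnorm A (a \<ominus> p) < e"
proof -
  define C where "C = {x \<in> carrier A. \<forall>e>0. \<exists>y\<in>P. cnorm A (x \<ominus> y) < e}"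
  have CI: "x \<in> C" if "x \<in> carrier A" "\<And>e. e > 0 \<Longrightarrow> \<exists>y\<in>P. cnorm A (x \<ominus> y) < e" for x
    using that by (auto simp: C_def)
  have Cc: "x \<in> carrier A" if "x \<in> C" for x using that by (auto simp: C_def)
  have Pc: "x \<in> carrier A" if "x \<in> P" for x using that P by auto
  have CE: "\<exists>y\<in>P. cnorm A (x \<ominus> y) < e" if "x \<in> C" "e > 0" for x e using that by (auto simp: C_def)
  have PC: "P \<subseteq> C" using P(1) by (force intro!: CI bexI simp: subset_iff)
  have "unital_cstar_subalgebra C A"
    unfolding unital_cstar_subalgebra_def
  proof (intro conjI ballI allI)
    show "\<one> \<in> C" using PC P by blast
    show "closedin (ctopology A) C"
      unfolding closedin_iff_approx
    proof (intro conjI ballI impI)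
      show "C \<subseteq> carrier A" using Cc by blast
      fix x assume x: "x \<in> carrier A" and ap: "\<forall>e>0. \<exists>y\<in>C. cnorm A (x \<ominus> y) < e"
      show "x \<in> C"
      proof (rule CI[OF x])
        fix e :: real assume e: "0 < e"
        obtain y where y: "y \<in> C" "cnorm A (x \<ominus> y) < e/2" using ap e half_gt_zero by blast
        obtain z where z: "z \<in> P" "cnorm A (y \<ominus> z) < e/2" using CE[OF y(1), of "e/2"] e by auto
        have "cnorm A (x \<ominus> z) < e"
          using cnorm_diff_triangle[OF x Cc[OF y(1)] Pc[OF z(1)]] y z by simp
        then show "\<exists>z\<in>P. cnorm A (x \<ominus> z) < e" using z by blast
      qed
    qed
    fix x assume x: "x \<in> C"
    show "x\<^sup>\<star> \<in> C"
    proof (rule CI)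
      fix e :: real assume e: "0 < e"
      obtain y where y: "y \<in> P" "cnorm A (x \<ominus> y) < e" using CE[OF x e] by blast
      have "cnorm A (x\<^sup>\<star> \<ominus> y\<^sup>\<star>) < e"
        using y Cc[OF x] Pc[OF y(1)] cnorm_adj[of "x \<ominus> y"] by (simp add: adj_diff)
      then show "\<exists>z\<in>P. cnorm A (x\<^sup>\<star> \<ominus> z) < e" using y cl by blast
    qed (use Cc[OF x] in simp)
    have mult: "x \<otimes> y \<in> C" if x: "x \<in> C" and y: "y \<in> C" for x y
    proof (rule CI)
      fix e :: real assume e: "0 < e"
      have c: "x \<in> carrier A" "y \<in> carrier A" using Cc x y by auto
      have p1: "0 < e / (2 * (cnorm A x + 1))" using e cnorm_nonneg[OF c(1)] by simp
      obtain v where v: "v \<in> P" "cnorm A (y \<ominus> v) < e / (2 * (cnorm A x + 1))" using CE[OF y p1] by blast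
      have vc: "v \<in> carrier A" using v Pc by blast
      have p2: "0 < e / (2 * (cnorm A v + 1))" using e cnorm_nonneg[OF vc] by simp
      obtain u where u: "u \<in> P" "cnorm A (x \<ominus> u) < e / (2 * (cnorm A v + 1))" using CE[OF x p2] by blast
      have uc: "u \<in> carrier A" using u Pc by blast
      have "cnorm A (x \<otimes> (y \<ominus> v)) \<le> (cnorm A x + 1) * cnorm A (y \<ominus> v)"
        using c vc cnorm_nonneg[of "y \<ominus> v"] order_trans[OF cnorm_mult mult_right_mono, of x "y \<ominus> v" "cnorm A x + 1"] by simp
      also have "\<dots> < e / 2" using v(2) cnorm_nonneg[OF c(1)] by (simp add: field_simps)
      finally have 1: "cnorm A (x \<otimes> (y \<ominus> v)) < e / 2" .
      have "cnorm A ((x \<ominus> u) \<otimes> v) \<le> cnorm A (x \<ominus> u) * (cnorm A v + 1)"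
        using c uc vc cnorm_nonneg[of "x \<ominus> u"] order_trans[OF cnorm_mult mult_left_mono, of "x \<ominus> u" v "cnorm A v + 1"] by simp
      also have "\<dots> < e / 2" using u(2) cnorm_nonneg[OF vc] by (simp add: field_simps)
      finally have 2: "cnorm A ((x \<ominus> u) \<otimes> v) < e / 2" .
      have "cnorm A (x \<otimes> y \<ominus> u \<otimes> v) < e"
        using 1 2 cnorm_diff_triangle[of "x \<otimes> y" "x \<otimes> v" "u \<otimes> v"] c uc vc
        by (simp add: r_distr_diff l_distr_diff)
      then show "\<exists>z\<in>P. cnorm A (x \<otimes> y \<ominus> z) < e" using u v cl by blast
    qed (use Cc[OF x] Cc[OF y] in simp)
    \<comment> \<open>multiplication by a scalar is multiplication by an element\<close>
    have "c \<odot> \<one> \<in> C" for c using PC P(3) cl(4) by blast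
    then show "c \<odot> x \<in> C" for c using mult[of "c \<odot> \<one>" x] x Cc[OF x] smult_mult_left[of \<one> x c] by simp
    fix y assume y: "y \<in> C"
    show "x \<oplus> y \<in> C"
    proof (rule CI)
      fix e :: real assume e: "0 < e"
      obtain u where u: "u \<in> P" "cnorm A (x \<ominus> u) < e/2" using CE[OF x, of "e/2"] e by auto
      obtain v where v: "v \<in> P" "cnorm A (y \<ominus> v) < e/2" using CE[OF y, of "e/2"] e by auto
      have "cnorm A ((x \<oplus> y) \<ominus> (u \<oplus> v)) < e"
        using u v cnorm_triangle[of "x \<ominus> u" "y \<ominus> v"] Cc[OF x] Cc[OF y] Pc[OF u(1)] Pc[OF v(1)]
        by (simp add: diff_diff_add)
      then show "\<exists>z\<in>P. cnorm A ((x \<oplus> y) \<ominus> z) < e" using u v cl by blast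
    qed (use Cc[OF x] Cc[OF y] in simp)
    show "x \<otimes> y \<in> C" by (rule mult[OF x y])
  qed
  then have "C = carrier A" using gen PC P unfolding cstar_generated_by_def by blast
  then have "\<exists>p\<in>P. cnorm A (a \<ominus> p) < e" using a e CE by blast
  then show thesis using that by blast
qed

subsection \<open>Commutation up to a scalar\<close>

text \<open>
  The commutation scalars of the words have no influence on any argument except that they do not
  vanish. Hiding them behind an existential quantifier saves the bookkeeping of powers of \<open>q\<close>.
\<close>

definition qcomm :: "'a \<Rightarrow> 'a \<Rightarrow> bool" where
  "qcomm x y \<longleftrightarrow> (\<exists>c. c \<noteq> 0 \<and> x \<otimes> y = c \<odot> (y \<otimes> x))"

lemma qcomm_sym: "\<lbrakk>qcomm x y; x \<in> carrier A; y \<in> carrier A\<rbrakk> \<Longrightarrow> qcomm y x"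
  unfolding qcomm_def by (metis inverse_nonzero_iff_nonzero left_inverse m_closed smult_one smult_smult)

lemma qcomm_one: "x \<in> carrier A \<Longrightarrow> qcomm \<one> x"
  unfolding qcomm_def by (rule exI[of _ 1]) simp

lemma qcomm_adj:
  assumes "qcomm x y" "x \<in> carrier A" "y \<in> carrier A" shows "qcomm (x\<^sup>\<star>) (y\<^sup>\<star>)"
proof -
  obtain c where c: "c \<noteq> 0" "y \<otimes> x = c \<odot> (x \<otimes> y)"
    using qcomm_sym[OF assms] by (auto simp: qcomm_def)
  then have "(y \<otimes> x)\<^sup>\<star> = cnj c \<odot> (x \<otimes> y)\<^sup>\<star>" using assms by (simp add: adj_smult)
  then have "x\<^sup>\<star> \<otimes> y\<^sup>\<star> = cnj c \<odot> (y\<^sup>\<star> \<otimes> x\<^sup>\<star>)" using assms by (simp add: adj_mult)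
  then show ?thesis unfolding qcomm_def using c by (intro exI[of _ "cnj c"]) simp
qed

lemma qcomm_mult:
  assumes "qcomm x z" "qcomm y z" and c: "x \<in> carrier A" "y \<in> carrier A" "z \<in> carrier A"
  shows "qcomm (x \<otimes> y) z"
proof -
  obtain a b where ab: "a \<noteq> 0" "x \<otimes> z = a \<odot> (z \<otimes> x)" "b \<noteq> 0" "y \<otimes> z = b \<odot> (z \<otimes> y)"
    using assms by (auto simp: qcomm_def)
  have "(x \<otimes> y) \<otimes> z = x \<otimes> (y \<otimes> z)" using c by (simp add: m_assoc)
  also have "\<dots> = b \<odot> ((x \<otimes> z) \<otimes> y)" unfolding ab(4) using c by (simp add: smult_mult_right m_assoc)
  also have "\<dots> = (b * a) \<odot> (z \<otimes> (x \<otimes> y))"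
    unfolding ab(2) using c by (simp add: smult_mult_left smult_smult m_assoc)
  finally show ?thesis unfolding qcomm_def using ab by (intro exI[of _ "b * a"]) simp
qed

lemma qcomm_mult_right:
  assumes "qcomm z x" "qcomm z y" and c: "x \<in> carrier A" "y \<in> carrier A" "z \<in> carrier A"
  shows "qcomm z (x \<otimes> y)"
  using assms by (meson m_closed qcomm_mult qcomm_sym)

end

subsection \<open>Words in a family of isometries\<close>

context isometry_family
begin

primrec word :: "'i list \<Rightarrow> 'a" where
  "word [] = \<one>"
| "word (i # w) = T i \<otimes> word w"

definition words :: "nat \<Rightarrow> 'i list set" where
  "words N = {w. set w \<subseteq> I \<and> length w = N}"

lemma finite_words: "finite (words N)"
  unfolding words_def using finite_I by (rule finite_lists_length_eq)

lemma word_closed [simp]: "set w \<subseteq> I \<Longrightarrow> word w \<in> carrier A"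
  by (induct w) auto

lemma word_append: "\<lbrakk>set u \<subseteq> I; set v \<subseteq> I\<rbrakk> \<Longrightarrow> word (u @ v) = word u \<otimes> word v"
  by (induct u) (auto simp: m_assoc)

lemma word_orth:
  assumes "length u = length v" "set u \<subseteq> I" "set v \<subseteq> I"
  shows "(word u)\<^sup>\<star> \<otimes> word v = (if u = v then \<one> else \<zero>)"
  using assms
proof (induct u v rule: list_induct2)
  case (Cons i u j v)
  then have c: "word u \<in> carrier A" "word v \<in> carrier A" "i \<in> I" "j \<in> I" by auto
  have "(word (i # u))\<^sup>\<star> \<otimes> word (j # v) = (word u)\<^sup>\<star> \<otimes> (((T i)\<^sup>\<star> \<otimes> T j) \<otimes> word v)"
    using c by (simp add: adj_mult m_assoc)
  then show ?case using Cons c by (auto simp: T_orth)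
qed simp

lemma adj_word_word:
  assumes "length u \<le> length v" "set u \<subseteq> I" "set v \<subseteq> I"
  shows "(word u)\<^sup>\<star> \<otimes> word v = (if take (length u) v = u then word (drop (length u) v) else \<zero>)"
proof -
  let ?a = "take (length u) v" and ?b = "drop (length u) v"
  have s: "set ?a \<subseteq> I" "set ?b \<subseteq> I" using assms(3) set_take_subset set_drop_subset by fast+
  have "(word u)\<^sup>\<star> \<otimes> word v = ((word u)\<^sup>\<star> \<otimes> word ?a) \<otimes> word ?b"
    using word_append[OF s] s assms by (simp add: m_assoc)
  then show ?thesis using word_orth[of u ?a] assms s by auto
qed

text \<open>
  If \<open>p\<close> is shorter than \<open>r\<close>, then the last letter \<open>j\<close> of \<open>p a\<close> stands at a position where \<open>r a\<close> has
  the letter \<open>i\<close>, since the lengths differ by at most \<open>N\<close>. So neither word is a prefix of the other.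
\<close>

lemma separating_word:
  assumes "i \<in> I" "j \<in> I" "i \<noteq> j" "set p \<subseteq> I" "set r \<subseteq> I" "length p \<le> N" "length r \<le> N"
    and "length p \<noteq> length r"
  defines "a \<equiv> replicate N i @ [j]"
  shows "(word (p @ a))\<^sup>\<star> \<otimes> word (r @ a) = \<zero>"
proof -
  have sa: "set a \<subseteq> I" using assms(1,2) by (auto simp: a_def)
  have main: "(word (p @ a))\<^sup>\<star> \<otimes> word (r @ a) = \<zero>"
    if pr: "length p < length r" "length r \<le> N" "set p \<subseteq> I" "set r \<subseteq> I" for p r
  proof -
    have "length p + N - length r < N" using pr by linarith
    then have "(r @ a) ! (length p + N) = i" using pr by (simp add: a_def nth_append)
    moreover have "(p @ a) ! (length p + N) = j" by (simp add: a_def nth_append)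
    moreover have "length p + N < length (p @ a)" by (simp add: a_def)
    ultimately have "take (length (p @ a)) (r @ a) \<noteq> p @ a" using assms(3) by (metis nth_take)
    then show ?thesis using adj_word_word[of "p @ a" "r @ a"] pr sa by simp
  qed
  show ?thesis
  proof (cases "length p < length r")
    case True then show ?thesis using main assms by blast
  next
    case False
    then have "(word (r @ a))\<^sup>\<star> \<otimes> word (p @ a) = \<zero>" using assms by (intro main) auto
    then have "((word (r @ a))\<^sup>\<star> \<otimes> word (p @ a))\<^sup>\<star> = \<zero>" by simp
    then show ?thesis using assms sa by (simp add: adj_mult)
  qed
qed

definition monomial :: "'i list \<Rightarrow> 'i list \<Rightarrow> 'a" where
  "monomial \<mu> \<nu> = word \<mu> \<otimes> (word \<nu>)\<^sup>\<star>"

lemma monomial_closed [simp]: "\<lbrakk>set \<mu> \<subseteq> I; set \<nu> \<subseteq> I\<rbrakk> \<Longrightarrow> monomial \<mu> \<nu> \<in> carrier A"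
  by (simp add: monomial_def)

lemma compress_monomial:
  assumes "set \<mu> \<subseteq> I" "set \<nu> \<subseteq> I" "length \<mu> \<le> length u" "length \<nu> \<le> length v" "set u \<subseteq> I" "set v \<subseteq> I"
  shows "(word u)\<^sup>\<star> \<otimes> monomial \<mu> \<nu> \<otimes> word v =
    (if take (length \<mu>) u = \<mu> \<and> take (length \<nu>) v = \<nu>
     then (word (drop (length \<mu>) u))\<^sup>\<star> \<otimes> word (drop (length \<nu>) v) else \<zero>)"
proof -
  have d: "set (drop (length \<mu>) u) \<subseteq> I" "set (drop (length \<nu>) v) \<subseteq> I"
    using assms(5,6) set_drop_subset by fast+
  have "(word u)\<^sup>\<star> \<otimes> monomial \<mu> \<nu> \<otimes> word v = ((word \<mu>)\<^sup>\<star> \<otimes> word u)\<^sup>\<star> \<otimes> ((word \<nu>)\<^sup>\<star> \<otimes> word v)"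
    using assms by (simp add: monomial_def adj_mult m_assoc)
  then show ?thesis using assms d by (simp add: adj_word_word)
qed

text \<open>
  Appending \<open>i\<^sup>N j\<close> to the compressing words kills every monomial of nonzero degree.
\<close>

lemma compress_monomial_zero:
  assumes "set \<mu> \<subseteq> I" "set \<nu> \<subseteq> I" "length \<mu> \<le> N" "length \<nu> \<le> N" "u \<in> words N" "v \<in> words N"
    and "length \<mu> \<noteq> length \<nu>" and ij: "i \<in> I" "j \<in> I" "i \<noteq> j"
  defines "a \<equiv> replicate N i @ [j]"
  shows "(word (u @ a))\<^sup>\<star> \<otimes> monomial \<mu> \<nu> \<otimes> word (v @ a) = \<zero>"
proof -
  have sa: "set a \<subseteq> I" using ij by (auto simp: a_def)
  have uv: "set u \<subseteq> I" "set v \<subseteq> I" "length u = N" "length v = N" using assms by (auto simp: words_def)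
  have d: "set (drop (length \<mu>) u) \<subseteq> I" "set (drop (length \<nu>) v) \<subseteq> I"
    using uv set_drop_subset by fast+
  have "(word (drop (length \<mu>) u @ a))\<^sup>\<star> \<otimes> word (drop (length \<nu>) v @ a) = \<zero>"
    unfolding a_def using assms(3,4,7) ij d uv by (intro separating_word) auto
  then show ?thesis using compress_monomial[of \<mu> \<nu> "u @ a" "v @ a"] assms(1-4) uv sa by simp
qed

lemma compress_monomial_scalar:
  assumes "set \<mu> \<subseteq> I" "set \<nu> \<subseteq> I" "length \<mu> \<le> N" "u \<in> words N" "v \<in> words N"
    and "length \<mu> = length \<nu>"
  shows "\<exists>c. (word u)\<^sup>\<star> \<otimes> monomial \<mu> \<nu> \<otimes> word v = c \<odot> \<one>"
proof -
  have uv: "set u \<subseteq> I" "set v \<subseteq> I" "length u = N" "length v = N" using assms by (auto simp: words_def)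
  have d: "set (drop (length \<mu>) u) \<subseteq> I" "set (drop (length \<nu>) v) \<subseteq> I"
    using uv set_drop_subset by fast+
  have "(word u)\<^sup>\<star> \<otimes> monomial \<mu> \<nu> \<otimes> word v =
    (if take (length \<mu>) u = \<mu> \<and> take (length \<nu>) v = \<nu> \<and> drop (length \<mu>) u = drop (length \<nu>) v then 1 else 0) \<odot> \<one>"
    using compress_monomial[of \<mu> \<nu> u v] word_orth[of "drop (length \<mu>) u" "drop (length \<nu>) v"] assms uv d by simp
  then show ?thesis by blast
qed

lemma T_monomial:
  assumes "i \<in> I" "set \<mu> \<subseteq> I" "set \<nu> \<subseteq> I"
  shows "T i \<otimes> monomial \<mu> \<nu> = monomial (i # \<mu>) \<nu>"
  using assms by (simp add: monomial_def m_assoc)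

lemma adj_T_monomial:
  assumes "i \<in> I" "set \<mu> \<subseteq> I" "set \<nu> \<subseteq> I"
  shows "(T i)\<^sup>\<star> \<otimes> monomial \<mu> \<nu> =
    (case \<mu> of [] \<Rightarrow> monomial [] (\<nu> @ [i]) | j # \<mu>' \<Rightarrow> if i = j then monomial \<mu>' \<nu> else \<zero>)"
proof (cases \<mu>)
  case Nil
  then show ?thesis using assms by (simp add: monomial_def word_append adj_mult)
next
  case (Cons j \<mu>')
  then have c: "j \<in> I" "word \<mu>' \<in> carrier A" "word \<nu> \<in> carrier A" using assms by auto
  have "(T i)\<^sup>\<star> \<otimes> monomial \<mu> \<nu> = ((T i)\<^sup>\<star> \<otimes> T j) \<otimes> monomial \<mu>' \<nu>"
    using c assms Cons by (simp add: monomial_def m_assoc)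
  then show ?thesis using Cons c assms by (auto simp: T_orth)
qed

text \<open>
  An ideal that contains the defect \<open>\<one> \<ominus> amp \<one>\<close> cannot distinguish \<open>x\<close> from the sum of the
  \<open>x (T i) (T i)\<^sup>\<star>\<close>. Hence membership can be tested after multiplication by all words of a
  fixed length.
\<close>

lemma ideal_mem_by_right_words:
  assumes J: "ideal J A" "\<one> \<ominus> amp \<one> \<in> J" and z: "z \<in> carrier A"
    and "\<And>u. u \<in> words N \<Longrightarrow> z \<otimes> word u \<in> J"
  shows "z \<in> J"
proof -
  have letter: "x \<in> J" if x: "x \<in> carrier A" and xi: "\<And>i. i \<in> I \<Longrightarrow> x \<otimes> T i \<in> J" for x
  proof -
    have "x \<otimes> amp \<one> = (\<Oplus>i\<in>I. x \<otimes> (T i \<otimes> \<one> \<otimes> (T i)\<^sup>\<star>))"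
      unfolding amp_def using x finite_I by (subst finsum_rdistr) auto
    moreover have "x \<otimes> (T i \<otimes> \<one> \<otimes> (T i)\<^sup>\<star>) \<in> J" if "i \<in> I" for i
      using ideal_mult_right[OF J(1) _ xi[OF that], of "(T i)\<^sup>\<star>"] that x by (simp add: m_assoc)
    ultimately have "x \<otimes> amp \<one> \<in> J" using ideal_finsum[OF J(1) finite_I] by auto
    moreover have "x \<otimes> (\<one> \<ominus> amp \<one>) \<in> J" using ideal_mult_left[OF J(1) x J(2)] .
    moreover have "x = x \<otimes> (\<one> \<ominus> amp \<one>) \<oplus> x \<otimes> amp \<one>" using x by (simp add: r_distr_diff minus_plus_cancel)
    ultimately show ?thesis using ideal_add[OF J(1)] by metis
  qed
  show ?thesis using assms(4)
  proof (induct N)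
    case 0 then show ?case using z by (auto simp: words_def)
  next
    case (Suc N)
    show ?case
    proof (rule Suc(1))
      fix u assume u: "u \<in> words N"
      then have uI: "set u \<subseteq> I" by (simp add: words_def)
      show "z \<otimes> word u \<in> J"
      proof (rule letter)
        fix i assume i: "i \<in> I"
        have "z \<otimes> word (u @ [i]) \<in> J" using u i by (intro Suc(2)) (auto simp: words_def)
        then show "z \<otimes> word u \<otimes> T i \<in> J" using uI i z by (simp add: word_append m_assoc)
      qed (use z uI in simp)
    qed
  qed
qed

lemma ideal_mem_by_left_words:
  assumes J: "ideal J A" "\<one> \<ominus> amp \<one> \<in> J" and z: "z \<in> carrier A"
    and "\<And>u. u \<in> words N \<Longrightarrow> (word u)\<^sup>\<star> \<otimes> z \<in> J"
  shows "z \<in> J"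
proof -
  have letter: "x \<in> J" if x: "x \<in> carrier A" and xi: "\<And>i. i \<in> I \<Longrightarrow> (T i)\<^sup>\<star> \<otimes> x \<in> J" for x
  proof -
    have "amp \<one> \<otimes> x = (\<Oplus>i\<in>I. (T i \<otimes> \<one> \<otimes> (T i)\<^sup>\<star>) \<otimes> x)"
      unfolding amp_def using x finite_I by (subst finsum_ldistr) auto
    moreover have "(T i \<otimes> \<one> \<otimes> (T i)\<^sup>\<star>) \<otimes> x \<in> J" if "i \<in> I" for i
      using ideal_mult_left[OF J(1) _ xi[OF that], of "T i"] that x by (simp add: m_assoc)
    ultimately have "amp \<one> \<otimes> x \<in> J" using ideal_finsum[OF J(1) finite_I] by auto
    moreover have "(\<one> \<ominus> amp \<one>) \<otimes> x \<in> J" using ideal_mult_right[OF J(1) x J(2)] .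
    moreover have "x = (\<one> \<ominus> amp \<one>) \<otimes> x \<oplus> amp \<one> \<otimes> x" using x by (simp add: l_distr_diff minus_plus_cancel)
    ultimately show ?thesis using ideal_add[OF J(1)] by metis
  qed
  show ?thesis using assms(4)
  proof (induct N)
    case 0 then show ?case using z by (auto simp: words_def)
  next
    case (Suc N)
    show ?case
    proof (rule Suc(1))
      fix u assume u: "u \<in> words N"
      then have uI: "set u \<subseteq> I" by (simp add: words_def)
      show "(word u)\<^sup>\<star> \<otimes> z \<in> J"
      proof (rule letter)
        fix i assume i: "i \<in> I"
        have "(word (u @ [i]))\<^sup>\<star> \<otimes> z \<in> J" using u i by (intro Suc(2)) (auto simp: words_def)
        then show "(T i)\<^sup>\<star> \<otimes> ((word u)\<^sup>\<star> \<otimes> z) \<in> J" using uI i z by (simp add: word_append adj_mult m_assoc)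
      qed (use z uI in simp)
    qed
  qed
qed

end

section \<open>Two families that commute up to scalars\<close>

context isometry_family
begin

lemma corner_zero: "\<zero> \<in> corner"
proof -
  have "\<exists>c. \<zero> = c \<odot> \<one>" by (rule exI[of _ 0]) simp
  then show ?thesis unfolding corner_def by auto
qed

lemma corner_lincomb: assumes x: "x \<in> corner" and y: "y \<in> corner" shows "c \<odot> x \<oplus> y \<in> corner"
proof -
  have x': "x \<in> carrier A" "amp \<one> \<otimes> x = x" "x \<otimes> amp \<one> = x" using x by (auto simp: corner_def)
  have y': "y \<in> carrier A" "amp \<one> \<otimes> y = y" "y \<otimes> amp \<one> = y" using y by (auto simp: corner_def)
  have "\<exists>e. (T i)\<^sup>\<star> \<otimes> (c \<odot> x \<oplus> y) \<otimes> T j = e \<odot> \<one>" if ij: "i \<in> I" "j \<in> I" for i j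
  proof -
    obtain d where d: "(T i)\<^sup>\<star> \<otimes> x \<otimes> T j = d \<odot> \<one>" using x ij by (auto simp: corner_def)
    obtain e where e: "(T i)\<^sup>\<star> \<otimes> y \<otimes> T j = e \<odot> \<one>" using y ij by (auto simp: corner_def)
    have "(T i)\<^sup>\<star> \<otimes> (c \<odot> x \<oplus> y) \<otimes> T j = c \<odot> ((T i)\<^sup>\<star> \<otimes> x \<otimes> T j) \<oplus> (T i)\<^sup>\<star> \<otimes> y \<otimes> T j"
      using ij x'(1) y'(1) by (simp add: l_distr r_distr smult_mult_left smult_mult_right)
    then show ?thesis unfolding d e
      by (intro exI[of _ "c * d + e"]) (simp add: smult_smult smult_add_left)
  qed
  then show ?thesis using x' y' unfolding corner_def
    by (simp add: l_distr r_distr smult_mult_left smult_mult_right)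
qed

text \<open>
  Compression by \<open>amp w\<close> acts on each matrix entry as compression by \<open>w\<close>.
\<close>

lemma amp_compression:
  assumes w: "w \<in> carrier A" and x: "x \<in> carrier A"
  defines "y \<equiv> (amp w)\<^sup>\<star> \<otimes> x \<otimes> amp w"
  shows "amp \<one> \<otimes> y = y" "y \<otimes> amp \<one> = y"
    "\<And>i j. \<lbrakk>i \<in> I; j \<in> I\<rbrakk> \<Longrightarrow> (T i)\<^sup>\<star> \<otimes> y \<otimes> T j = w\<^sup>\<star> \<otimes> ((T i)\<^sup>\<star> \<otimes> x \<otimes> T j) \<otimes> w"
proof -
  have "amp \<one> \<otimes> y = (amp \<one> \<otimes> amp (w\<^sup>\<star>)) \<otimes> (x \<otimes> amp w)"
    using w x by (simp add: y_def adj_amp m_assoc)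
  then show "amp \<one> \<otimes> y = y" using w x by (simp add: amp_mult y_def adj_amp m_assoc)
  have "y \<otimes> amp \<one> = amp (w\<^sup>\<star>) \<otimes> x \<otimes> (amp w \<otimes> amp \<one>)"
    using w x by (simp add: y_def adj_amp m_assoc)
  then show "y \<otimes> amp \<one> = y" using w x by (simp add: amp_mult y_def adj_amp)
  fix i j assume ij: "i \<in> I" "j \<in> I"
  have "(T i)\<^sup>\<star> \<otimes> y \<otimes> T j = ((T i)\<^sup>\<star> \<otimes> amp (w\<^sup>\<star>)) \<otimes> x \<otimes> (amp w \<otimes> T j)"
    using ij w x by (simp add: y_def adj_amp m_assoc)
  then show "(T i)\<^sup>\<star> \<otimes> y \<otimes> T j = w\<^sup>\<star> \<otimes> ((T i)\<^sup>\<star> \<otimes> x \<otimes> T j) \<otimes> w"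
    using ij w x by (simp add: adj_T_amp amp_T m_assoc)
qed

end

locale E_family = unital_cstar_algebra A for A :: "'a cstar" (structure) +
  fixes n m :: nat and q :: complex and s t :: "nat \<Rightarrow> 'a"
  assumes n: "2 \<le> n" and m: "2 \<le> m" and q: "cmod q = 1"
    and rel: "E_relations n m q A s t"

sublocale E_family \<subseteq> S: isometry_family A "{1..n}" s
  using rel unfolding E_relations_def by unfold_locales auto

sublocale E_family \<subseteq> T: isometry_family A "{1..m}" t
  using rel unfolding E_relations_def by unfold_locales auto

context E_family
begin

(* Keeps the index sets {1..n} and {1..m} in the form in which the two families are interpreted. *)
declare One_nat_def [simp del]

lemma range_sum_s: "range_sum A n s = S.amp \<one>"
  unfolding range_sum_def S.amp_def by (rule finsum_cong') auto

lemma range_sum_t: "range_sum A m t = T.amp \<one>"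
  unfolding range_sum_def T.amp_def by (rule finsum_cong') auto

lemma adj_s_t:
  assumes "j \<in> {1..n}" "r \<in> {1..m}" shows "(s j)\<^sup>\<star> \<otimes> t r = q \<odot> (t r \<otimes> (s j)\<^sup>\<star>)"
  using rel assms unfolding E_relations_def by blast

lemma adj_t_s:
  assumes j: "j \<in> {1..n}" and r: "r \<in> {1..m}" shows "(t r)\<^sup>\<star> \<otimes> s j = cnj q \<odot> (s j \<otimes> (t r)\<^sup>\<star>)"
proof -
  have "((s j)\<^sup>\<star> \<otimes> t r)\<^sup>\<star> = (q \<odot> (t r \<otimes> (s j)\<^sup>\<star>))\<^sup>\<star>" using adj_s_t assms by simp
  then show ?thesis using j r by (simp add: adj_mult adj_smult)
qed

lemma q_cnj: "q * cnj q = 1" "cnj q * q = 1"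
  using q by (simp_all add: complex_mult_cnj mult.commute flip: cmod_power2)

text \<open>
  This relation is not among the defining ones. Both \<open>a = t r s j\<close> and \<open>b = q s j t r\<close> are isometries,
  and \<open>a\<^sup>\<star> b = 1\<close> by the given relations; so \<open>(a - b)\<^sup>\<star> (a - b) = 0\<close>.
\<close>

lemma t_s:
  assumes j: "j \<in> {1..n}" and r: "r \<in> {1..m}" shows "t r \<otimes> s j = q \<odot> (s j \<otimes> t r)"
proof -
  define x y where "x = s j" and "y = t r"
  have c: "x \<in> carrier A" "y \<in> carrier A" using j r by (simp_all add: x_def y_def)
  have iso: "x\<^sup>\<star> \<otimes> x = \<one>" "y\<^sup>\<star> \<otimes> y = \<one>" using j r by (simp_all add: x_def y_def S.T_orth T.T_orth)
  have com: "x\<^sup>\<star> \<otimes> y = q \<odot> (y \<otimes> x\<^sup>\<star>)" "y\<^sup>\<star> \<otimes> x = cnj q \<odot> (x \<otimes> y\<^sup>\<star>)"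
    using adj_s_t adj_t_s j r by (simp_all add: x_def y_def)
  define a b where "a = y \<otimes> x" and "b = q \<odot> (x \<otimes> y)"
  have ab: "a \<in> carrier A" "b \<in> carrier A" using c by (simp_all add: a_def b_def)
  have collapse: "u\<^sup>\<star> \<otimes> (v\<^sup>\<star> \<otimes> v) \<otimes> u = \<one>"
    if "u \<in> carrier A" "v \<in> carrier A" "u\<^sup>\<star> \<otimes> u = \<one>" "v\<^sup>\<star> \<otimes> v = \<one>" for u v
    using that by simp
  have aa: "a\<^sup>\<star> \<otimes> a = \<one>"
    using collapse[OF c iso] c by (simp add: a_def adj_mult m_assoc)
  have bb: "b\<^sup>\<star> \<otimes> b = \<one>"
    using collapse[OF c(2,1) iso(2,1)] c q_cnj
    by (simp add: b_def adj_mult adj_smult m_assoc smult_mult_left smult_mult_right smult_smult)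
  have ab1: "a\<^sup>\<star> \<otimes> b = \<one>"
  proof -
    have "a\<^sup>\<star> \<otimes> b = q \<odot> (x\<^sup>\<star> \<otimes> (y\<^sup>\<star> \<otimes> x) \<otimes> y)"
      using c by (simp add: a_def b_def adj_mult m_assoc smult_mult_right)
    also have "\<dots> = (q * cnj q) \<odot> ((x\<^sup>\<star> \<otimes> x) \<otimes> (y\<^sup>\<star> \<otimes> y))"
      unfolding com(2) using c by (simp add: m_assoc smult_mult_left smult_mult_right smult_smult)
    finally show ?thesis using iso q_cnj by simp
  qed
  have ba1: "b\<^sup>\<star> \<otimes> a = \<one>"
  proof -
    have "(a\<^sup>\<star> \<otimes> b)\<^sup>\<star> = \<one>" using ab1 by simp
    then show ?thesis using ab by (simp add: adj_mult)
  qed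
  have "(a \<ominus> b)\<^sup>\<star> \<otimes> (a \<ominus> b) = \<zero>"
    using ab aa bb ab1 ba1 by (simp add: adj_diff l_distr_diff r_distr_diff)
  then have "(cnorm A (a \<ominus> b))\<^sup>2 = 0" using cstar_identity[of "a \<ominus> b"] ab by simp
  then have "a = b" using ab by (simp add: cnorm_eq_0_iff diff_eq_zero_iff)
  then show ?thesis by (simp add: a_def b_def x_def y_def)
qed

lemma q_nz: "q \<noteq> 0" "cnj q \<noteq> 0" using q by auto

text \<open>
  The elements that commute up to nonzero scalars with all \<open>t r\<close> and \<open>(t r)\<^sup>\<star>\<close>, and below those that
  commute in this sense with all of these. The first set contains every product of the \<open>s j\<close> and their
  adjoints, the second every product of the \<open>t r\<close> and their adjoints.
\<close>

definition Sq :: "'a set" where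
  "Sq = {x \<in> carrier A. \<forall>r\<in>{1..m}. qcomm x (t r) \<and> qcomm x ((t r)\<^sup>\<star>)}"

definition Tq :: "'a set" where
  "Tq = {y \<in> carrier A. \<forall>x\<in>Sq. qcomm x y}"

lemma Sq_closed: "x \<in> Sq \<Longrightarrow> x \<in> carrier A" and Tq_closed: "x \<in> Tq \<Longrightarrow> x \<in> carrier A"
  by (simp_all add: Sq_def Tq_def)

lemma Sq_Tq_qcomm: "\<lbrakk>x \<in> Sq; y \<in> Tq\<rbrakk> \<Longrightarrow> qcomm x y"
  by (simp add: Tq_def)

lemma Sq_mult: "\<lbrakk>x \<in> Sq; y \<in> Sq\<rbrakk> \<Longrightarrow> x \<otimes> y \<in> Sq"
  by (auto simp: Sq_def intro!: qcomm_mult)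

lemma Sq_adj: "x \<in> Sq \<Longrightarrow> x\<^sup>\<star> \<in> Sq"
proof -
  assume x: "x \<in> Sq"
  have "qcomm (x\<^sup>\<star>) (t r)" "qcomm (x\<^sup>\<star>) ((t r)\<^sup>\<star>)" if "r \<in> {1..m}" for r
    using x that qcomm_adj[of x "(t r)\<^sup>\<star>"] qcomm_adj[of x "t r"] by (auto simp: Sq_def)
  then show ?thesis using x by (auto simp: Sq_def)
qed

lemma Tq_mult: "\<lbrakk>x \<in> Tq; y \<in> Tq\<rbrakk> \<Longrightarrow> x \<otimes> y \<in> Tq"
  by (auto simp: Tq_def Sq_closed intro!: qcomm_mult_right)

lemma Tq_adj:
  assumes y: "y \<in> Tq" shows "y\<^sup>\<star> \<in> Tq"
proof -
  have "qcomm x (y\<^sup>\<star>)" if x: "x \<in> Sq" for x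
    using qcomm_adj[OF Sq_Tq_qcomm[OF Sq_adj[OF x] y]] x y by (simp add: Sq_closed Tq_closed)
  then show ?thesis using y by (simp add: Tq_def)
qed

lemma Sq_one: "\<one> \<in> Sq" and Tq_one: "\<one> \<in> Tq"
  by (auto simp: Sq_def Tq_def intro: qcomm_one qcomm_sym)

lemma s_Sq: "i \<in> {1..n} \<Longrightarrow> s i \<in> Sq"
proof -
  assume i: "i \<in> {1..n}"
  have "qcomm (s i) (t r)" "qcomm (s i) ((t r)\<^sup>\<star>)" if r: "r \<in> {1..m}" for r
  proof -
    have "qcomm (t r) (s i)" unfolding qcomm_def using t_s[OF i r] q_nz(1) by (intro exI conjI)
    from qcomm_sym[OF this] show "qcomm (s i) (t r)" using i r by simp
    have "qcomm ((t r)\<^sup>\<star>) (s i)" unfolding qcomm_def using adj_t_s[OF i r] q_nz(2) by (intro exI conjI)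
    from qcomm_sym[OF this] show "qcomm (s i) ((t r)\<^sup>\<star>)" using i r by simp
  qed
  then show ?thesis using i by (simp add: Sq_def)
qed

lemma t_Tq: "r \<in> {1..m} \<Longrightarrow> t r \<in> Tq"
  by (auto simp: Tq_def Sq_def)

lemma word_Sq: "set u \<subseteq> {1..n} \<Longrightarrow> S.word u \<in> Sq"
  by (induct u) (auto intro!: Sq_one Sq_mult s_Sq)

lemma word_Tq: "set u \<subseteq> {1..m} \<Longrightarrow> T.word u \<in> Tq"
  by (induct u) (auto intro!: Tq_one Tq_mult t_Tq)

lemma monomial_Sq: "\<lbrakk>set \<mu> \<subseteq> {1..n}; set \<nu> \<subseteq> {1..n}\<rbrakk> \<Longrightarrow> S.monomial \<mu> \<nu> \<in> Sq"
  by (auto simp: S.monomial_def intro!: word_Sq Sq_mult Sq_adj)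

lemma monomial_Tq: "\<lbrakk>set \<mu> \<subseteq> {1..m}; set \<nu> \<subseteq> {1..m}\<rbrakk> \<Longrightarrow> T.monomial \<mu> \<nu> \<in> Tq"
  by (auto simp: T.monomial_def intro!: word_Tq Tq_mult Tq_adj)

lemma separate_product:
  assumes "x \<in> Sq" "x' \<in> Sq" "y \<in> Tq" "y' \<in> Tq"
  obtains c where "c \<noteq> 0" "(x \<otimes> y) \<otimes> (x' \<otimes> y') = c \<odot> ((x \<otimes> x') \<otimes> (y \<otimes> y'))"
proof -
  have car: "x \<in> carrier A" "x' \<in> carrier A" "y \<in> carrier A" "y' \<in> carrier A"
    using assms Sq_closed Tq_closed by auto
  obtain c where c: "c \<noteq> 0" "y \<otimes> x' = c \<odot> (x' \<otimes> y)"
    using qcomm_sym[OF Sq_Tq_qcomm[OF assms(2,3)]] car by (auto simp: qcomm_def)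
  have "(x \<otimes> y) \<otimes> (x' \<otimes> y') = x \<otimes> (y \<otimes> x') \<otimes> y'" using car by (simp add: m_assoc)
  also have "\<dots> = c \<odot> ((x \<otimes> x') \<otimes> (y \<otimes> y'))"
    unfolding c using car by (simp add: m_assoc smult_mult_left smult_mult_right)
  finally show thesis using c that by blast
qed

text \<open>
  Up to a nonzero scalar, compressions of products can be computed in each family separately.
\<close>

lemma separate_sandwich:
  assumes S: "a \<in> Sq" "a' \<in> Sq" "x \<in> Sq" and T: "b \<in> Tq" "b' \<in> Tq" "y \<in> Tq"
  obtains c where "c \<noteq> 0"
    "(a \<otimes> b)\<^sup>\<star> \<otimes> (x \<otimes> y) \<otimes> (a' \<otimes> b') = c \<odot> ((a\<^sup>\<star> \<otimes> x \<otimes> a') \<otimes> (b\<^sup>\<star> \<otimes> y \<otimes> b'))"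
proof -
  have car: "a \<in> carrier A" "a' \<in> carrier A" "x \<in> carrier A" "b \<in> carrier A" "b' \<in> carrier A" "y \<in> carrier A"
    using assms Sq_closed Tq_closed by auto
  obtain c where c: "c \<noteq> 0" "b\<^sup>\<star> \<otimes> a\<^sup>\<star> = c \<odot> (a\<^sup>\<star> \<otimes> b\<^sup>\<star>)"
    using qcomm_sym[OF Sq_Tq_qcomm[OF Sq_adj[OF S(1)] Tq_adj[OF T(1)]]] car by (auto simp: qcomm_def)
  obtain d where d: "d \<noteq> 0" "(a\<^sup>\<star> \<otimes> b\<^sup>\<star>) \<otimes> (x \<otimes> y) = d \<odot> ((a\<^sup>\<star> \<otimes> x) \<otimes> (b\<^sup>\<star> \<otimes> y))"
    using separate_product[OF Sq_adj[OF S(1)] S(3) Tq_adj[OF T(1)] T(3)] by blast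
  obtain e where e: "e \<noteq> 0" "((a\<^sup>\<star> \<otimes> x) \<otimes> (b\<^sup>\<star> \<otimes> y)) \<otimes> (a' \<otimes> b') = e \<odot> ((a\<^sup>\<star> \<otimes> x \<otimes> a') \<otimes> (b\<^sup>\<star> \<otimes> y \<otimes> b'))"
    using separate_product[OF Sq_mult[OF Sq_adj[OF S(1)] S(3)] S(2) Tq_mult[OF Tq_adj[OF T(1)] T(3)] T(2)] by blast
  have "(a \<otimes> b)\<^sup>\<star> \<otimes> (x \<otimes> y) \<otimes> (a' \<otimes> b') = c \<odot> (((a\<^sup>\<star> \<otimes> b\<^sup>\<star>) \<otimes> (x \<otimes> y)) \<otimes> (a' \<otimes> b'))"
    using car c by (simp add: adj_mult smult_mult_left)
  also have "\<dots> = (c * d * e) \<odot> ((a\<^sup>\<star> \<otimes> x \<otimes> a') \<otimes> (b\<^sup>\<star> \<otimes> y \<otimes> b'))"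
    unfolding d using car e(2) by (simp add: smult_mult_left smult_smult mult.assoc)
  finally show thesis using that[of "c * d * e"] c d e by simp
qed

definition pair_word :: "nat list \<times> nat list \<Rightarrow> 'a" where
  "pair_word p = S.word (fst p) \<otimes> T.word (snd p)"

definition pairs :: "nat \<Rightarrow> (nat list \<times> nat list) set" where
  "pairs N = S.words N \<times> T.words N"

lemma pairsE:
  assumes "p \<in> pairs N" obtains u v where "p = (u, v)" "u \<in> S.words N" "v \<in> T.words N"
    "set u \<subseteq> {1..n}" "set v \<subseteq> {1..m}" "length u = N" "length v = N"
  using assms that by (auto simp: pairs_def S.words_def T.words_def)

lemma pair_word_closed [simp]: "p \<in> pairs N \<Longrightarrow> pair_word p \<in> carrier A"
  by (erule pairsE) (simp add: pair_word_def)

lemma pair_family: "isometry_family A (pairs N) pair_word"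
proof unfold_locales
  show "finite (pairs N)" unfolding pairs_def by (simp add: S.finite_words T.finite_words)
  fix p p' assume p: "p \<in> pairs N" and p': "p' \<in> pairs N"
  from p obtain u v where uv: "p = (u, v)" "set u \<subseteq> {1..n}" "set v \<subseteq> {1..m}" "length u = N" "length v = N"
    by (rule pairsE)
  from p' obtain u' v' where uv': "p' = (u', v')" "set u' \<subseteq> {1..n}" "set v' \<subseteq> {1..m}" "length u' = N" "length v' = N"
    by (rule pairsE)
  have "(pair_word p)\<^sup>\<star> \<otimes> pair_word p' = (T.word v)\<^sup>\<star> \<otimes> ((S.word u)\<^sup>\<star> \<otimes> S.word u') \<otimes> T.word v'"
    using uv uv' by (simp add: pair_word_def adj_mult m_assoc)
  also have "\<dots> = (if p = p' then \<one> else \<zero>)"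
    using uv uv' by (auto simp: S.word_orth T.word_orth)
  finally show "(pair_word p)\<^sup>\<star> \<otimes> pair_word p' = (if p = p' then \<one> else \<zero>)" .
qed simp

lemma ideal_mem_by_pairs:
  assumes J: "ideal J A" "\<one> \<ominus> S.amp \<one> \<in> J" "\<one> \<ominus> T.amp \<one> \<in> J" and z: "z \<in> carrier A"
    and "\<And>p p'. \<lbrakk>p \<in> pairs N; p' \<in> pairs N\<rbrakk> \<Longrightarrow> (pair_word p)\<^sup>\<star> \<otimes> z \<otimes> pair_word p' \<in> J"
  shows "z \<in> J"
proof (rule S.ideal_mem_by_right_words[OF J(1,2) z])
  fix u' assume u': "u' \<in> S.words N"
  then have u'c: "S.word u' \<in> carrier A" by (simp add: S.words_def)
  show "z \<otimes> S.word u' \<in> J"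
  proof (rule T.ideal_mem_by_right_words[OF J(1,3)])
    fix v' assume v': "v' \<in> T.words N"
    then have v'c: "T.word v' \<in> carrier A" by (simp add: T.words_def)
    show "z \<otimes> S.word u' \<otimes> T.word v' \<in> J"
    proof (rule S.ideal_mem_by_left_words[OF J(1,2)])
      fix u assume u: "u \<in> S.words N"
      then have uc: "S.word u \<in> carrier A" by (simp add: S.words_def)
      show "(S.word u)\<^sup>\<star> \<otimes> (z \<otimes> S.word u' \<otimes> T.word v') \<in> J"
      proof (rule T.ideal_mem_by_left_words[OF J(1,3)])
        fix v assume v: "v \<in> T.words N"
        then have vc: "T.word v \<in> carrier A" by (simp add: T.words_def)
        have "(pair_word (u, v))\<^sup>\<star> \<otimes> z \<otimes> pair_word (u', v') \<in> J"
          using u v u' v' by (intro assms(5)) (auto simp: pairs_def)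
        then show "(T.word v)\<^sup>\<star> \<otimes> ((S.word u)\<^sup>\<star> \<otimes> (z \<otimes> S.word u' \<otimes> T.word v')) \<in> J"
          using uc vc u'c v'c z by (simp add: pair_word_def adj_mult m_assoc)
      qed (use z uc u'c v'c in simp)
    qed (use z u'c v'c in simp)
  qed (use z u'c in simp)
qed

subsection \<open>Polynomials in the generators\<close>

text \<open>
  Products of monomials in words of length at most \<open>N\<close>. The bound is recorded because the compressing
  words have to be longer than all words that occur.
\<close>

definition mons :: "nat \<Rightarrow> 'a set" where
  "mons N = {S.monomial \<mu> \<nu> \<otimes> T.monomial \<alpha> \<beta> |\<mu> \<nu> \<alpha> \<beta>.
     set \<mu> \<subseteq> {1..n} \<and> set \<nu> \<subseteq> {1..n} \<and> set \<alpha> \<subseteq> {1..m} \<and> set \<beta> \<subseteq> {1..m} \<and>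
     length \<mu> \<le> N \<and> length \<nu> \<le> N \<and> length \<alpha> \<le> N \<and> length \<beta> \<le> N}"

lemma mons_closed: "mons N \<subseteq> carrier A"
  by (auto simp: mons_def)

lemma word_product_isometry:
  assumes "set u \<subseteq> {1..n}" "set v \<subseteq> {1..m}"
  shows "(S.word u \<otimes> T.word v)\<^sup>\<star> \<otimes> (S.word u \<otimes> T.word v) = \<one>"
proof -
  have "(S.word u \<otimes> T.word v)\<^sup>\<star> \<otimes> (S.word u \<otimes> T.word v) =
      (T.word v)\<^sup>\<star> \<otimes> ((S.word u)\<^sup>\<star> \<otimes> S.word u) \<otimes> T.word v"
    using assms by (simp add: adj_mult m_assoc)
  then show ?thesis using assms by (simp add: S.word_orth T.word_orth)
qed

text \<open>
  This is what \<open>n \<ge> 2\<close> and \<open>m \<ge> 2\<close> are for: a word that does not overlap with itself after a shift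
  by at most \<open>N\<close> needs two letters.
\<close>

abbreviation sep_word :: "nat \<Rightarrow> nat list" where
  "sep_word N \<equiv> replicate N 1 @ [2]"

lemma sep_word_letters: "set (sep_word N) \<subseteq> {1..n}" "set (sep_word N) \<subseteq> {1..m}"
  using n m by auto

definition separator :: "nat \<Rightarrow> 'a" where
  "separator N = S.word (sep_word N) \<otimes> T.word (sep_word N)"

lemma separator_closed [simp]: "separator N \<in> carrier A"
  unfolding separator_def using sep_word_letters by (intro m_closed S.word_closed T.word_closed)

lemma separator_isometry: "(separator N)\<^sup>\<star> \<otimes> separator N = \<one>"
  unfolding separator_def by (rule word_product_isometry[OF sep_word_letters])

context
  fixes N :: nat and \<mu> \<nu> \<alpha> \<beta> :: "nat list"
  assumes sets: "set \<mu> \<subseteq> {1..n}" "set \<nu> \<subseteq> {1..n}" "set \<alpha> \<subseteq> {1..m}" "set \<beta> \<subseteq> {1..m}"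
    and lens: "length \<mu> \<le> N" "length \<nu> \<le> N" "length \<alpha> \<le> N" "length \<beta> \<le> N"
begin

lemma compress_degree_zero:
  assumes deg: "length \<mu> = length \<nu>" "length \<alpha> = length \<beta>" and p: "p \<in> pairs N" and p': "p' \<in> pairs N"
  shows "\<exists>c. (pair_word p)\<^sup>\<star> \<otimes> (S.monomial \<mu> \<nu> \<otimes> T.monomial \<alpha> \<beta>) \<otimes> pair_word p' = c \<odot> \<one>"
proof -
  from p obtain u v where uv: "p = (u, v)" "u \<in> S.words N" "v \<in> T.words N"
    "set u \<subseteq> {1..n}" "set v \<subseteq> {1..m}" by (rule pairsE)
  from p' obtain u' v' where uv': "p' = (u', v')" "u' \<in> S.words N" "v' \<in> T.words N"
    "set u' \<subseteq> {1..n}" "set v' \<subseteq> {1..m}" by (rule pairsE)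
  obtain c where c: "(pair_word p)\<^sup>\<star> \<otimes> (S.monomial \<mu> \<nu> \<otimes> T.monomial \<alpha> \<beta>) \<otimes> pair_word p' =
      c \<odot> (((S.word u)\<^sup>\<star> \<otimes> S.monomial \<mu> \<nu> \<otimes> S.word u') \<otimes> ((T.word v)\<^sup>\<star> \<otimes> T.monomial \<alpha> \<beta> \<otimes> T.word v'))"
    using separate_sandwich[OF word_Sq[OF uv(4)] word_Sq[OF uv'(4)] monomial_Sq[OF sets(1,2)]
      word_Tq[OF uv(5)] word_Tq[OF uv'(5)] monomial_Tq[OF sets(3,4)]]
    unfolding pair_word_def uv uv' fst_conv snd_conv by blast
  obtain d where d: "(S.word u)\<^sup>\<star> \<otimes> S.monomial \<mu> \<nu> \<otimes> S.word u' = d \<odot> \<one>"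
    using S.compress_monomial_scalar[OF sets(1,2) lens(1) uv(2) uv'(2) deg(1)] by blast
  obtain e where e: "(T.word v)\<^sup>\<star> \<otimes> T.monomial \<alpha> \<beta> \<otimes> T.word v' = e \<odot> \<one>"
    using T.compress_monomial_scalar[OF sets(3,4) lens(3) uv(3) uv'(3) deg(2)] by blast
  have "(pair_word p)\<^sup>\<star> \<otimes> (S.monomial \<mu> \<nu> \<otimes> T.monomial \<alpha> \<beta>) \<otimes> pair_word p' = (c * (d * e)) \<odot> \<one>"
    unfolding c d e by (simp add: smult_mult_left smult_smult)
  then show ?thesis by blast
qed

lemma compress_degree_nonzero:
  assumes deg: "\<not> (length \<mu> = length \<nu> \<and> length \<alpha> = length \<beta>)"
    and p: "p \<in> pairs N" and p': "p' \<in> pairs N"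
  shows "(pair_word p \<otimes> separator N)\<^sup>\<star> \<otimes> (S.monomial \<mu> \<nu> \<otimes> T.monomial \<alpha> \<beta>) \<otimes> (pair_word p' \<otimes> separator N) = \<zero>"
proof -
  define x where "x = S.monomial \<mu> \<nu> \<otimes> T.monomial \<alpha> \<beta>"
  have xc: "x \<in> carrier A" using sets by (simp add: x_def)
  let ?a = "sep_word N"
  note an = sep_word_letters[of N]
  have absorb: "\<exists>u v c. pair_word p \<otimes> separator N = c \<odot> (S.word (u @ ?a) \<otimes> T.word (v @ ?a)) \<and>
      u \<in> S.words N \<and> v \<in> T.words N \<and> set (u @ ?a) \<subseteq> {1..n} \<and> set (v @ ?a) \<subseteq> {1..m}"
    if "p \<in> pairs N" for p
  proof -
    from that obtain u v where uv: "p = (u, v)" "u \<in> S.words N" "v \<in> T.words N"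
      "set u \<subseteq> {1..n}" "set v \<subseteq> {1..m}" by (rule pairsE)
    have "\<exists>c. pair_word p \<otimes> separator N = c \<odot> (S.word (u @ ?a) \<otimes> T.word (v @ ?a))"
      using separate_product[OF word_Sq[OF uv(4)] word_Sq[OF an(1)] word_Tq[OF uv(5)] word_Tq[OF an(2)]]
      unfolding pair_word_def separator_def uv(1) fst_conv snd_conv
        S.word_append[OF uv(4) an(1)] T.word_append[OF uv(5) an(2)] by blast
    then show ?thesis using uv an unfolding set_append by blast
  qed
  obtain u v c where c: "pair_word p \<otimes> separator N = c \<odot> (S.word (u @ ?a) \<otimes> T.word (v @ ?a))"
    and uv: "u \<in> S.words N" "v \<in> T.words N" "set (u @ ?a) \<subseteq> {1..n}" "set (v @ ?a) \<subseteq> {1..m}"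
    using absorb[OF p] by blast
  obtain u' v' c' where c': "pair_word p' \<otimes> separator N = c' \<odot> (S.word (u' @ ?a) \<otimes> T.word (v' @ ?a))"
    and uv': "u' \<in> S.words N" "v' \<in> T.words N" "set (u' @ ?a) \<subseteq> {1..n}" "set (v' @ ?a) \<subseteq> {1..m}"
    using absorb[OF p'] by blast
  let ?X = "(S.word (u @ ?a))\<^sup>\<star> \<otimes> S.monomial \<mu> \<nu> \<otimes> S.word (u' @ ?a)"
  let ?Y = "(T.word (v @ ?a))\<^sup>\<star> \<otimes> T.monomial \<alpha> \<beta> \<otimes> T.word (v' @ ?a)"
  have wc: "S.word (u @ ?a) \<in> carrier A" "S.word (u' @ ?a) \<in> carrier A"
    "T.word (v @ ?a) \<in> carrier A" "T.word (v' @ ?a) \<in> carrier A"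
    by (intro S.word_closed T.word_closed uv uv')+
  obtain d where d: "(S.word (u @ ?a) \<otimes> T.word (v @ ?a))\<^sup>\<star> \<otimes> x \<otimes> (S.word (u' @ ?a) \<otimes> T.word (v' @ ?a)) = d \<odot> (?X \<otimes> ?Y)"
    using separate_sandwich[OF word_Sq[OF uv(3)] word_Sq[OF uv'(3)] monomial_Sq[OF sets(1,2)]
      word_Tq[OF uv(4)] word_Tq[OF uv'(4)] monomial_Tq[OF sets(3,4)]] unfolding x_def by blast
  have ij: "(1::nat) \<in> {1..n}" "2 \<in> {1..n}" "(1::nat) \<in> {1..m}" "2 \<in> {1..m}" "(1::nat) \<noteq> 2" using n m by auto
  have "?X = \<zero> \<or> ?Y = \<zero>"
    using deg S.compress_monomial_zero[OF sets(1,2) lens(1,2) uv(1) uv'(1) _ ij(1,2,5)]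
      T.compress_monomial_zero[OF sets(3,4) lens(3,4) uv(2) uv'(2) _ ij(3,4,5)] by blast
  then have d0: "d \<odot> (?X \<otimes> ?Y) = \<zero>" using wc sets by auto
  have "(pair_word p \<otimes> separator N)\<^sup>\<star> \<otimes> x \<otimes> (pair_word p' \<otimes> separator N) = (cnj c * c') \<odot> (d \<odot> (?X \<otimes> ?Y))"
    unfolding c c' d[symmetric] using wc xc
    by (simp add: adj_smult smult_mult_left smult_mult_right smult_smult mult.commute)
  then show ?thesis unfolding d0 x_def by simp
qed

end

text \<open>
  Here \<open>\<Phi>\<close> is any linear map that projects the polynomials in question onto their part of degree zero.
  Let \<open>V = amp W\<close> for the separating isometry \<open>W\<close>. The compression \<open>V\<^sup>\<star> b V\<close> is as close to
  \<open>J\<close> as \<open>b\<close> is, and it lies in the corner, so it has norm at most \<open>r\<close>. Its entries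
  \<open>W\<^sup>\<star> (T\<^sub>p)\<^sup>\<star> b (T\<^sub>p\<^sub>') W\<close> are those of \<open>\<Phi> b\<close>: monomials of degree zero have scalar entries, which \<open>W\<close>
  leaves alone, and the entries of all other monomials are killed. So \<open>\<Phi> b\<close> differs
  from an element of norm at most \<open>r\<close> by an element of \<open>M\<close>.
\<close>

lemma expectation_near:
  assumes J: "closed_ideal J A" "J \<noteq> carrier A"
    and M: "ideal M A" "\<one> \<ominus> S.amp \<one> \<in> M" "\<one> \<ominus> T.amp \<one> \<in> M"
    and \<Phi>: "\<Phi> \<zero> = \<zero>" "\<And>x. x \<in> carrier A \<Longrightarrow> \<Phi> x \<in> carrier A"
      "\<And>c x y. \<lbrakk>x \<in> carrier A; y \<in> carrier A\<rbrakk> \<Longrightarrow> \<Phi> (c \<odot> x \<oplus> y) = c \<odot> \<Phi> x \<oplus> \<Phi> y"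
    and \<Phi>m: "\<And>\<mu> \<nu> \<alpha> \<beta>. \<lbrakk>set \<mu> \<subseteq> {1..n}; set \<nu> \<subseteq> {1..n}; set \<alpha> \<subseteq> {1..m}; set \<beta> \<subseteq> {1..m};
       length \<mu> \<le> N; length \<nu> \<le> N; length \<alpha> \<le> N; length \<beta> \<le> N\<rbrakk> \<Longrightarrow>
       \<Phi> (S.monomial \<mu> \<nu> \<otimes> T.monomial \<alpha> \<beta>) =
         (if length \<mu> = length \<nu> \<and> length \<alpha> = length \<beta> then S.monomial \<mu> \<nu> \<otimes> T.monomial \<alpha> \<beta> else \<zero>)"
    and b: "b \<in> lspan (mons N)" and near: "near J b r"
  shows "near M (\<Phi> b) r"
proof -
  interpret F: isometry_family A "pairs N" pair_word by (rule pair_family)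
  have idJ: "ideal J A" using J closed_ideal_def by blast
  let ?W = "separator N"
  define comp where "comp x = (F.amp ?W)\<^sup>\<star> \<otimes> x \<otimes> F.amp ?W" for x
  have compc: "comp x \<in> carrier A" if "x \<in> carrier A" for x using that by (simp add: comp_def)
  have comp0: "comp \<zero> = \<zero>" by (simp add: comp_def)
  have complin: "comp (c \<odot> x \<oplus> y) = c \<odot> comp x \<oplus> comp y" if "x \<in> carrier A" "y \<in> carrier A" for c x y
    using that by (simp add: comp_def l_distr r_distr smult_mult_left smult_mult_right)
  have mono: "comp x \<in> F.corner \<and> comp x \<ominus> \<Phi> x \<in> M" if xm: "x \<in> mons N" for x
  proof -
    obtain \<mu> \<nu> \<alpha> \<beta> where x: "x = S.monomial \<mu> \<nu> \<otimes> T.monomial \<alpha> \<beta>"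
      and sets: "set \<mu> \<subseteq> {1..n}" "set \<nu> \<subseteq> {1..n}" "set \<alpha> \<subseteq> {1..m}" "set \<beta> \<subseteq> {1..m}"
      and lens: "length \<mu> \<le> N" "length \<nu> \<le> N" "length \<alpha> \<le> N" "length \<beta> \<le> N"
      using xm by (auto simp: mons_def)
    have xc: "x \<in> carrier A" using sets by (simp add: x)
    have key: "\<exists>c. (pair_word p)\<^sup>\<star> \<otimes> comp x \<otimes> pair_word p' = c \<odot> \<one> \<and>
        (pair_word p)\<^sup>\<star> \<otimes> \<Phi> x \<otimes> pair_word p' = c \<odot> \<one>" if pp: "p \<in> pairs N" "p' \<in> pairs N" for p p'
    proof -
      have entry: "(pair_word p)\<^sup>\<star> \<otimes> comp x \<otimes> pair_word p' = ?W\<^sup>\<star> \<otimes> ((pair_word p)\<^sup>\<star> \<otimes> x \<otimes> pair_word p') \<otimes> ?W"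
        unfolding comp_def by (rule F.amp_compression(3)[OF separator_closed xc pp])
      show ?thesis
      proof (cases "length \<mu> = length \<nu> \<and> length \<alpha> = length \<beta>")
        case True
        obtain c where c: "(pair_word p)\<^sup>\<star> \<otimes> x \<otimes> pair_word p' = c \<odot> \<one>"
          using compress_degree_zero[OF sets lens _ _ pp] True x by blast
        have "\<Phi> x = x" using \<Phi>m[OF sets lens] True by (simp add: x)
        then show ?thesis unfolding entry c
          by (auto simp: c smult_mult_left smult_mult_right separator_isometry intro!: exI[of _ c])
      next
        case False
        have "?W\<^sup>\<star> \<otimes> ((pair_word p)\<^sup>\<star> \<otimes> x \<otimes> pair_word p') \<otimes> ?W =
            (pair_word p \<otimes> ?W)\<^sup>\<star> \<otimes> x \<otimes> (pair_word p' \<otimes> ?W)"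
          using pp xc by (simp add: adj_mult m_assoc)
        then have "(pair_word p)\<^sup>\<star> \<otimes> comp x \<otimes> pair_word p' = \<zero>"
          using compress_degree_nonzero[OF sets lens False pp] entry x by simp
        moreover have "\<Phi> x = \<zero>" using \<Phi>m[OF sets lens] False by (simp add: x)
        ultimately show ?thesis using pp by (intro exI[of _ 0]) simp
      qed
    qed
    have "comp x \<in> F.corner"
      unfolding F.corner_def using key compc[OF xc] F.amp_compression(1,2)[OF separator_closed xc]
      by (auto simp: comp_def) blast
    moreover have "comp x \<ominus> \<Phi> x \<in> M"
    proof (rule ideal_mem_by_pairs[OF M])
      show "comp x \<ominus> \<Phi> x \<in> carrier A" using compc[OF xc] \<Phi>(2)[OF xc] by simp
      fix p p' assume pp: "p \<in> pairs N" "p' \<in> pairs N"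
      have "(pair_word p)\<^sup>\<star> \<otimes> (comp x \<ominus> \<Phi> x) \<otimes> pair_word p' =
         (pair_word p)\<^sup>\<star> \<otimes> comp x \<otimes> pair_word p' \<ominus> (pair_word p)\<^sup>\<star> \<otimes> \<Phi> x \<otimes> pair_word p'"
        using pp compc[OF xc] \<Phi>(2)[OF xc] by (simp add: l_distr_diff r_distr_diff)
      also have "\<dots> = \<zero>" using key[OF pp] by auto
      finally show "(pair_word p)\<^sup>\<star> \<otimes> (comp x \<ominus> \<Phi> x) \<otimes> pair_word p' \<in> M" using ideal_zero[OF M(1)] by simp
    qed
    ultimately show ?thesis by blast
  qed
  have bc: "b \<in> carrier A" using lspan_closed[OF b mons_closed] .
  have "comp b \<in> F.corner \<and> comp b \<ominus> \<Phi> b \<in> M"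
    using b
  proof (induct rule: lspan.induct)
    case zero
    then show ?case using comp0 \<Phi>(1) F.corner_zero ideal_zero[OF M(1)] by simp
  next
    case (step x y c)
    have c: "x \<in> carrier A" "y \<in> carrier A" using step mons_closed lspan_closed by blast+
    have "comp (c \<odot> x \<oplus> y) \<ominus> \<Phi> (c \<odot> x \<oplus> y) = c \<odot> (comp x \<ominus> \<Phi> x) \<oplus> (comp y \<ominus> \<Phi> y)"
      using c compc \<Phi> by (simp add: complin diff_diff_add smult_diff_right)
    then show ?case using step mono[OF step(1)] complin[OF c] F.corner_lincomb
      by (auto intro!: ideal_add[OF M(1)] ideal_smult[OF M(1)])
  qed
  moreover have Vn: "cnorm A (F.amp ?W) \<le> 1" by (rule F.amp_isometry_norm[OF separator_closed separator_isometry])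
  then have "near J (comp b) r"
    unfolding comp_def using bc by (intro near_mult_right[OF idJ] near_mult_left[OF idJ] near) auto
  ultimately have "cnorm A (comp b) \<le> r" and d: "comp b \<ominus> \<Phi> b \<in> M" using F.corner_norm_le[OF J] by auto
  then have "near M (comp b) r" using near_norm[OF M(1)] compc[OF bc] by blast
  moreover have "\<Phi> b \<ominus> comp b \<in> M"
    using ideal_smult[OF M(1) d, of "-1"] compc[OF bc] \<Phi>(2)[OF bc] by (simp add: smult_minus_one minus_minus_swap)
  ultimately show ?thesis using near_congr[OF M(1)] compc[OF bc] \<Phi>(2)[OF bc] by blast
qed

end

section \<open>Fejer kernels and density of the polynomials\<close>

subsection \<open>Sums over roots of unity\<close>

definition unity_root :: "nat \<Rightarrow> nat \<Rightarrow> complex" where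
  "unity_root K l = cis (2 * pi * real l / real K)"

lemma norm_unity_root [simp]: "cmod (unity_root K l) = 1"
  by (simp add: unity_root_def)

lemma sum_unity_root:
  assumes "a < K" "b < K"
  shows "(\<Sum>l<K. unity_root K l ^ a * cnj (unity_root K l) ^ b) = (if a = b then of_nat K else 0)"
proof -
  define y where "y = unity_root K a * cnj (unity_root K b)"
  have swap: "unity_root K l ^ c = unity_root K c ^ l" for l c
    unfolding unity_root_def Complex.DeMoivre by (rule arg_cong[where f = cis]) simp
  have pow: "unity_root K l ^ a * cnj (unity_root K l) ^ b = y ^ l" for l
    unfolding y_def power_mult_distrib swap[of a l, symmetric] complex_cnj_power[symmetric] swap[of b l, symmetric] ..
  have "unity_root K K = 1" using assms by (simp add: unity_root_def)
  then have yK: "y ^ K = 1"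
    unfolding y_def power_mult_distrib complex_cnj_power[symmetric] swap[of _ K] by simp
  show ?thesis
  proof (cases "a = b")
    case True
    have "y = 1" using True complex_norm_square[of "unity_root K b"] by (simp add: y_def)
    then show ?thesis unfolding pow using True by simp
  next
    case False
    have "y \<noteq> 1"
    proof
      assume "y = 1"
      have "cnj (unity_root K b) * unity_root K b = 1"
        using complex_norm_square[of "unity_root K b"] by (simp add: mult.commute)
      then have "unity_root K a = y * unity_root K b" by (simp add: y_def mult.assoc)
      then have "unity_root K a = unity_root K b" using \<open>y = 1\<close> by simp
      moreover have "inj_on (\<lambda>k. cis (2 * pi * real k / real K)) {..<K}"
        using Complex.bij_betw_roots_unity[of K] assms by (auto simp: bij_betw_def)
      ultimately show False using False assms by (auto simp: unity_root_def inj_on_def)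
    qed
    then show ?thesis unfolding pow using False yK by (simp add: sum_gp_strict)
  qed
qed

text \<open>Averaging the rotations by roots of unity with these coefficients extracts the Fourier mode of
  degree \<open>j - i\<close>, see \<open>sum_mode_char\<close>.\<close>

definition mode :: "nat \<Rightarrow> nat \<Rightarrow> nat \<Rightarrow> nat \<Rightarrow> complex" where
  "mode K i j l = unity_root K l ^ i * cnj (unity_root K l) ^ j / of_nat K"

definition fejer :: "nat \<Rightarrow> nat \<Rightarrow> nat \<Rightarrow> complex" where
  "fejer L K l = (\<Sum>i<L. \<Sum>j<L. mode K i j l) / of_nat L"

lemma sum_norm_mode: "K > 0 \<Longrightarrow> (\<Sum>l<K. cmod (mode K i j l)) = 1"
  by (simp add: mode_def norm_mult norm_power norm_divide)

lemma sum_mode_char: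
  assumes "i + p < K" "j + p' < K"
  shows "(\<Sum>l<K. mode K i j l * (unity_root K l ^ p * cnj (unity_root K l) ^ p')) = (if i + p = j + p' then 1 else 0)"
proof -
  have "(\<Sum>l<K. mode K i j l * (unity_root K l ^ p * cnj (unity_root K l) ^ p')) =
     (\<Sum>l<K. unity_root K l ^ (i + p) * cnj (unity_root K l) ^ (j + p')) / of_nat K"
    by (simp add: mode_def sum_divide_distrib power_add mult_ac)
  then show ?thesis using sum_unity_root[OF assms] assms by simp
qed

text \<open>
  The Fourier coefficient of the Fejer kernel, \<open>max 0 (1 - \<bar>p - p'\<bar> / L)\<close>, as a count of lattice points.
  Degrees are kept as pairs of word lengths \<open>p\<close> and \<open>p'\<close> so that all exponents are natural numbers.
\<close>

definition fejer_weight :: "nat \<Rightarrow> nat \<Rightarrow> nat \<Rightarrow> real" where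
  "fejer_weight L p p' = (\<Sum>i<L. \<Sum>j<L. if i + p = j + p' then 1 else 0) / real L"

lemma sum_fejer_char:
  assumes "L + p \<le> K" "L + p' \<le> K"
  shows "(\<Sum>l<K. fejer L K l * (unity_root K l ^ p * cnj (unity_root K l) ^ p')) = of_real (fejer_weight L p p')"
proof -
  have "(\<Sum>l<K. fejer L K l * (unity_root K l ^ p * cnj (unity_root K l) ^ p')) =
    (\<Sum>l<K. \<Sum>i<L. \<Sum>j<L. mode K i j l * (unity_root K l ^ p * cnj (unity_root K l) ^ p') / of_nat L)"
    by (simp add: fejer_def sum_distrib_right sum_divide_distrib)
  also have "\<dots> = (\<Sum>i<L. \<Sum>l<K. \<Sum>j<L. mode K i j l * (unity_root K l ^ p * cnj (unity_root K l) ^ p') / of_nat L)"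
    by (rule sum.swap)
  also have "\<dots> = (\<Sum>i<L. \<Sum>j<L. \<Sum>l<K. mode K i j l * (unity_root K l ^ p * cnj (unity_root K l) ^ p') / of_nat L)"
    by (rule sum.cong[OF refl], rule sum.swap)
  also have "\<dots> = (\<Sum>i<L. \<Sum>j<L. (if i + p = j + p' then 1 else 0) / of_nat L)"
    using assms by (intro sum.cong refl) (simp add: sum_mode_char flip: sum_divide_distrib)
  also have "\<dots> = of_real (fejer_weight L p p')"
    by (simp add: fejer_weight_def flip: sum_divide_distrib) (simp add: if_distrib[of of_real] cong: if_cong)
  finally show ?thesis .
qed

lemma fejer_weight_bounds:
  assumes "p \<le> N" "p' \<le> N" "L > 0"
  shows "fejer_weight L p p' \<le> 1" "1 - 2 * real N / real L \<le> fejer_weight L p p'" "0 \<le> fejer_weight L p p'"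
proof -
  have inner: "(\<Sum>j<L. if i + p = j + p' then 1 else 0) = (if p' \<le> i + p \<and> i + p < L + p' then 1 else (0::real))" for i
  proof (cases "p' \<le> i + p")
    case True
    then have "(\<Sum>j<L. if i + p = j + p' then 1 else 0) = (\<Sum>j<L. if j = i + p - p' then 1 else (0::real))"
      by (intro sum.cong refl) auto
    then show ?thesis using True by auto
  next
    case False then show ?thesis by auto
  qed
  have "(\<Sum>i<L. \<Sum>j<L. if i + p = j + p' then 1 else 0) \<le> (\<Sum>i<L. (1::real))"
    unfolding inner by (intro sum_mono) auto
  then show "fejer_weight L p p' \<le> 1" using assms by (simp add: fejer_weight_def)
  show "0 \<le> fejer_weight L p p'" by (auto simp: fejer_weight_def intro!: divide_nonneg_nonneg sum_nonneg)
  have "real L - 2 * real N \<le> real (card {N..<L - N})" by simp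
  also have "\<dots> = (\<Sum>i\<in>{N..<L - N}. 1)" by simp
  also have "\<dots> \<le> (\<Sum>i<L. if p' \<le> i + p \<and> i + p < L + p' then 1 else (0::real))"
  proof -
    have "(\<Sum>i\<in>{N..<L - N}. 1) = (\<Sum>i\<in>{N..<L - N}. if p' \<le> i + p \<and> i + p < L + p' then 1 else (0::real))"
      using assms by (intro sum.cong) auto
    also have "\<dots> \<le> (\<Sum>i<L. if p' \<le> i + p \<and> i + p < L + p' then 1 else (0::real))"
      by (rule sum_mono2) auto
    finally show ?thesis .
  qed
  finally have "real L - 2 * real N \<le> (\<Sum>i<L. \<Sum>j<L. if i + p = j + p' then 1 else 0)" unfolding inner .
  then have "(real L - 2 * real N) / real L \<le> fejer_weight L p p'"
    unfolding fejer_weight_def by (rule divide_right_mono) simp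
  then show "1 - 2 * real N / real L \<le> fejer_weight L p p'"
    using assms by (simp add: diff_divide_distrib)
qed

lemma fejer_weight_product_bound:
  assumes "p \<le> N" "p' \<le> N" "r \<le> N" "r' \<le> N" "L > 0"
  shows "\<bar>fejer_weight L p p' * fejer_weight L r r' - 1\<bar> \<le> 4 * real N / real L"
proof -
  let ?x = "fejer_weight L p p'" and ?y = "fejer_weight L r r'"
  have b: "?x \<le> 1" "1 - 2 * real N / real L \<le> ?x" "0 \<le> ?x" "?y \<le> 1" "1 - 2 * real N / real L \<le> ?y" "0 \<le> ?y"
    by (fact fejer_weight_bounds[OF assms(1,2,5)] fejer_weight_bounds[OF assms(3,4,5)])+
  have "?x * ?y \<le> 1" using b by (simp add: mult_le_one)
  moreover have "1 - ?x * ?y = (1 - ?x) + ?x * (1 - ?y)" by (simp add: algebra_simps)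
  moreover have "?x * (1 - ?y) \<le> 1 * (1 - ?y)" using b by (intro mult_right_mono) auto
  ultimately show ?thesis using b by simp
qed

text \<open>
  The kernel is the squared modulus of a Dirichlet kernel. Its nonnegativity and total mass one are what makes
  Fejer means contractive.
\<close>

lemma fejer_nonneg: "fejer L K l = of_real ((cmod (\<Sum>i<L. unity_root K l ^ i))\<^sup>2 / (real K * real L))"
proof -
  have "complex_of_real ((cmod (\<Sum>i<L. unity_root K l ^ i))\<^sup>2) =
      (\<Sum>i<L. unity_root K l ^ i) * cnj (\<Sum>i<L. unity_root K l ^ i)"
    by (simp only: complex_norm_square)
  also have "\<dots> = (\<Sum>i<L. \<Sum>j<L. unity_root K l ^ i * cnj (unity_root K l) ^ j)"
    by (simp add: sum_product)
  finally show ?thesis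
    by (simp add: fejer_def mode_def sum_divide_distrib)
qed

lemma sum_norm_fejer:
  assumes "0 < L" "L \<le> K" shows "(\<Sum>l<K. cmod (fejer L K l)) = 1"
proof -
  have "complex_of_real (\<Sum>l<K. cmod (fejer L K l)) = (\<Sum>l<K. fejer L K l)"
    by (simp add: fejer_nonneg norm_divide norm_power norm_mult)
  also have "\<dots> = of_real (fejer_weight L 0 0)"
    using sum_fejer_char[of L 0 K 0] assms by simp
  also have "fejer_weight L 0 0 = 1" using assms by (simp add: fejer_weight_def)
  finally show ?thesis using of_real_eq_1_iff by metis
qed

subsection \<open>Density of the polynomials\<close>

context E_family
begin

definition polys :: "'a set" where
  "polys = lspan (\<Union>N. mons N)"

lemma Mons_closed: "(\<Union>N. mons N) \<subseteq> carrier A"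
  using mons_closed by auto

lemma polys_closed: "x \<in> polys \<Longrightarrow> x \<in> carrier A"
  unfolding polys_def using lspan_closed[OF _ Mons_closed] .

lemma mons_mono: "N \<le> N' \<Longrightarrow> mons N \<subseteq> mons N'"
proof
  fix x assume N: "N \<le> N'" and "x \<in> mons N"
  then obtain \<mu> \<nu> \<alpha> \<beta> where x: "x = S.monomial \<mu> \<nu> \<otimes> T.monomial \<alpha> \<beta>"
    and "set \<mu> \<subseteq> {1..n}" "set \<nu> \<subseteq> {1..n}" "set \<alpha> \<subseteq> {1..m}" "set \<beta> \<subseteq> {1..m}"
      "length \<mu> \<le> N" "length \<nu> \<le> N" "length \<alpha> \<le> N" "length \<beta> \<le> N"
    unfolding mons_def by blast
  then show "x \<in> mons N'"
    unfolding mons_def using N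
    by (intro CollectI exI[of _ \<mu>] exI[of _ \<nu>] exI[of _ \<alpha>] exI[of _ \<beta>] conjI) simp_all
qed

lemma polys_bounded: "x \<in> polys \<Longrightarrow> \<exists>N. x \<in> lspan (mons N)"
  unfolding polys_def
proof (induct rule: lspan.induct)
  case zero show ?case using lspan.zero by blast
next
  case (step x y c)
  then obtain N N' where "x \<in> mons N" "y \<in> lspan (mons N')" by blast
  then have "x \<in> mons (max N N')" "y \<in> lspan (mons (max N N'))"
    using mons_mono[of N "max N N'"] lspan_mono[OF _ mons_mono[of N' "max N N'"]] by auto
  then show ?case using lspan.step by blast
qed

lemma polys_zero: "\<zero> \<in> polys" unfolding polys_def by (rule lspan.zero)

lemma polys_add: "\<lbrakk>x \<in> polys; y \<in> polys\<rbrakk> \<Longrightarrow> x \<oplus> y \<in> polys"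
  unfolding polys_def by (rule lspan_add[OF _ _ Mons_closed])

lemma polys_smult: "x \<in> polys \<Longrightarrow> c \<odot> x \<in> polys"
  unfolding polys_def by (rule lspan_smult[OF _ Mons_closed])

lemma mono_polys:
  assumes "set \<mu> \<subseteq> {1..n}" "set \<nu> \<subseteq> {1..n}" "set \<alpha> \<subseteq> {1..m}" "set \<beta> \<subseteq> {1..m}"
  shows "S.monomial \<mu> \<nu> \<otimes> T.monomial \<alpha> \<beta> \<in> polys"
proof -
  let ?N = "length \<mu> + length \<nu> + length \<alpha> + length \<beta>"
  have "S.monomial \<mu> \<nu> \<otimes> T.monomial \<alpha> \<beta> \<in> mons ?N"
    unfolding mons_def using assms
    by (intro CollectI exI[of _ \<mu>] exI[of _ \<nu>] exI[of _ \<alpha>] exI[of _ \<beta>] conjI refl) simp_all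
  then show ?thesis unfolding polys_def by (intro lspan_base[OF _ Mons_closed]) blast
qed

lemma one_polys: "\<one> \<in> polys"
  using mono_polys[of "[]" "[]" "[]" "[]"] by (simp add: S.monomial_def T.monomial_def)

text \<open>
  The left multipliers of the space of polynomials form an algebra that contains the generators and
  their adjoints. So they contain all polynomials, which makes the polynomials an algebra.
\<close>

definition mults :: "'a set" where
  "mults = {y \<in> carrier A. \<forall>x\<in>polys. y \<otimes> x \<in> polys}"

lemma multsI:
  assumes y: "y \<in> carrier A"
    and "\<And>\<mu> \<nu> \<alpha> \<beta>. \<lbrakk>set \<mu> \<subseteq> {1..n}; set \<nu> \<subseteq> {1..n}; set \<alpha> \<subseteq> {1..m}; set \<beta> \<subseteq> {1..m}\<rbrakk> \<Longrightarrow>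
      y \<otimes> (S.monomial \<mu> \<nu> \<otimes> T.monomial \<alpha> \<beta>) \<in> polys"
  shows "y \<in> mults"
proof -
  have "y \<otimes> x \<in> polys" if "x \<in> polys" for x
    using that unfolding polys_def
  proof (rule lspan_linear_image[where g = "\<lambda>c. c", OF _ Mons_closed Mons_closed])
    fix x assume "x \<in> (\<Union>N. mons N)"
    then obtain N where "x \<in> mons N" by blast
    then obtain \<mu> \<nu> \<alpha> \<beta> where x: "x = S.monomial \<mu> \<nu> \<otimes> T.monomial \<alpha> \<beta>"
      and "set \<mu> \<subseteq> {1..n}" "set \<nu> \<subseteq> {1..n}" "set \<alpha> \<subseteq> {1..m}" "set \<beta> \<subseteq> {1..m}"
      unfolding mons_def by blast
    then show "y \<otimes> x \<in> lspan (\<Union>N. mons N)"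
      unfolding x polys_def[symmetric] by (intro assms(2))
  qed (use y in \<open>auto simp: r_distr smult_mult_right\<close>)
  then show ?thesis using y by (simp add: mults_def)
qed

lemma mults_mult: "\<lbrakk>x \<in> mults; y \<in> mults\<rbrakk> \<Longrightarrow> x \<otimes> y \<in> mults"
  by (simp add: mults_def m_assoc polys_closed)

lemma mults_one: "\<one> \<in> mults" by (simp add: mults_def polys_closed)

lemma s_mults: assumes i: "i \<in> {1..n}" shows "s i \<in> mults" "(s i)\<^sup>\<star> \<in> mults"
proof -
  show "s i \<in> mults"
  proof (rule multsI)
    fix \<mu> \<nu> \<alpha> \<beta> assume sets: "set \<mu> \<subseteq> {1..n}" "set \<nu> \<subseteq> {1..n}" "set \<alpha> \<subseteq> {1..m}" "set \<beta> \<subseteq> {1..m}"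
    then show "s i \<otimes> (S.monomial \<mu> \<nu> \<otimes> T.monomial \<alpha> \<beta>) \<in> polys"
      using i mono_polys[of "i # \<mu>" \<nu> \<alpha> \<beta>] S.T_monomial[of i \<mu> \<nu>] by (simp flip: m_assoc)
  qed (use i in simp)
  show "(s i)\<^sup>\<star> \<in> mults"
  proof (rule multsI)
    fix \<mu> \<nu> \<alpha> \<beta> assume sets: "set \<mu> \<subseteq> {1..n}" "set \<nu> \<subseteq> {1..n}" "set \<alpha> \<subseteq> {1..m}" "set \<beta> \<subseteq> {1..m}"
    then show "(s i)\<^sup>\<star> \<otimes> (S.monomial \<mu> \<nu> \<otimes> T.monomial \<alpha> \<beta>) \<in> polys"
      using i S.adj_T_monomial[of i \<mu> \<nu>] mono_polys
      by (auto simp: polys_zero simp flip: m_assoc split: list.splits)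
  qed (use i in simp)
qed

lemma t_mults: assumes r: "r \<in> {1..m}" shows "t r \<in> mults" "(t r)\<^sup>\<star> \<in> mults"
proof -
  have main: "y \<otimes> (S.monomial \<mu> \<nu> \<otimes> T.monomial \<alpha> \<beta>) \<in> polys"
    if y: "y \<in> Tq" and yp: "S.monomial \<mu> \<nu> \<otimes> (y \<otimes> T.monomial \<alpha> \<beta>) \<in> polys"
      and sets: "set \<mu> \<subseteq> {1..n}" "set \<nu> \<subseteq> {1..n}" "set \<alpha> \<subseteq> {1..m}" "set \<beta> \<subseteq> {1..m}" for y \<mu> \<nu> \<alpha> \<beta>
  proof -
    obtain c where "y \<otimes> S.monomial \<mu> \<nu> = c \<odot> (S.monomial \<mu> \<nu> \<otimes> y)"
      using qcomm_sym[OF Sq_Tq_qcomm[OF monomial_Sq[OF sets(1,2)] y]] sets Tq_closed[OF y] by (auto simp: qcomm_def)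
    then have "y \<otimes> (S.monomial \<mu> \<nu> \<otimes> T.monomial \<alpha> \<beta>) = c \<odot> (S.monomial \<mu> \<nu> \<otimes> (y \<otimes> T.monomial \<alpha> \<beta>))"
      using sets Tq_closed[OF y] by (simp add: smult_mult_left m_assoc flip: m_assoc[of y])
    then show ?thesis using polys_smult[OF yp] by simp
  qed
  show "t r \<in> mults"
  proof (rule multsI)
    fix \<mu> \<nu> \<alpha> \<beta> assume sets: "set \<mu> \<subseteq> {1..n}" "set \<nu> \<subseteq> {1..n}" "set \<alpha> \<subseteq> {1..m}" "set \<beta> \<subseteq> {1..m}"
    then show "t r \<otimes> (S.monomial \<mu> \<nu> \<otimes> T.monomial \<alpha> \<beta>) \<in> polys"
      using r mono_polys[of \<mu> \<nu> "r # \<alpha>" \<beta>] T.T_monomial[of r \<alpha> \<beta>] by (intro main t_Tq) auto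
  qed (use r in simp)
  show "(t r)\<^sup>\<star> \<in> mults"
  proof (rule multsI)
    fix \<mu> \<nu> \<alpha> \<beta> assume sets: "set \<mu> \<subseteq> {1..n}" "set \<nu> \<subseteq> {1..n}" "set \<alpha> \<subseteq> {1..m}" "set \<beta> \<subseteq> {1..m}"
    then have "S.monomial \<mu> \<nu> \<otimes> ((t r)\<^sup>\<star> \<otimes> T.monomial \<alpha> \<beta>) \<in> polys"
      using r T.adj_T_monomial[of r \<alpha> \<beta>] mono_polys by (auto simp: polys_zero split: list.splits)
    then show "(t r)\<^sup>\<star> \<otimes> (S.monomial \<mu> \<nu> \<otimes> T.monomial \<alpha> \<beta>) \<in> polys"
      using r sets by (intro main Tq_adj t_Tq) auto
  qed (use r in simp)
qed

lemma word_mults_s: "set u \<subseteq> {1..n} \<Longrightarrow> S.word u \<in> mults \<and> (S.word u)\<^sup>\<star> \<in> mults"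
  by (induct u) (auto simp: adj_mult intro!: mults_one mults_mult s_mults)

lemma word_mults_t: "set v \<subseteq> {1..m} \<Longrightarrow> T.word v \<in> mults \<and> (T.word v)\<^sup>\<star> \<in> mults"
  by (induct v) (auto simp: adj_mult intro!: mults_one mults_mult t_mults)

lemma monomial_mults:
  "\<lbrakk>set \<mu> \<subseteq> {1..n}; set \<nu> \<subseteq> {1..n}\<rbrakk> \<Longrightarrow> S.monomial \<mu> \<nu> \<in> mults"
  "\<lbrakk>set \<alpha> \<subseteq> {1..m}; set \<beta> \<subseteq> {1..m}\<rbrakk> \<Longrightarrow> T.monomial \<alpha> \<beta> \<in> mults"
  using word_mults_s word_mults_t by (simp_all add: S.monomial_def T.monomial_def mults_mult)

lemma mults_polys: "x \<in> mults \<Longrightarrow> x \<in> polys"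
  using one_polys by (auto simp: mults_def dest!: bspec)

lemma polys_mults: "x \<in> polys \<Longrightarrow> x \<in> mults"
  unfolding polys_def
proof (induct rule: lspan.induct)
  case zero then show ?case by (auto simp: mults_def polys_closed polys_zero)
next
  case (step x y c)
  then have "x \<in> mults" unfolding mons_def by (auto intro!: mults_mult monomial_mults)
  then show ?case using step(3) unfolding mults_def
    by (auto simp: l_distr smult_mult_left polys_closed intro!: polys_add polys_smult)
qed

lemma polys_mult: "\<lbrakk>x \<in> polys; y \<in> polys\<rbrakk> \<Longrightarrow> x \<otimes> y \<in> polys"
  using polys_mults by (simp add: mults_def)

lemma polys_adj: "x \<in> polys \<Longrightarrow> x\<^sup>\<star> \<in> polys"
  unfolding polys_def
proof (rule lspan_linear_image[where f = "adj A" and g = cnj, OF _ Mons_closed Mons_closed])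
  fix x assume "x \<in> (\<Union>N. mons N)"
  then obtain \<mu> \<nu> \<alpha> \<beta> where x: "x = S.monomial \<mu> \<nu> \<otimes> T.monomial \<alpha> \<beta>"
      and sets: "set \<mu> \<subseteq> {1..n}" "set \<nu> \<subseteq> {1..n}" "set \<alpha> \<subseteq> {1..m}" "set \<beta> \<subseteq> {1..m}"
    unfolding mons_def by blast
  have "x\<^sup>\<star> = T.monomial \<beta> \<alpha> \<otimes> S.monomial \<nu> \<mu>"
    using sets by (simp add: x adj_mult S.monomial_def T.monomial_def)
  then have "x\<^sup>\<star> \<in> polys" using sets by (simp add: mults_polys mults_mult monomial_mults)
  then show "x\<^sup>\<star> \<in> lspan (\<Union>N. mons N)" by (simp add: polys_def)
qed (auto simp: adj_add adj_smult)

lemma polys_dense: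
  assumes "cstar_generated_by A (s ` {1..n} \<union> t ` {1..m})" "a \<in> carrier A" "0 < e"
  obtains p where "p \<in> polys" "cnorm A (a \<ominus> p) < e"
proof (rule dense_of_generated[OF assms(1), of polys a e])
  show "s ` {1..n} \<union> t ` {1..m} \<subseteq> polys" using s_mults t_mults mults_polys by auto
qed (use assms that one_polys polys_add polys_mult polys_adj polys_smult polys_closed in auto)

end

section \<open>Gauge automorphisms and Fourier modes\<close>

locale universal_E_family = E_family +
  assumes gen: "cstar_generated_by A (s ` {1..n} \<union> t ` {1..m})"
    and univ: "E_universal_for TYPE('a) n m q A s t"
begin

lemma rotated_relations:
  assumes z: "cmod z = 1" and w: "cmod w = 1"
  shows "E_relations n m q A (\<lambda>i. z \<odot> s i) (\<lambda>r. w \<odot> t r)"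
proof -
  have u: "z * cnj z = 1" "w * cnj w = 1"
    using z w by (simp_all flip: complex_norm_square)
  show ?thesis
    unfolding E_relations_def
    using u S.T_orth T.T_orth adj_s_t
    by (auto simp: adj_smult smult_mult_left smult_mult_right smult_smult mult_ac)
qed

text \<open>
  The gauge action of the torus, as provided by the universal property.
\<close>

definition gauge :: "complex \<Rightarrow> complex \<Rightarrow> 'a \<Rightarrow> 'a" where
  "gauge z w = (SOME h. h \<in> star_hom A A \<and> (\<forall>i\<in>{1..n}. h (s i) = z \<odot> s i) \<and> (\<forall>r\<in>{1..m}. h (t r) = w \<odot> t r))"

context
  fixes z w :: complex assumes zw: "cmod z = 1" "cmod w = 1"
begin

lemma gauge: "gauge z w \<in> star_hom A A" "i \<in> {1..n} \<Longrightarrow> gauge z w (s i) = z \<odot> s i"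
    "r \<in> {1..m} \<Longrightarrow> gauge z w (t r) = w \<odot> t r"
proof -
  have "\<exists>h. h \<in> star_hom A A \<and> (\<forall>i\<in>{1..n}. h (s i) = z \<odot> s i) \<and> (\<forall>r\<in>{1..m}. h (t r) = w \<odot> t r)"
    using univ rotated_relations[OF zw] unital_cstar_algebra_axioms unfolding E_universal_for_def by blast
  then have *: "gauge z w \<in> star_hom A A \<and> (\<forall>i\<in>{1..n}. gauge z w (s i) = z \<odot> s i) \<and> (\<forall>r\<in>{1..m}. gauge z w (t r) = w \<odot> t r)"
    unfolding gauge_def by (rule someI_ex)
  then show "gauge z w \<in> star_hom A A" "i \<in> {1..n} \<Longrightarrow> gauge z w (s i) = z \<odot> s i"
    "r \<in> {1..m} \<Longrightarrow> gauge z w (t r) = w \<odot> t r" by auto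
qed

lemma gauge_hom:
  shows gauge_closed: "x \<in> carrier A \<Longrightarrow> gauge z w x \<in> carrier A"
    and gauge_mult: "\<lbrakk>x \<in> carrier A; y \<in> carrier A\<rbrakk> \<Longrightarrow> gauge z w (x \<otimes> y) = gauge z w x \<otimes> gauge z w y"
    and gauge_add: "\<lbrakk>x \<in> carrier A; y \<in> carrier A\<rbrakk> \<Longrightarrow> gauge z w (x \<oplus> y) = gauge z w x \<oplus> gauge z w y"
    and gauge_one: "gauge z w \<one> = \<one>"
    and gauge_smult: "x \<in> carrier A \<Longrightarrow> gauge z w (c \<odot> x) = c \<odot> gauge z w x"
    and gauge_adj: "x \<in> carrier A \<Longrightarrow> gauge z w (x\<^sup>\<star>) = (gauge z w x)\<^sup>\<star>"
proof -
  have h: "gauge z w \<in> ring_hom A A" using gauge(1) by (simp add: star_hom_def)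
  show "x \<in> carrier A \<Longrightarrow> gauge z w x \<in> carrier A"
    "\<lbrakk>x \<in> carrier A; y \<in> carrier A\<rbrakk> \<Longrightarrow> gauge z w (x \<otimes> y) = gauge z w x \<otimes> gauge z w y"
    "\<lbrakk>x \<in> carrier A; y \<in> carrier A\<rbrakk> \<Longrightarrow> gauge z w (x \<oplus> y) = gauge z w x \<oplus> gauge z w y"
    "gauge z w \<one> = \<one>"
    using ring_hom_closed[OF h] ring_hom_mult[OF h] ring_hom_add[OF h] ring_hom_one[OF h] by auto
  show "x \<in> carrier A \<Longrightarrow> gauge z w (c \<odot> x) = c \<odot> gauge z w x"
    "x \<in> carrier A \<Longrightarrow> gauge z w (x\<^sup>\<star>) = (gauge z w x)\<^sup>\<star>"
    using gauge(1) by (auto simp: star_hom_def)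
qed

lemma gauge_norm: "x \<in> carrier A \<Longrightarrow> cnorm A (gauge z w x) \<le> cnorm A x"
  using star_hom_contractive[OF unital_cstar_algebra_axioms unital_cstar_algebra_axioms gauge(1)] .

lemma gauge_word_s: "set u \<subseteq> {1..n} \<Longrightarrow> gauge z w (S.word u) = z ^ length u \<odot> S.word u"
  by (induct u) (auto simp: gauge_one gauge_mult gauge(2) smult_mult_left smult_mult_right smult_smult mult.commute)

lemma gauge_word_t: "set u \<subseteq> {1..m} \<Longrightarrow> gauge z w (T.word u) = w ^ length u \<odot> T.word u"
  by (induct u) (auto simp: gauge_one gauge_mult gauge(3) smult_mult_left smult_mult_right smult_smult mult.commute)

lemma gauge_monomial_s:
  assumes "set \<mu> \<subseteq> {1..n}" "set \<nu> \<subseteq> {1..n}"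
  shows "gauge z w (S.monomial \<mu> \<nu>) = (z ^ length \<mu> * cnj z ^ length \<nu>) \<odot> S.monomial \<mu> \<nu>"
  using assms by (simp add: S.monomial_def gauge_mult gauge_adj gauge_word_s adj_smult
     smult_mult_left smult_mult_right smult_smult mult.commute)

lemma gauge_monomial_t:
  assumes "set \<mu> \<subseteq> {1..m}" "set \<nu> \<subseteq> {1..m}"
  shows "gauge z w (T.monomial \<mu> \<nu>) = (w ^ length \<mu> * cnj w ^ length \<nu>) \<odot> T.monomial \<mu> \<nu>"
  using assms by (simp add: T.monomial_def gauge_mult gauge_adj gauge_word_t adj_smult
     smult_mult_left smult_mult_right smult_smult mult.commute)

end

abbreviation grid :: "nat \<Rightarrow> (nat \<times> nat) set" where
  "grid K \<equiv> {..<K} \<times> {..<K}"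

definition rot :: "nat \<Rightarrow> nat \<times> nat \<Rightarrow> 'a \<Rightarrow> 'a" where
  "rot K g = gauge (unity_root K (fst g)) (unity_root K (snd g))"

text \<open>
  The discrete substitute for integrals over the torus. On a fixed polynomial, the means with the
  coefficients used below do not depend on \<open>K\<close> once \<open>K\<close> is large enough.
\<close>

definition gmean :: "nat \<Rightarrow> (nat \<times> nat \<Rightarrow> complex) \<Rightarrow> 'a \<Rightarrow> 'a" where
  "gmean K c x = (\<Oplus>g\<in>grid K. c g \<odot> rot K g x)"

lemma rot_closed [simp]: "x \<in> carrier A \<Longrightarrow> rot K g x \<in> carrier A"
  unfolding rot_def by (rule gauge_closed) auto

lemma gmean_closed [simp]: "x \<in> carrier A \<Longrightarrow> gmean K c x \<in> carrier A"
  unfolding gmean_def by (rule finsum_closed) auto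

lemma rot_lincomb: "\<lbrakk>x \<in> carrier A; y \<in> carrier A\<rbrakk> \<Longrightarrow> rot K g (d \<odot> x \<oplus> y) = d \<odot> rot K g x \<oplus> rot K g y"
  unfolding rot_def by (simp add: gauge_add gauge_smult gauge_closed)

lemma gmean_lincomb:
  assumes "x \<in> carrier A" "y \<in> carrier A"
  shows "gmean K c (d \<odot> x \<oplus> y) = d \<odot> gmean K c x \<oplus> gmean K c y"
proof -
  have "gmean K c (d \<odot> x \<oplus> y) = (\<Oplus>g\<in>grid K. d \<odot> (c g \<odot> rot K g x) \<oplus> c g \<odot> rot K g y)"
    unfolding gmean_def using assms
    by (intro finsum_cong') (auto simp: rot_lincomb smult_add_right smult_smult mult.commute)
  also have "\<dots> = (\<Oplus>g\<in>grid K. d \<odot> (c g \<odot> rot K g x)) \<oplus> gmean K c y"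
    unfolding gmean_def using assms by (intro finsum_addf) auto
  also have "(\<Oplus>g\<in>grid K. d \<odot> (c g \<odot> rot K g x)) = d \<odot> gmean K c x"
    unfolding gmean_def using assms by (intro smult_finsum[symmetric]) auto
  finally show ?thesis .
qed

lemma gmean_zero: "gmean K c \<zero> = \<zero>"
  using gmean_lincomb[of \<zero> \<zero> K c "-1"]
  by (simp add: smult_minus_one l_neg)

lemma gmean_diff:
  assumes "x \<in> carrier A" "y \<in> carrier A"
  shows "gmean K c (x \<ominus> y) = gmean K c x \<ominus> gmean K c y"
  using gmean_lincomb[of y x K c "-1"] assms by (simp add: smult_minus_one a_minus_def a_comm)

lemma gmean_coeff_sum:
  assumes "finite X" "x \<in> carrier A"
  shows "gmean K (\<lambda>g. \<Sum>k\<in>X. c k g) x = (\<Oplus>k\<in>X. gmean K (c k) x)"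
  using assms(1)
proof (induct X rule: finite_induct)
  case empty
  then show ?case using assms(2) by (simp add: gmean_def)
next
  case (insert k X)
  have "gmean K (\<lambda>g. \<Sum>k\<in>insert k X. c k g) x = (\<Oplus>g\<in>grid K. c k g \<odot> rot K g x \<oplus> (\<Sum>k\<in>X. c k g) \<odot> rot K g x)"
    unfolding gmean_def using assms(2) insert(1,2)
    by (intro finsum_cong') (auto simp: smult_add_left)
  also have "\<dots> = gmean K (c k) x \<oplus> gmean K (\<lambda>g. \<Sum>k\<in>X. c k g) x"
    unfolding gmean_def using assms(2) by (intro finsum_addf) auto
  finally show ?case using insert assms(2) by (simp add: Pi_def)
qed

lemma gmean_norm:
  assumes "x \<in> carrier A"
  shows "cnorm A (gmean K c x) \<le> (\<Sum>g\<in>grid K. cmod (c g)) * cnorm A x"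
proof -
  have "cnorm A (gmean K c x) \<le> (\<Sum>g\<in>grid K. cnorm A (c g \<odot> rot K g x))"
    unfolding gmean_def using assms by (intro cnorm_finsum) auto
  also have "\<dots> \<le> (\<Sum>g\<in>grid K. cmod (c g) * cnorm A x)"
    using assms by (intro sum_mono) (auto simp: cnorm_smult rot_def gauge_closed gauge_norm intro!: mult_left_mono)
  finally show ?thesis by (simp add: sum_distrib_right)
qed

abbreviation tensor :: "(nat \<Rightarrow> complex) \<Rightarrow> (nat \<Rightarrow> complex) \<Rightarrow> nat \<times> nat \<Rightarrow> complex" where
  "tensor c d g \<equiv> c (fst g) * d (snd g)"

lemma sum_tensor: "(\<Sum>g\<in>grid K. f (fst g) * h (snd g)) = (\<Sum>k<K. f k) * (\<Sum>l<K. h l :: 'b::comm_semiring_0)"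
  by (simp add: sum_product sum.cartesian_product split_def)

lemma gmean_contraction:
  assumes "x \<in> carrier A" "(\<Sum>l<K. cmod (c l)) = 1" "(\<Sum>l<K. cmod (d l)) = 1"
  shows "cnorm A (gmean K (tensor c d) x) \<le> cnorm A x"
  using gmean_norm[OF assms(1), of K "tensor c d"] sum_tensor[of "\<lambda>k. cmod (c k)" "\<lambda>k. cmod (d k)" K] assms
  by (simp add: norm_mult)

lemma gmean_mono:
  assumes "set \<mu> \<subseteq> {1..n}" "set \<nu> \<subseteq> {1..n}" "set \<alpha> \<subseteq> {1..m}" "set \<beta> \<subseteq> {1..m}"
  shows "gmean K (tensor c d) (S.monomial \<mu> \<nu> \<otimes> T.monomial \<alpha> \<beta>) =
    ((\<Sum>l<K. c l * (unity_root K l ^ length \<mu> * cnj (unity_root K l) ^ length \<nu>)) *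
     (\<Sum>l<K. d l * (unity_root K l ^ length \<alpha> * cnj (unity_root K l) ^ length \<beta>))) \<odot>
    (S.monomial \<mu> \<nu> \<otimes> T.monomial \<alpha> \<beta>)"
proof -
  let ?x = "S.monomial \<mu> \<nu> \<otimes> T.monomial \<alpha> \<beta>"
  let ?c = "\<lambda>l. c l * (unity_root K l ^ length \<mu> * cnj (unity_root K l) ^ length \<nu>)"
  let ?d = "\<lambda>l. d l * (unity_root K l ^ length \<alpha> * cnj (unity_root K l) ^ length \<beta>)"
  have x: "?x \<in> carrier A" using assms by simp
  have "gmean K (tensor c d) ?x = (\<Oplus>g\<in>grid K. (?c (fst g) * ?d (snd g)) \<odot> ?x)"
    unfolding gmean_def using assms
    by (intro finsum_cong') (auto simp: rot_def gauge_mult gauge_monomial_s gauge_monomial_t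
      smult_mult_left smult_mult_right smult_smult mult_ac)
  also have "\<dots> = (\<Sum>g\<in>grid K. ?c (fst g) * ?d (snd g)) \<odot> ?x"
    using x by (intro finsum_smult_const) auto
  also have "(\<Sum>g\<in>grid K. ?c (fst g) * ?d (snd g)) = (\<Sum>l<K. ?c l) * (\<Sum>l<K. ?d l)"
    by (rule sum_tensor)
  finally show ?thesis .
qed

subsection \<open>Fourier modes of elements of an ideal\<close>

text \<open>
  Multiplication by homogeneous elements shifts the Fourier modes.
\<close>

lemma gmean_modulate:
  assumes l: "l \<in> carrier A" and r: "r \<in> carrier A" and x: "x \<in> carrier A"
    and ga: "\<And>g. g \<in> grid K \<Longrightarrow> rot K g l = a g \<odot> l" and gb: "\<And>g. g \<in> grid K \<Longrightarrow> rot K g r = b g \<odot> r"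
  shows "gmean K c (l \<otimes> x \<otimes> r) = l \<otimes> gmean K (\<lambda>g. c g * a g * b g) x \<otimes> r"
proof -
  have "gmean K c (l \<otimes> x \<otimes> r) = (\<Oplus>g\<in>grid K. l \<otimes> ((c g * a g * b g) \<odot> rot K g x) \<otimes> r)"
    unfolding gmean_def
  proof (rule finsum_cong')
    fix g assume g: "g \<in> grid K"
    have "rot K g (l \<otimes> x \<otimes> r) = rot K g l \<otimes> rot K g x \<otimes> rot K g r"
      unfolding rot_def using l r x by (simp add: gauge_mult)
    then show "c g \<odot> rot K g (l \<otimes> x \<otimes> r) = l \<otimes> ((c g * a g * b g) \<odot> rot K g x) \<otimes> r"
      using l r x by (simp add: ga[OF g] gb[OF g] smult_mult_left smult_mult_right smult_smult mult_ac)
  qed (use l r x in auto)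
  also have "\<dots> = (\<Oplus>g\<in>grid K. l \<otimes> ((c g * a g * b g) \<odot> rot K g x)) \<otimes> r"
    using l r x by (intro finsum_ldistr[symmetric]) auto
  also have "(\<Oplus>g\<in>grid K. l \<otimes> ((c g * a g * b g) \<odot> rot K g x)) = l \<otimes> gmean K (\<lambda>g. c g * a g * b g) x"
    unfolding gmean_def using l r x by (intro finsum_rdistr[symmetric]) auto
  finally show ?thesis .
qed

context
  fixes J M
  assumes J: "closed_ideal J A" "J \<noteq> carrier A"
    and M: "closed_ideal M A" "\<one> \<ominus> S.amp \<one> \<in> M" "\<one> \<ominus> T.amp \<one> \<in> M"
begin

lemma idJ: "ideal J A" and idM: "ideal M A" using J M by (auto simp: closed_ideal_def)

lemma zero_mode_near:
  assumes b: "b \<in> lspan (mons N)" "near J b r" and K: "N < K"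
  shows "near M (gmean K (tensor (mode K 0 0) (mode K 0 0)) b) r"
proof (rule expectation_near[OF J idM M(2,3) gmean_zero gmean_closed gmean_lincomb _ b])
  fix \<mu> \<nu> \<alpha> \<beta>
  assume sets: "set \<mu> \<subseteq> {1..n}" "set \<nu> \<subseteq> {1..n}" "set \<alpha> \<subseteq> {1..m}" "set \<beta> \<subseteq> {1..m}"
    and "length \<mu> \<le> N" "length \<nu> \<le> N" "length \<alpha> \<le> N" "length \<beta> \<le> N"
  then show "gmean K (tensor (mode K 0 0) (mode K 0 0)) (S.monomial \<mu> \<nu> \<otimes> T.monomial \<alpha> \<beta>) =
     (if length \<mu> = length \<nu> \<and> length \<alpha> = length \<beta> then S.monomial \<mu> \<nu> \<otimes> T.monomial \<alpha> \<beta> else \<zero>)"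
    using sum_mode_char[of 0 "length \<mu>" K 0 "length \<nu>"] sum_mode_char[of 0 "length \<alpha>" K 0 "length \<beta>"] K
    unfolding gmean_mono[OF sets] by auto
qed

text \<open>
  Multiplying an approximating polynomial by \<open>l = s\<^sub>1\<^sup>i t\<^sub>1\<^sup>i\<^sup>'\<close> from the left and by \<open>v\<^sup>\<star>\<close> for
  \<open>v = s\<^sub>1\<^sup>j t\<^sub>1\<^sup>j\<^sup>'\<close> from the right moves the mode in question to degree zero, where \<open>zero_mode_near\<close>
  applies. As \<open>l\<close> and \<open>v\<close> are isometries, this can be undone by \<open>l\<^sup>\<star>\<close> and \<open>v\<close>.
\<close>

lemma mode_near:
  assumes a: "a \<in> J" and e: "0 < e"
  shows "\<exists>K0. \<forall>K\<ge>K0. near M (gmean K (tensor (mode K i j) (mode K i' j')) a) e"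
proof -
  have ac: "a \<in> carrier A" using a ideal_mem[OF idJ] by blast
  obtain b where b: "b \<in> polys" "cnorm A (a \<ominus> b) < e / 2" using polys_dense[OF gen ac, of "e/2"] e by auto
  have bc: "b \<in> carrier A" using polys_closed b by blast
  define l where "l = S.word (replicate i 1) \<otimes> T.word (replicate i' 1)"
  define v where "v = S.word (replicate j 1) \<otimes> T.word (replicate j' 1)"
  have 1: "set (replicate k (1::nat)) \<subseteq> {1..n}" "set (replicate k (1::nat)) \<subseteq> {1..m}" for k using n m by auto
  have lc: "l \<in> carrier A" and vc: "v \<in> carrier A" using 1 by (simp_all add: l_def v_def)
  have liso: "l\<^sup>\<star> \<otimes> l = \<one>" and viso: "v\<^sup>\<star> \<otimes> v = \<one>" unfolding l_def v_def by (rule word_product_isometry[OF 1])+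
  have ln: "cnorm A l \<le> 1" "cnorm A v \<le> 1" using isometry_cnorm_le_one lc vc liso viso by blast+
  have lp: "l \<in> polys" "v \<in> polys" unfolding l_def v_def
    using word_mults_s[OF 1(1)] word_mults_t[OF 1(2)] by (auto intro!: mults_mult mults_polys)
  define b' where "b' = l \<otimes> b \<otimes> v\<^sup>\<star>"
  have b'p: "b' \<in> polys" unfolding b'_def using lp b by (intro polys_mult polys_adj)
  then obtain N where N: "b' \<in> lspan (mons N)" using polys_bounded by blast
  have "near J b (e / 2)"
    unfolding near_def using a b cnorm_minus_commute[OF ac bc] by (intro bexI[of _ a]) auto
  then have "near J b' (e / 2)"
    unfolding b'_def using lc vc bc ln by (intro near_mult_right[OF idJ] near_mult_left[OF idJ]) auto
  have "near M (gmean K (tensor (mode K i j) (mode K i' j')) a) e" if K: "N + 1 \<le> K" for K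
  proof -
    let ?c = "tensor (mode K 0 0) (mode K 0 0)" and ?d = "tensor (mode K i j) (mode K i' j')"
    have K0: "K > 0" using K by simp
    have n1: "near M (gmean K ?c b') (e / 2)"
      using zero_mode_near[OF N \<open>near J b' (e / 2)\<close>] K by simp
    have rl: "rot K g l = (unity_root K (fst g) ^ i * unity_root K (snd g) ^ i') \<odot> l" for g
      unfolding rot_def l_def using 1
      by (simp add: gauge_mult gauge_word_s gauge_word_t smult_mult_left smult_mult_right smult_smult mult.commute)
    have rv: "rot K g v = (unity_root K (fst g) ^ j * unity_root K (snd g) ^ j') \<odot> v" for g
      unfolding rot_def v_def using 1
      by (simp add: gauge_mult gauge_word_s gauge_word_t smult_mult_left smult_mult_right smult_smult mult.commute)
    have rv': "rot K g (v\<^sup>\<star>) = cnj (unity_root K (fst g) ^ j * unity_root K (snd g) ^ j') \<odot> v\<^sup>\<star>" for g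
    proof -
      have "rot K g (v\<^sup>\<star>) = (rot K g v)\<^sup>\<star>" unfolding rot_def using vc by (simp add: gauge_adj)
      then show ?thesis unfolding rv using vc by (simp add: adj_smult)
    qed
    have "gmean K ?c b' = l \<otimes> gmean K (\<lambda>g. ?c g * (unity_root K (fst g) ^ i * unity_root K (snd g) ^ i') *
        cnj (unity_root K (fst g) ^ j * unity_root K (snd g) ^ j')) b \<otimes> v\<^sup>\<star>"
      unfolding b'_def using lc vc bc rl rv' by (intro gmean_modulate) auto
    also have "(\<lambda>g. ?c g * (unity_root K (fst g) ^ i * unity_root K (snd g) ^ i') *
        cnj (unity_root K (fst g) ^ j * unity_root K (snd g) ^ j')) = ?d"
      by (rule ext) (simp add: mode_def)
    finally have eq: "gmean K ?c b' = l \<otimes> gmean K ?d b \<otimes> v\<^sup>\<star>" .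
    have "near M (l\<^sup>\<star> \<otimes> gmean K ?c b' \<otimes> v) (e / 2)"
      using n1 lc vc ln polys_closed[OF b'p] by (intro near_mult_right[OF idM] near_mult_left[OF idM]) auto
    also have "l\<^sup>\<star> \<otimes> gmean K ?c b' \<otimes> v = (l\<^sup>\<star> \<otimes> l) \<otimes> gmean K ?d b \<otimes> (v\<^sup>\<star> \<otimes> v)"
      unfolding eq using lc vc bc by (simp add: m_assoc)
    finally have n2: "near M (gmean K ?d b) (e / 2)" using liso viso bc by simp
    have "cnorm A (gmean K ?d (a \<ominus> b)) \<le> cnorm A (a \<ominus> b)"
      using ac bc K0 by (intro gmean_contraction sum_norm_mode) auto
    then have "cnorm A (gmean K ?d a \<ominus> gmean K ?d b) \<le> e / 2" using b ac bc by (simp add: gmean_diff)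
    then have "near M (gmean K ?d a) (e / 2 + e / 2)" using n2 ac bc by (intro near_perturb[OF idM n2]) auto
    then show ?thesis by simp
  qed
  then show ?thesis by blast
qed

text \<open>
  A Fejer mean is a combination of \<open>L\<^sup>4\<close> modes, a number that does not depend on \<open>K\<close>.
\<close>

lemma fejer_near:
  assumes a: "a \<in> J" and e: "0 < e" and L: "0 < L"
  shows "\<exists>K0. \<forall>K\<ge>K0. near M (gmean K (tensor (fejer L K) (fejer L K)) a) e"
proof -
  have ac: "a \<in> carrier A" using a ideal_mem[OF idJ] by blast
  define X where "X = (({..<L} \<times> {..<L}) \<times> ({..<L} \<times> {..<L}))"
  have fX: "finite X" by (simp add: X_def)
  define c where "c K k = tensor (mode K (fst (fst k)) (snd (fst k))) (mode K (fst (snd k)) (snd (snd k)))" for K k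
  define d where "d = e / (real (card X) + 1)"
  have d: "0 < d" using e by (simp add: d_def add_nonneg_pos)
  have "\<exists>K0. \<forall>K\<ge>K0. near M (gmean K (c K k) a) d" for k
    unfolding c_def using mode_near[OF a d] .
  then obtain K0 where K0: "\<And>k K. K0 k \<le> K \<Longrightarrow> near M (gmean K (c K k) a) d" by metis
  have "near M (gmean K (tensor (fejer L K) (fejer L K)) a) e" if K: "(\<Sum>k\<in>X. K0 k) \<le> K" for K
  proof -
    have ne: "near M (\<Oplus>k\<in>Y. gmean K (c K k) a) (real (card Y) * d)" if Y: "finite Y" "Y \<subseteq> X" for Y
      using Y
    proof (induct Y rule: finite_induct)
      case empty
      then show ?case using near_mem[OF idM ideal_zero[OF idM], of 0] by simp
    next
      case (insert k Y)
      have "K0 k \<le> (\<Sum>k\<in>X. K0 k)" using insert(4) fX by (intro member_le_sum) auto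
      then have "near M (gmean K (c K k) a) d" using K0 K by simp
      then have "near M (gmean K (c K k) a \<oplus> (\<Oplus>k\<in>Y. gmean K (c K k) a)) (d + real (card Y) * d)"
        using insert ac by (intro near_add[OF idM]) auto
      then show ?case using insert ac by (simp add: algebra_simps Pi_def)
    qed
    have "(\<lambda>g. tensor (fejer L K) (fejer L K) g) = (\<lambda>g. \<Sum>k\<in>X. c K k g / (of_nat L)\<^sup>2)"
    proof
      fix g
      have "tensor (fejer L K) (fejer L K) g =
        ((\<Sum>p\<in>{..<L} \<times> {..<L}. mode K (fst p) (snd p) (fst g)) * (\<Sum>p\<in>{..<L} \<times> {..<L}. mode K (fst p) (snd p) (snd g))) / (of_nat L)\<^sup>2"
        by (simp add: fejer_def sum.cartesian_product split_def power2_eq_square)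
      also have "\<dots> = (\<Sum>k\<in>X. c K k g / (of_nat L)\<^sup>2)"
        by (simp only: sum_product X_def sum.cartesian_product split_def sum_divide_distrib c_def)
      finally show "tensor (fejer L K) (fejer L K) g = (\<Sum>k\<in>X. c K k g / (of_nat L)\<^sup>2)" .
    qed
    then have "gmean K (tensor (fejer L K) (fejer L K)) a = (\<Oplus>k\<in>X. gmean K (\<lambda>g. c K k g / (of_nat L)\<^sup>2) a)"
      using gmean_coeff_sum[OF fX ac] by simp
    also have "\<dots> = (\<Oplus>k\<in>X. (1 / (of_nat L)\<^sup>2) \<odot> gmean K (c K k) a)"
    proof (rule finsum_cong')
      fix k
      have "gmean K (\<lambda>g. c K k g / (of_nat L)\<^sup>2) a = (\<Oplus>g\<in>grid K. (1 / (of_nat L)\<^sup>2) \<odot> (c K k g \<odot> rot K g a))"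
        unfolding gmean_def using ac by (intro finsum_cong') (auto simp: smult_smult)
      then show "gmean K (\<lambda>g. c K k g / (of_nat L)\<^sup>2) a = (1 / (of_nat L)\<^sup>2) \<odot> gmean K (c K k) a"
        unfolding gmean_def using ac by (simp add: smult_finsum Pi_def)
    qed (use ac in auto)
    also have "\<dots> = (1 / (of_nat L)\<^sup>2) \<odot> (\<Oplus>k\<in>X. gmean K (c K k) a)"
      using ac fX by (intro smult_finsum[symmetric]) auto
    finally have eq: "gmean K (tensor (fejer L K) (fejer L K)) a = (1 / (of_nat L)\<^sup>2) \<odot> (\<Oplus>k\<in>X. gmean K (c K k) a)" .
    have "near M (gmean K (tensor (fejer L K) (fejer L K)) a) (cmod (1 / (of_nat L)\<^sup>2) * (real (card X) * d))"
      unfolding eq using ac fX by (intro near_smult[OF idM ne]) auto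
    moreover have "cmod (1 / (of_nat L)\<^sup>2) * (real (card X) * d) \<le> 1 * (real (card X) * d)"
      using L d by (intro mult_right_mono) (auto simp: norm_divide norm_power divide_le_eq_1)
    moreover have "real (card X) * d \<le> e"
      using e by (simp add: d_def field_simps)
    ultimately show ?thesis using near_mono[OF idM] by simp
  qed
  then show ?thesis by blast
qed

end

subsection \<open>Fejer means converge\<close>

text \<open>
  Forming the mean multiplies a monomial by a product of two Fejer weights, which differs from one by
  at most \<open>4 N / L\<close>. The constant \<open>C\<close> sums this up over the monomials of \<open>b\<close>.
\<close>

lemma fejer_mean_poly:
  assumes b: "b \<in> lspan (mons N)"
  shows "\<exists>C\<ge>0. \<forall>L>0. \<forall>K\<ge>L + N. cnorm A (gmean K (tensor (fejer L K) (fejer L K)) b \<ominus> b) \<le> C / real L"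
  using b
proof (induct rule: lspan.induct)
  case zero
  then show ?case by (intro exI[of _ 0]) (simp add: gmean_zero)
next
  case (step x y c)
  then obtain C where C: "0 \<le> C" "\<And>L K. \<lbrakk>0 < L; L + N \<le> K\<rbrakk> \<Longrightarrow>
      cnorm A (gmean K (tensor (fejer L K) (fejer L K)) y \<ominus> y) \<le> C / real L" by auto
  obtain \<mu> \<nu> \<alpha> \<beta> where x: "x = S.monomial \<mu> \<nu> \<otimes> T.monomial \<alpha> \<beta>"
      and sets: "set \<mu> \<subseteq> {1..n}" "set \<nu> \<subseteq> {1..n}" "set \<alpha> \<subseteq> {1..m}" "set \<beta> \<subseteq> {1..m}"
      and lens: "length \<mu> \<le> N" "length \<nu> \<le> N" "length \<alpha> \<le> N" "length \<beta> \<le> N"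
    using step(1) unfolding mons_def by blast
  have xc: "x \<in> carrier A" "y \<in> carrier A" using sets x lspan_closed[OF step(2) mons_closed] by auto
  have "cnorm A (gmean K (tensor (fejer L K) (fejer L K)) (c \<odot> x \<oplus> y) \<ominus> (c \<odot> x \<oplus> y)) \<le>
     (cmod c * (4 * real N * cnorm A x) + C) / real L" if L: "0 < L" and K: "L + N \<le> K" for L K
  proof -
    let ?G = "gmean K (tensor (fejer L K) (fejer L K))"
    let ?w = "fejer_weight L (length \<mu>) (length \<nu>) * fejer_weight L (length \<alpha>) (length \<beta>)"
    have "?G x = complex_of_real ?w \<odot> x"
      using sum_fejer_char[of L "length \<mu>" K "length \<nu>"] sum_fejer_char[of L "length \<alpha>" K "length \<beta>"] lens K
      by (simp add: x gmean_mono[OF sets])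
    then have "?G x \<ominus> x = complex_of_real (?w - 1) \<odot> x" using xc smult_diff_left[of x "complex_of_real ?w" 1] by simp
    then have "cnorm A (?G x \<ominus> x) = \<bar>?w - 1\<bar> * cnorm A x" using xc by (simp add: cnorm_smult del: of_real_diff)
    also have "\<dots> \<le> (4 * real N / real L) * cnorm A x"
      using fejer_weight_product_bound[OF lens L] xc by (intro mult_right_mono cnorm_nonneg) auto
    finally have 1: "cnorm A (?G x \<ominus> x) \<le> (4 * real N / real L) * cnorm A x" .
    have "?G (c \<odot> x \<oplus> y) \<ominus> (c \<odot> x \<oplus> y) = c \<odot> (?G x \<ominus> x) \<oplus> (?G y \<ominus> y)"
      using xc by (simp add: gmean_lincomb diff_diff_add smult_diff_right)
    then have "cnorm A (?G (c \<odot> x \<oplus> y) \<ominus> (c \<odot> x \<oplus> y)) \<le> cmod c * cnorm A (?G x \<ominus> x) + cnorm A (?G y \<ominus> y)"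
      using cnorm_triangle[of "c \<odot> (?G x \<ominus> x)" "?G y \<ominus> y"] xc by (simp add: cnorm_smult)
    also have "\<dots> \<le> cmod c * ((4 * real N / real L) * cnorm A x) + C / real L"
      using 1 C(2)[OF L K] by (intro add_mono mult_left_mono) auto
    finally show ?thesis by (simp add: add_divide_distrib mult_ac)
  qed
  moreover have "0 \<le> cmod c * (4 * real N * cnorm A x) + C" using C xc cnorm_nonneg by simp
  ultimately show ?case by blast
qed

text \<open>
  The order of choices matters: the polynomial \<open>b\<close> and then \<open>L\<close> make the Fejer mean of \<open>a\<close> close to \<open>a\<close>
  for all large \<open>K\<close>, and only then \<open>K\<close> is taken so large that this mean is close to \<open>M\<close>.
\<close>

theorem proper_ideal_subset:
  assumes J: "closed_ideal J A" "J \<noteq> carrier A"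
    and M: "closed_ideal M A" "\<one> \<ominus> S.amp \<one> \<in> M" "\<one> \<ominus> T.amp \<one> \<in> M"
  shows "J \<subseteq> M"
proof
  fix a assume a: "a \<in> J"
  have idJ: "ideal J A" and idM: "ideal M A" using J M by (auto simp: closed_ideal_def)
  have ac: "a \<in> carrier A" using a ideal_mem[OF idJ] by blast
  show "a \<in> M"
  proof (rule closed_ideal_memI[OF M(1) ac])
    fix e :: real assume e: "0 < e"
    obtain b where b: "b \<in> polys" "cnorm A (a \<ominus> b) < e / 4" using polys_dense[OF gen ac, of "e/4"] e by auto
    have bc: "b \<in> carrier A" using polys_closed b by blast
    obtain N where N: "b \<in> lspan (mons N)" using polys_bounded[OF b(1)] by blast
    obtain C where C: "\<And>L K. \<lbrakk>0 < L; L + N \<le> K\<rbrakk> \<Longrightarrow>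
        cnorm A (gmean K (tensor (fejer L K) (fejer L K)) b \<ominus> b) \<le> C / real L" and C0: "0 \<le> C"
      using fejer_mean_poly[OF N] by blast
    obtain L where L: "C / (e / 4) < real L" using reals_Archimedean2 by blast
    have L0: "0 < L" using L C0 e by (metis divide_nonneg_pos less_le_not_le of_nat_0 gr0I le_less_trans zero_less_divide_iff zero_less_numeral less_eq_real_def)
    have CL: "C / real L \<le> e / 4" using L L0 e by (simp add: field_simps)
    obtain K0 where K0: "\<And>K. K0 \<le> K \<Longrightarrow> near M (gmean K (tensor (fejer L K) (fejer L K)) a) (e / 4)"
      using fejer_near[OF J M a _ L0, of "e / 4"] e by auto
    define K where "K = K0 + L + N"
    let ?G = "gmean K (tensor (fejer L K) (fejer L K))"
    have "cnorm A (?G (a \<ominus> b)) \<le> cnorm A (a \<ominus> b)"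
      using ac bc L0 by (intro gmean_contraction sum_norm_fejer) (auto simp: K_def)
    then have 1: "cnorm A (?G a \<ominus> ?G b) \<le> e / 4" using ac bc b by (simp add: gmean_diff)
    have 2: "cnorm A (?G b \<ominus> b) \<le> e / 4" using order_trans[OF C[OF L0, of K] CL] by (simp add: K_def)
    have 3: "cnorm A (a \<ominus> b) \<le> e / 4" using b by simp
    have "cnorm A (a \<ominus> ?G b) \<le> e / 4 + e / 4"
      using cnorm_diff_triangle[of a b "?G b"] 2 3 ac bc cnorm_minus_commute[of b "?G b"] by simp
    then have "cnorm A (a \<ominus> ?G a) \<le> e / 4 + e / 4 + e / 4"
      using cnorm_diff_triangle[of a "?G b" "?G a"] 1 ac bc cnorm_minus_commute[of "?G a" "?G b"] by simp
    then have "near M a (e / 4 + e / 4 + e / 4 + e / 4)"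
      using ac by (intro near_perturb[OF idM K0[of K]]) (auto simp: K_def)
    then show "near M a e" by simp
  qed
qed

end

section \<open>Closed ideals and kernels\<close>

context unital_cstar_algebra
begin

lemma closed_ideal_carrier: "closed_ideal (carrier A) A"
  using oneideal by (simp add: closed_ideal_def closedin_iff_approx)

lemma closed_ideal_generated:
  assumes "X \<subseteq> carrier A"
  shows "closed_ideal (closed_ideal_generated A X) A" "X \<subseteq> closed_ideal_generated A X"
proof -
  let ?F = "{J. closed_ideal J A \<and> X \<subseteq> J}"
  have ne: "?F \<noteq> {}" using closed_ideal_carrier assms by blast
  show "closed_ideal (closed_ideal_generated A X) A"
    unfolding closed_ideal_def[of "closed_ideal_generated A X"]
    unfolding closed_ideal_generated_def
  proof
    show "ideal (\<Inter> ?F) A" using ne by (intro i_Intersect) (auto simp: closed_ideal_def)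
    show "closedin (ctopology A) (\<Inter> ?F)" using ne by (intro closedin_Inter) (auto simp: closed_ideal_def)
  qed
  show "X \<subseteq> closed_ideal_generated A X" by (auto simp: closed_ideal_generated_def)
qed

lemma closed_ideal_generated_least:
  "closed_ideal J A \<Longrightarrow> X \<subseteq> J \<Longrightarrow> closed_ideal_generated A X \<subseteq> J"
  by (auto simp: closed_ideal_generated_def)

end

lemma star_hom_finsum:
  assumes A: "unital_cstar_algebra A" and B: "unital_cstar_algebra B" and h: "h \<in> star_hom A B"
    and "finite I" "f \<in> I \<rightarrow> carrier A"
  shows "h (finsum A f I) = finsum B (\<lambda>i. h (f i)) I"
proof -
  interpret A: unital_cstar_algebra A by fact
  interpret B: unital_cstar_algebra B by fact
  interpret ring_hom_ring A B h
    using h by (intro ring_hom_ringI2 A.ring_axioms B.ring_axioms) (simp add: star_hom_def)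
  show ?thesis using assms(4,5) by (induct I rule: finite_induct) (auto simp: Pi_def)
qed

lemma star_hom_kernel_closed_ideal:
  assumes A: "unital_cstar_algebra A" and B: "unital_cstar_algebra B" and h: "h \<in> star_hom A B"
  shows "closed_ideal {x \<in> carrier A. h x = \<zero>\<^bsub>B\<^esub>} A"
proof -
  interpret A: unital_cstar_algebra A by fact
  interpret B: unital_cstar_algebra B by fact
  interpret ring_hom_ring A B h
    using h by (intro ring_hom_ringI2 A.ring_axioms B.ring_axioms) (simp add: star_hom_def)
  have "h x = \<zero>\<^bsub>B\<^esub>" if x: "x \<in> carrier A"
    and ap: "\<forall>e>0. \<exists>y\<in>{x \<in> carrier A. h x = \<zero>\<^bsub>B\<^esub>}. cnorm A (x \<ominus>\<^bsub>A\<^esub> y) < e" for x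
  proof -
    have "cnorm B (h x) \<le> e" if e: "0 < e" for e
    proof -
      obtain y where y: "y \<in> carrier A" "h y = \<zero>\<^bsub>B\<^esub>" "cnorm A (x \<ominus>\<^bsub>A\<^esub> y) < e" using ap e by auto
      have "h (x \<ominus>\<^bsub>A\<^esub> y) = h x" using x y by (simp add: a_minus_def)
      then show ?thesis using star_hom_contractive[OF A B h, of "x \<ominus>\<^bsub>A\<^esub> y"] x y by simp
    qed
    then have "cnorm B (h x) \<le> 0" by (rule field_le_epsilon[of _ 0, simplified])
    then show ?thesis using B.cnorm_nonneg[of "h x"] B.cnorm_eq_0_iff[of "h x"] x by simp
  qed
  then show ?thesis
    using kernel_is_ideal unfolding closed_ideal_def A.closedin_iff_approx a_kernel_def' by blast
qed

lemma star_hom_range_sum: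
  assumes A: "unital_cstar_algebra A" and B: "unital_cstar_algebra B" and h: "h \<in> star_hom A B"
    and s: "s ` {1..n} \<subseteq> carrier A" and s': "\<forall>i\<in>{1..n}. h (s i) = s' i"
  shows "h (range_sum A n s) = range_sum B n s'"
proof -
  interpret A: unital_cstar_algebra A by fact
  interpret B: unital_cstar_algebra B by fact
  have rh: "h \<in> ring_hom A B" and ha: "\<And>x. x \<in> carrier A \<Longrightarrow> h (adj A x) = adj B (h x)"
    using h by (auto simp: star_hom_def)
  have c: "s i \<in> carrier A" "s' i \<in> carrier B" if "i \<in> {1..n}" for i
    using s s' that ring_hom_closed[OF rh] by (blast, metis imageI subsetD)
  have "h (range_sum A n s) = finsum B (\<lambda>i. h (s i \<otimes>\<^bsub>A\<^esub> adj A (s i))) {1..n}"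
    unfolding range_sum_def using c by (intro star_hom_finsum[OF A B h]) auto
  also have "\<dots> = range_sum B n s'"
    unfolding range_sum_def using c s' by (intro B.finsum_cong') (auto simp: ring_hom_mult[OF rh] ha)
  finally show ?thesis .
qed

context universal_E_family
begin

text \<open>
  The kernel of a homomorphism into an algebra with full range sums contains the generators of the
  ideal.
\<close>

lemma M_ideal_proper:
  assumes B: "unital_cstar_algebra B" "\<one>\<^bsub>B\<^esub> \<noteq> \<zero>\<^bsub>B\<^esub>" and h: "h \<in> star_hom A B"
    and s': "\<forall>i\<in>{1..n}. h (s i) = s' i" "range_sum B n s' = \<one>\<^bsub>B\<^esub>"
    and t': "\<forall>r\<in>{1..m}. h (t r) = t' r" "range_sum B m t' = \<one>\<^bsub>B\<^esub>"
  shows "M_ideal n m A s t \<noteq> carrier A"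
proof -
  interpret B: unital_cstar_algebra B by (rule B(1))
  interpret ring_hom_ring A B h
    using h by (intro ring_hom_ringI2 ring_axioms B.ring_axioms) (simp add: star_hom_def)
  let ?K = "{x \<in> carrier A. h x = \<zero>\<^bsub>B\<^esub>}"
  have "h (S.amp \<one>) = \<one>\<^bsub>B\<^esub>" "h (T.amp \<one>) = \<one>\<^bsub>B\<^esub>"
    using star_hom_range_sum[OF unital_cstar_algebra_axioms B(1) h _ s'(1)]
      star_hom_range_sum[OF unital_cstar_algebra_axioms B(1) h _ t'(1)] s'(2) t'(2)
    by (auto simp: range_sum_s range_sum_t image_subset_iff)
  then have "{\<one> \<ominus> T.amp \<one>, \<one> \<ominus> S.amp \<one>} \<subseteq> ?K" by (simp add: a_minus_def B.r_neg)
  then have "M_ideal n m A s t \<subseteq> ?K"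
    unfolding M_ideal_def range_sum_s range_sum_t
    by (intro closed_ideal_generated_least star_hom_kernel_closed_ideal[OF unital_cstar_algebra_axioms B(1) h])
  moreover have "\<one> \<notin> ?K" using B(2) by simp
  ultimately show ?thesis by blast
qed

lemma M_ideal_closed: "closed_ideal (M_ideal n m A s t) A"
  and M_ideal_defects: "\<one> \<ominus> S.amp \<one> \<in> M_ideal n m A s t" "\<one> \<ominus> T.amp \<one> \<in> M_ideal n m A s t"
  unfolding M_ideal_def range_sum_s range_sum_t
  using closed_ideal_generated[of "{\<one> \<ominus> T.amp \<one>, \<one> \<ominus> S.amp \<one>}"] by auto

end

section \<open>Bounded operators on a Hilbert sequence space\<close>

text \<open>
  The Hilbert space of square summable families of complex numbers is treated as a real Hilbert space
  with an action of the complex scalars. For operators that commute with these scalars the real and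
  the complex adjoint coincide, since the real inner product is the real part of the complex one.
\<close>

typedef 'i ell2 = "{x :: 'i \<Rightarrow> complex. (\<lambda>i. (cmod (x i))\<^sup>2) summable_on UNIV}"
  morphisms coord Abs_ell2
  by (rule exI[of _ "\<lambda>_. 0"]) simp

lemma coord_summable: "(\<lambda>i. (cmod (coord x i))\<^sup>2) summable_on UNIV"
  using coord[of x] by simp

lemma coord_Abs: "(\<lambda>i. (cmod (f i))\<^sup>2) summable_on UNIV \<Longrightarrow> coord (Abs_ell2 f) = f"
  by (rule Abs_ell2_inverse) simp

lemma ell2_eqI: "(\<And>i. coord x i = coord y i) \<Longrightarrow> x = y"
  by (metis coord_inject ext)

lemma real_summable_comparison:
  fixes f g :: "'i \<Rightarrow> real"
  assumes "g summable_on X" "\<And>i. i \<in> X \<Longrightarrow> \<bar>f i\<bar> \<le> g i"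
  shows "f summable_on X"
proof -
  have "(\<lambda>i. norm (g i)) summable_on X \<longleftrightarrow> g summable_on X"
    using assms(2) by (intro summable_on_cong) force
  then have "(\<lambda>i. norm (g i)) summable_on X" using assms(1) by simp
  then have "(\<lambda>i. norm (f i)) summable_on X"
    by (rule Infinite_Sum.abs_summable_on_comparison_test) (use assms(2) in force)
  then show ?thesis by (rule Infinite_Sum.abs_summable_summable)
qed

lemma square_summable_add:
  assumes "(\<lambda>i. (cmod (f i))\<^sup>2) summable_on UNIV" "(\<lambda>i. (cmod (g i))\<^sup>2) summable_on UNIV"
  shows "(\<lambda>i. (cmod (f i + g i))\<^sup>2) summable_on UNIV"
proof (rule real_summable_comparison)
  show "(\<lambda>i. 2 * ((cmod (f i))\<^sup>2 + (cmod (g i))\<^sup>2)) summable_on UNIV"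
    using assms by (intro summable_on_cmult_right summable_on_add)
  fix i
  have "(cmod (f i + g i))\<^sup>2 \<le> (cmod (f i) + cmod (g i))\<^sup>2" by (intro power_mono norm_triangle_ineq) auto
  also have "\<dots> \<le> 2 * ((cmod (f i))\<^sup>2 + (cmod (g i))\<^sup>2)"
    using zero_le_power2[of "cmod (f i) - cmod (g i)"] by (simp add: power2_diff power2_sum)
  finally show "\<bar>(cmod (f i + g i))\<^sup>2\<bar> \<le> 2 * ((cmod (f i))\<^sup>2 + (cmod (g i))\<^sup>2)" by simp
qed

lemma square_summable_scale:
  "(\<lambda>i. (cmod (f i))\<^sup>2) summable_on UNIV \<Longrightarrow> (\<lambda>i. (cmod (c * f i))\<^sup>2) summable_on UNIV"
  by (simp add: norm_mult power_mult_distrib summable_on_cmult_right)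

lemma inner_summable: "(\<lambda>i. inner (coord x i) (coord y i)) summable_on UNIV"
proof (rule real_summable_comparison)
  show "(\<lambda>i. (cmod (coord x i))\<^sup>2 + (cmod (coord y i))\<^sup>2) summable_on UNIV"
    by (intro summable_on_add coord_summable)
  fix i
  have "\<bar>inner (coord x i) (coord y i)\<bar> \<le> cmod (coord x i) * cmod (coord y i)" by (rule Cauchy_Schwarz_ineq2)
  also have "\<dots> \<le> (cmod (coord x i))\<^sup>2 + (cmod (coord y i))\<^sup>2"
    using sum_squares_bound[of "cmod (coord x i)" "cmod (coord y i)"]
      mult_nonneg_nonneg[OF norm_ge_zero[of "coord x i"] norm_ge_zero[of "coord y i"]] by linarith
  finally show "\<bar>inner (coord x i) (coord y i)\<bar> \<le> (cmod (coord x i))\<^sup>2 + (cmod (coord y i))\<^sup>2" .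
qed

instantiation ell2 :: (type) real_inner
begin

definition "0 = Abs_ell2 (\<lambda>_. 0)"
definition "x + y = Abs_ell2 (\<lambda>i. coord x i + coord y i)"
definition "- x = Abs_ell2 (\<lambda>i. - coord x i)"
definition "x - y = Abs_ell2 (\<lambda>i. coord x i - coord y i)"
definition "r *\<^sub>R (x :: 'a ell2) = Abs_ell2 (\<lambda>i. of_real r * coord x i)"
definition "inner x (y :: 'a ell2) = infsum (\<lambda>i. inner (coord x i) (coord y i)) UNIV"
definition "norm x = sqrt (inner x (x :: 'a ell2))"
definition "sgn x = scaleR (inverse (norm x)) (x :: 'a ell2)"
definition "dist x y = norm (x - (y :: 'a ell2))"
definition [code del]: "(uniformity :: ('a ell2 \<times> 'a ell2) filter) = (INF e\<in>{0<..}. principal {(x, y). dist x y < e})"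
definition [code del]: "open (U :: 'a ell2 set) \<longleftrightarrow> (\<forall>x\<in>U. eventually (\<lambda>(x', y). x' = x \<longrightarrow> y \<in> U) uniformity)"

lemma coord_ops:
  "coord (0 :: 'a ell2) i = 0"
  "coord (x + y) i = coord x i + coord y i"
  "coord (- x) i = - coord x i"
  "coord (x - y) i = coord x i - coord y i"
  "coord (r *\<^sub>R x) i = r *\<^sub>R coord x i" for x y :: "'a ell2"
proof -
  have neg: "(\<lambda>i. (cmod (- coord y i))\<^sup>2) summable_on UNIV" using coord_summable[of y] by simp
  show "coord (0 :: 'a ell2) i = 0" by (simp add: zero_ell2_def coord_Abs)
  show "coord (x + y) i = coord x i + coord y i"
    by (simp add: plus_ell2_def coord_Abs square_summable_add coord_summable)
  show "coord (- x) i = - coord x i" by (simp add: uminus_ell2_def coord_Abs coord_summable)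
  show "coord (x - y) i = coord x i - coord y i"
    using square_summable_add[OF coord_summable[of x] neg] by (simp add: minus_ell2_def coord_Abs)
  show "coord (r *\<^sub>R x) i = r *\<^sub>R coord x i"
    using square_summable_scale[OF coord_summable[of x], of "of_real r"]
    by (simp add: scaleR_ell2_def coord_Abs scaleR_conv_of_real[where 'a = complex])
qed

instance
proof
  fix x y z :: "'a ell2" and r s :: real
  show "x + y + z = x + (y + z)" "x + y = y + x" "0 + x = x" "- x + x = 0" "x - y = x + - y"
    "r *\<^sub>R (x + y) = r *\<^sub>R x + r *\<^sub>R y" "(r + s) *\<^sub>R x = r *\<^sub>R x + s *\<^sub>R x"
    "r *\<^sub>R s *\<^sub>R x = (r * s) *\<^sub>R x" "1 *\<^sub>R x = x"
    by (rule ell2_eqI; simp add: coord_ops algebra_simps)+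
  show "inner x y = inner y x" by (simp add: inner_ell2_def inner_commute)
  show "inner (x + y) z = inner x z + inner y z"
    by (simp add: inner_ell2_def coord_ops inner_add_left infsum_add inner_summable)
  show "inner (r *\<^sub>R x) y = r * inner x y"
    by (simp add: inner_ell2_def coord_ops infsum_cmult_right')
  show "0 \<le> inner x x" unfolding inner_ell2_def by (rule infsum_nonneg) simp
  show "(inner x x = 0) = (x = 0)"
  proof
    assume 0: "inner x x = 0"
    have "inner (coord x i) (coord x i) = 0" for i
      using 0 by (intro nonneg_infsum_le_0D[where A = UNIV and f = "\<lambda>i. inner (coord x i) (coord x i)"])
        (auto simp: inner_ell2_def inner_summable)
    then show "x = 0" by (intro ell2_eqI) (simp add: coord_ops)
  next
    assume "x = 0"
    then show "inner x x = 0" by (simp add: inner_ell2_def coord_ops)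
  qed
qed (auto simp: norm_ell2_def sgn_ell2_def dist_ell2_def uniformity_ell2_def open_ell2_def)

end

lemma norm_ell2_square: "(norm x)\<^sup>2 = infsum (\<lambda>i. (cmod (coord x i))\<^sup>2) UNIV"
  by (simp add: power2_norm_eq_inner inner_ell2_def)

lemma norm_coord_le: "cmod (coord x i) \<le> norm x"
proof -
  have "(\<Sum>j\<in>{i}. (cmod (coord x j))\<^sup>2) \<le> (norm x)\<^sup>2"
    unfolding norm_ell2_square by (rule finite_sum_le_infsum) (auto simp: coord_summable)
  then show ?thesis using power2_le_imp_le[of "cmod (coord x i)" "norm x"] by simp
qed

instance ell2 :: (type) banach
proof
  fix X :: "nat \<Rightarrow> 'a ell2" assume X: "Cauchy X"
  have "Cauchy (\<lambda>n. coord (X n) i)" for i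
  proof (rule CauchyI)
    fix e :: real assume "0 < e"
    then obtain N where N: "\<And>m n. \<lbrakk>N \<le> m; N \<le> n\<rbrakk> \<Longrightarrow> norm (X m - X n) < e" using CauchyD[OF X] by blast
    have "norm (coord (X m) i - coord (X n) i) < e" if "N \<le> m" "N \<le> n" for m n
      using norm_coord_le[of "X m - X n" i] N[OF that] by (simp add: coord_ops)
    then show "\<exists>M. \<forall>m\<ge>M. \<forall>n\<ge>M. norm (coord (X m) i - coord (X n) i) < e" by blast
  qed
  then have "\<forall>i. \<exists>l. (\<lambda>n. coord (X n) i) \<longlonglongrightarrow> l"
    by (auto intro: Cauchy_convergent simp flip: convergent_def)
  then obtain l where l: "\<And>i. (\<lambda>n. coord (X n) i) \<longlonglongrightarrow> l i" by metis
  have tail: "\<exists>N. \<forall>n\<ge>N. \<forall>F. finite F \<longrightarrow> (\<Sum>i\<in>F. (cmod (coord (X n) i - l i))\<^sup>2) \<le> e\<^sup>2" if e: "0 < e" for e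
  proof -
    obtain N where N: "\<And>m n. \<lbrakk>N \<le> m; N \<le> n\<rbrakk> \<Longrightarrow> norm (X m - X n) < e" using CauchyD[OF X e] by blast
    have "(\<Sum>i\<in>F. (cmod (coord (X n) i - l i))\<^sup>2) \<le> e\<^sup>2" if n: "N \<le> n" and F: "finite F" for n F
    proof (rule LIMSEQ_le_const2)
      show "(\<lambda>m. \<Sum>i\<in>F. (cmod (coord (X n) i - coord (X m) i))\<^sup>2) \<longlonglongrightarrow> (\<Sum>i\<in>F. (cmod (coord (X n) i - l i))\<^sup>2)"
        by (intro tendsto_intros l)
      have "(\<Sum>i\<in>F. (cmod (coord (X n) i - coord (X m) i))\<^sup>2) \<le> e\<^sup>2" if m: "N \<le> m" for m
      proof -
        have "(\<Sum>i\<in>F. (cmod (coord (X n - X m) i))\<^sup>2) \<le> (norm (X n - X m))\<^sup>2"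
          unfolding norm_ell2_square using F by (intro finite_sum_le_infsum) (auto simp: coord_summable)
        also have "\<dots> \<le> e\<^sup>2" using N[OF n m] by (intro power_mono) auto
        finally show ?thesis by (simp add: coord_ops)
      qed
      then show "\<exists>N. \<forall>m\<ge>N. (\<Sum>i\<in>F. (cmod (coord (X n) i - coord (X m) i))\<^sup>2) \<le> e\<^sup>2" by blast
    qed
    then show ?thesis by blast
  qed
  have diff_summable: "(\<lambda>i. (cmod (coord (X n) i - l i))\<^sup>2) summable_on UNIV"
    if "\<And>F. finite F \<Longrightarrow> (\<Sum>i\<in>F. (cmod (coord (X n) i - l i))\<^sup>2) \<le> b" for n b
    by (rule nonneg_bdd_above_summable_on) (auto intro!: bdd_aboveI2[where M = b] that)
  obtain N where N: "\<And>F. finite F \<Longrightarrow> (\<Sum>i\<in>F. (cmod (coord (X N) i - l i))\<^sup>2) \<le> 1\<^sup>2"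
    using tail[of 1] by auto
  have "(\<lambda>i. (cmod (coord (X N) i + (-1) * (coord (X N) i - l i)))\<^sup>2) summable_on UNIV"
    using diff_summable[OF N] by (intro square_summable_add coord_summable square_summable_scale)
  then have ls: "(\<lambda>i. (cmod (l i))\<^sup>2) summable_on UNIV" by simp
  define L where "L = Abs_ell2 l"
  have L: "coord L = l" using ls by (simp add: L_def coord_Abs)
  have "X \<longlonglongrightarrow> L"
  proof (rule LIMSEQ_I)
    fix e :: real assume e: "0 < e"
    then obtain N where N: "\<And>n F. \<lbrakk>N \<le> n; finite F\<rbrakk> \<Longrightarrow> (\<Sum>i\<in>F. (cmod (coord (X n) i - l i))\<^sup>2) \<le> (e/2)\<^sup>2"
      using tail[of "e/2"] by auto
    have "norm (X n - L) < e" if "N \<le> n" for n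
    proof -
      have "(norm (X n - L))\<^sup>2 \<le> (e/2)\<^sup>2"
        unfolding norm_ell2_square
        by (rule infsum_le_finite_sums[OF coord_summable]) (simp add: coord_ops L N[OF that])
      then have "norm (X n - L) \<le> e/2" using e by (intro power2_le_imp_le[of "norm (X n - L)" "e/2"]) simp_all
      then show ?thesis using e by simp
    qed
    then show "\<exists>no. \<forall>n\<ge>no. norm (X n - L) < e" by blast
  qed
  then show "convergent X" by (rule convergentI)
qed

subsection \<open>Adjoints and complex scalars\<close>

definition cscale :: "complex \<Rightarrow> 'i ell2 \<Rightarrow> 'i ell2" where
  "cscale c x = Abs_ell2 (\<lambda>i. c * coord x i)"

lemma coord_cscale: "coord (cscale c x) i = c * coord x i"
  by (simp add: cscale_def coord_Abs square_summable_scale coord_summable)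

lemma norm_cscale: "norm (cscale c x) = cmod c * norm x"
proof -
  have "(norm (cscale c x))\<^sup>2 = (cmod c * norm x)\<^sup>2"
    unfolding norm_ell2_square power_mult_distrib
    by (simp add: coord_cscale norm_mult power_mult_distrib infsum_cmult_right')
  then show ?thesis by (simp add: power2_eq_iff_nonneg)
qed

definition cscale_op :: "complex \<Rightarrow> 'i ell2 \<Rightarrow>\<^sub>L 'i ell2" where
  "cscale_op c = Blinfun (cscale c)"

lemma cscale_op [simp]: "blinfun_apply (cscale_op c) x = cscale c x"
proof -
  have "bounded_linear (cscale c :: 'a ell2 \<Rightarrow> _)"
  proof (rule bounded_linear_intro)
    show "cscale c (x + y) = cscale c x + cscale c y" "cscale c (r *\<^sub>R x) = r *\<^sub>R cscale c x" for x y :: "'a ell2" and r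
      by (rule ell2_eqI; simp add: coord_cscale coord_ops algebra_simps)+
    show "norm (cscale c x) \<le> norm x * cmod c" for x :: "'a ell2" by (simp add: norm_cscale)
  qed
  then show ?thesis by (simp add: cscale_op_def bounded_linear_Blinfun_apply)
qed

lemma cscale_simps:
  "cscale 1 x = x" "cscale c (cscale d x) = cscale (c * d) x" "cscale (c + d) x = cscale c x + cscale d x"
  "cscale c (x + y) = cscale c x + cscale c y"
  by (rule ell2_eqI; simp add: coord_cscale coord_ops algebra_simps)+

lemma inner_cscale: "inner (cscale c x) y = inner x (cscale (cnj c) y)"
  unfolding inner_ell2_def
  by (rule infsum_cong) (simp add: coord_cscale inner_complex_def algebra_simps)

type_synonym 'i op = "'i ell2 \<Rightarrow>\<^sub>L 'i ell2"

definition adjoints :: "'i op \<Rightarrow> 'i op \<Rightarrow> bool" where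
  "adjoints S T \<longleftrightarrow> (\<forall>x y. inner (blinfun_apply S x) y = inner x (blinfun_apply T y))"

lemma adjoints_unique: "\<lbrakk>adjoints S T; adjoints S T'\<rbrakk> \<Longrightarrow> T = T'"
  unfolding adjoints_def by (metis blinfun_eqI vector_eq_ldot)

lemma adjoints_sym: "adjoints S T \<Longrightarrow> adjoints T S"
  unfolding adjoints_def by (metis inner_commute)

lemma adjoints_add: "\<lbrakk>adjoints S T; adjoints S' T'\<rbrakk> \<Longrightarrow> adjoints (S + S') (T + T')"
  by (simp add: adjoints_def plus_blinfun.rep_eq inner_add_left inner_add_right)

lemma adjoints_diff: "\<lbrakk>adjoints S T; adjoints S' T'\<rbrakk> \<Longrightarrow> adjoints (S - S') (T - T')"
  by (simp add: adjoints_def minus_blinfun.rep_eq inner_diff_left inner_diff_right)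

lemma adjoints_compose: "\<lbrakk>adjoints S T; adjoints S' T'\<rbrakk> \<Longrightarrow> adjoints (S o\<^sub>L S') (T' o\<^sub>L T)"
  by (simp add: adjoints_def)

lemma adjoints_cscale: "adjoints (cscale_op c) (cscale_op (cnj c))"
  by (simp add: adjoints_def inner_cscale)

lemma adjoints_square:
  assumes "adjoints S T" shows "norm (T o\<^sub>L S) = (norm S)\<^sup>2" "norm T = norm S"
proof -
  have le: "norm S \<le> norm T" "(norm S)\<^sup>2 \<le> norm (T o\<^sub>L S)" if "adjoints S T" for S T :: "'a op"
  proof -
    have b: "norm (blinfun_apply S x) \<le> sqrt (norm (T o\<^sub>L S)) * norm x" for x
    proof -
      have "(norm (blinfun_apply S x))\<^sup>2 = inner x (blinfun_apply (T o\<^sub>L S) x)"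
        using that by (simp add: power2_norm_eq_inner adjoints_def)
      also have "\<dots> \<le> norm x * (norm (T o\<^sub>L S) * norm x)"
        using norm_blinfun[of "T o\<^sub>L S" x]
        by (intro order_trans[OF norm_cauchy_schwarz mult_left_mono]) auto
      also have "\<dots> = (sqrt (norm (T o\<^sub>L S)) * norm x)\<^sup>2" by (simp add: power_mult_distrib power2_eq_square)
      finally show ?thesis by (rule power2_le_imp_le) simp
    qed
    then have 1: "norm S \<le> sqrt (norm (T o\<^sub>L S))" by (intro norm_blinfun_bound) auto
    then have "(norm S)\<^sup>2 \<le> (sqrt (norm (T o\<^sub>L S)))\<^sup>2" by (intro power_mono) auto
    then show 2: "(norm S)\<^sup>2 \<le> norm (T o\<^sub>L S)" by simp
    also have "\<dots> \<le> norm T * norm S" by (rule norm_blinfun_compose)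
    finally show "norm S \<le> norm T" by (cases "norm S = 0") (auto simp: power2_eq_square)
  qed
  show eq: "norm T = norm S" using le(1)[OF assms] le(1)[OF adjoints_sym[OF assms]] by simp
  show "norm (T o\<^sub>L S) = (norm S)\<^sup>2"
    using le(2)[OF assms] norm_blinfun_compose[of T S] eq by (simp add: power2_eq_square)
qed

text \<open>
  The complex linear adjointable operators. They form a norm closed *-algebra, because passing to the
  adjoint is isometric.
\<close>

definition ops :: "'i op set" where
  "ops = {S. (\<forall>c. S o\<^sub>L cscale_op c = cscale_op c o\<^sub>L S) \<and> (\<exists>T. adjoints S T)}"

definition adj_op :: "'i op \<Rightarrow> 'i op" where
  "adj_op S = (SOME T. adjoints S T)"

lemma adj_op_eq: "adjoints S T \<Longrightarrow> adj_op S = T"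
  unfolding adj_op_def using adjoints_unique by (metis someI)

lemma ops_adjoints: "S \<in> ops \<Longrightarrow> adjoints S (adj_op S)"
  unfolding ops_def using adj_op_eq by blast

lemma ops_commute: "S \<in> ops \<Longrightarrow> S o\<^sub>L cscale_op c = cscale_op c o\<^sub>L S"
  by (simp add: ops_def)

lemma opsI: "\<lbrakk>\<And>c. S o\<^sub>L cscale_op c = cscale_op c o\<^sub>L S; adjoints S T\<rbrakk> \<Longrightarrow> S \<in> ops"
  unfolding ops_def by blast

lemma compose_simps:
  "(S + S') o\<^sub>L T = (S o\<^sub>L T) + (S' o\<^sub>L T)" "T o\<^sub>L (S + S') = (T o\<^sub>L S) + (T o\<^sub>L S')"
  "(S - S') o\<^sub>L T = (S o\<^sub>L T) - (S' o\<^sub>L T)" "T o\<^sub>L (S - S') = (T o\<^sub>L S) - (T o\<^sub>L S')"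
  "(S o\<^sub>L T) o\<^sub>L U = S o\<^sub>L (T o\<^sub>L U)"
  for S S' T U :: "'i op"
  by (rule blinfun_eqI; simp add: plus_blinfun.rep_eq minus_blinfun.rep_eq blinfun.add_right blinfun.diff_right)+

lemma ops_adj: assumes "S \<in> ops" shows "adj_op S \<in> ops" "adj_op (adj_op S) = S"
proof -
  have a: "adjoints S (adj_op S)" by (rule ops_adjoints[OF assms])
  show "adj_op (adj_op S) = S" by (rule adj_op_eq[OF adjoints_sym[OF a]])
  show "adj_op S \<in> ops"
  proof (rule opsI[OF _ adjoints_sym[OF a]])
    fix c
    have 1: "adjoints (cscale_op (cnj c) o\<^sub>L S) (adj_op S o\<^sub>L cscale_op c)"
      using adjoints_compose[OF adjoints_cscale[of "cnj c"] a] by simp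
    have 2: "adjoints (S o\<^sub>L cscale_op (cnj c)) (cscale_op c o\<^sub>L adj_op S)"
      using adjoints_compose[OF a adjoints_cscale[of "cnj c"]] by simp
    show "adj_op S o\<^sub>L cscale_op c = cscale_op c o\<^sub>L adj_op S"
      using adjoints_unique[OF 1] 2 ops_commute[OF assms] by simp
  qed
qed

lemma ops_add:
  assumes "S \<in> ops" "T \<in> ops" shows "S + T \<in> ops" "adj_op (S + T) = adj_op S + adj_op T"
proof -
  have a: "adjoints (S + T) (adj_op S + adj_op T)" by (intro adjoints_add ops_adjoints assms)
  show "S + T \<in> ops"
  proof (rule opsI[OF _ a])
    fix c
    show "(S + T) o\<^sub>L cscale_op c = cscale_op c o\<^sub>L (S + T)"
      using ops_commute[OF assms(1), of c] ops_commute[OF assms(2), of c]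
      by (metis compose_simps(1) compose_simps(2))
  qed
  show "adj_op (S + T) = adj_op S + adj_op T" by (rule adj_op_eq[OF a])
qed

lemma ops_diff:
  assumes "S \<in> ops" "T \<in> ops" shows "S - T \<in> ops" "adj_op (S - T) = adj_op S - adj_op T"
proof -
  have a: "adjoints (S - T) (adj_op S - adj_op T)" by (intro adjoints_diff ops_adjoints assms)
  show "S - T \<in> ops"
  proof (rule opsI[OF _ a])
    fix c
    show "(S - T) o\<^sub>L cscale_op c = cscale_op c o\<^sub>L (S - T)"
      using ops_commute[OF assms(1), of c] ops_commute[OF assms(2), of c]
      by (metis compose_simps(3) compose_simps(4))
  qed
  show "adj_op (S - T) = adj_op S - adj_op T" by (rule adj_op_eq[OF a])
qed

lemma ops_compose:
  assumes "S \<in> ops" "T \<in> ops" shows "S o\<^sub>L T \<in> ops" "adj_op (S o\<^sub>L T) = adj_op T o\<^sub>L adj_op S"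
proof -
  have a: "adjoints (S o\<^sub>L T) (adj_op T o\<^sub>L adj_op S)" by (intro adjoints_compose ops_adjoints assms)
  show "S o\<^sub>L T \<in> ops"
  proof (rule opsI[OF _ a])
    fix c
    have "(S o\<^sub>L T) o\<^sub>L cscale_op c = (S o\<^sub>L cscale_op c) o\<^sub>L T"
      unfolding compose_simps(5) ops_commute[OF assms(2)] ..
    then show "(S o\<^sub>L T) o\<^sub>L cscale_op c = cscale_op c o\<^sub>L (S o\<^sub>L T)"
      by (simp only: ops_commute[OF assms(1)] compose_simps(5))
  qed
  show "adj_op (S o\<^sub>L T) = adj_op T o\<^sub>L adj_op S" by (rule adj_op_eq[OF a])
qed

lemma ops_cscale: "cscale_op c \<in> ops" "adj_op (cscale_op c) = cscale_op (cnj c)"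
proof -
  show "cscale_op c \<in> ops"
    by (rule opsI[OF blinfun_eqI adjoints_cscale]) (simp add: cscale_simps mult.commute)
  show "adj_op (cscale_op c) = cscale_op (cnj c)" by (rule adj_op_eq[OF adjoints_cscale])
qed

lemma cscale_op_one: "cscale_op 1 = id_blinfun"
  by (rule blinfun_eqI) (simp add: cscale_simps)

lemma ops_id: "id_blinfun \<in> ops" "adj_op id_blinfun = id_blinfun"
  using ops_cscale[of 1] by (simp_all add: cscale_op_one)

lemma ops_zero: "0 \<in> ops" using ops_diff(1)[OF ops_id(1) ops_id(1)] by simp

lemma ops_uminus: "S \<in> ops \<Longrightarrow> - S \<in> ops" using ops_diff(1)[OF ops_zero] by simp

lemma norm_cscale_compose: "norm (cscale_op c o\<^sub>L S) = cmod c * norm S" for S :: "'a op"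
proof -
  have le: "norm (cscale_op c o\<^sub>L S) \<le> cmod c * norm S" for c and S :: "'a op"
    by (rule norm_blinfun_bound) (auto simp: norm_cscale mult.assoc intro!: mult_left_mono norm_blinfun)
  show ?thesis
  proof (cases "c = 0")
    case True then show ?thesis using le[of 0 S] by simp
  next
    case False
    have "S = cscale_op (inverse c) o\<^sub>L (cscale_op c o\<^sub>L S)"
      by (rule blinfun_eqI) (simp add: cscale_simps False)
    then have "norm S \<le> cmod (inverse c) * norm (cscale_op c o\<^sub>L S)" using le by metis
    then have "cmod c * norm S \<le> norm (cscale_op c o\<^sub>L S)" using False by (simp add: norm_inverse norm_divide field_simps)
    then show ?thesis using le[of c S] by simp
  qed
qed

lemma ops_limit:
  assumes X: "\<And>n. X n \<in> ops" and lim: "X \<longlonglongrightarrow> L" shows "L \<in> ops"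
proof -
  have "Cauchy (\<lambda>n. adj_op (X n))"
  proof (rule CauchyI)
    fix e :: real assume "0 < e"
    then obtain N where N: "\<And>m n. \<lbrakk>N \<le> m; N \<le> n\<rbrakk> \<Longrightarrow> norm (X m - X n) < e"
      using CauchyD[OF LIMSEQ_imp_Cauchy[OF lim]] by blast
    have "norm (adj_op (X m) - adj_op (X n)) = norm (X m - X n)" for m n
      using adjoints_square(2)[OF ops_adjoints[OF ops_diff(1)[OF X[of m] X[of n]]]] ops_diff(2)[OF X[of m] X[of n]] by simp
    then show "\<exists>M. \<forall>m\<ge>M. \<forall>n\<ge>M. norm (adj_op (X m) - adj_op (X n)) < e"
      using N by (intro exI[of _ N]) simp
  qed
  then obtain T where T: "(\<lambda>n. adj_op (X n)) \<longlonglongrightarrow> T" by (metis Cauchy_convergent convergent_def)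
  have app: "(\<lambda>n. blinfun_apply (Y n) x) \<longlonglongrightarrow> blinfun_apply Z x" if "Y \<longlonglongrightarrow> Z" for Y :: "nat \<Rightarrow> 'a op" and Z x
    using that by (intro tendsto_intros)
  show ?thesis
  proof (rule opsI)
    fix c
    show "L o\<^sub>L cscale_op c = cscale_op c o\<^sub>L L"
    proof (rule blinfun_eqI)
      fix x
      have "(\<lambda>n. blinfun_apply (X n) (cscale c x)) \<longlonglongrightarrow> blinfun_apply L (cscale c x)" by (rule app[OF lim])
      moreover have "(\<lambda>n. blinfun_apply (cscale_op c) (blinfun_apply (X n) x)) \<longlonglongrightarrow> blinfun_apply (cscale_op c) (blinfun_apply L x)"
        by (intro blinfun.tendsto tendsto_const app[OF lim])
      moreover have "blinfun_apply (X n) (cscale c x) = blinfun_apply (cscale_op c) (blinfun_apply (X n) x)" for n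
        using arg_cong[OF ops_commute[OF X[of n], of c], of "\<lambda>T. blinfun_apply T x"] by simp
      ultimately show "blinfun_apply (L o\<^sub>L cscale_op c) x = blinfun_apply (cscale_op c o\<^sub>L L) x"
        using LIMSEQ_unique by simp blast
    qed
    show "adjoints L T"
      unfolding adjoints_def
    proof (intro allI)
      fix x y
      have "(\<lambda>n. inner (blinfun_apply (X n) x) y) \<longlonglongrightarrow> inner (blinfun_apply L x) y"
        by (intro tendsto_inner app[OF lim] tendsto_const)
      moreover have "(\<lambda>n. inner x (blinfun_apply (adj_op (X n)) y)) \<longlonglongrightarrow> inner x (blinfun_apply T y)"
        by (intro tendsto_inner app[OF T] tendsto_const)
      moreover have "inner (blinfun_apply (X n) x) y = inner x (blinfun_apply (adj_op (X n)) y)" for n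
        using ops_adjoints[OF X[of n]] by (simp add: adjoints_def)
      ultimately show "inner (blinfun_apply L x) y = inner x (blinfun_apply T y)"
        using LIMSEQ_unique by simp blast
    qed
  qed
qed

subsection \<open>The C*-algebra of operators\<close>

lemma id_compose [simp]: "id_blinfun o\<^sub>L S = S" "S o\<^sub>L id_blinfun = S"
  by (rule blinfun_eqI; simp)+

text \<open>
  The operators form a C*-algebra on the type of bounded linear maps. The universal property speaks of
  algebras over the type \<^typ>\<open>nat \<Rightarrow> nat \<Rightarrow> complex\<close>, so all operations are transported along an
  injective encoding \<open>\<phi>\<close>.
\<close>

definition op_algebra :: "('i op \<Rightarrow> 'b) \<Rightarrow> 'b cstar" where
  "op_algebra \<phi> = (let \<psi> = inv_into ops \<phi> in
     \<lparr>carrier = \<phi> ` ops, mult = (\<lambda>x y. \<phi> (\<psi> x o\<^sub>L \<psi> y)), one = \<phi> id_blinfun,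
      zero = \<phi> 0, add = (\<lambda>x y. \<phi> (\<psi> x + \<psi> y)), smult = (\<lambda>c x. \<phi> (cscale_op c o\<^sub>L \<psi> x)),
      adj = (\<lambda>x. \<phi> (adj_op (\<psi> x))), cnorm = (\<lambda>x. norm (\<psi> x))\<rparr>)"

locale op_encoding =
  fixes \<phi> :: "'i op \<Rightarrow> 'b"
  assumes inj: "inj_on \<phi> ops"
begin

abbreviation B :: "'b cstar" where "B \<equiv> op_algebra \<phi>"

lemma B_simps:
  "carrier B = \<phi> ` ops" "one B = \<phi> id_blinfun" "zero B = \<phi> 0"
  "\<lbrakk>S \<in> ops; T \<in> ops\<rbrakk> \<Longrightarrow> mult B (\<phi> S) (\<phi> T) = \<phi> (S o\<^sub>L T)"
  "\<lbrakk>S \<in> ops; T \<in> ops\<rbrakk> \<Longrightarrow> add B (\<phi> S) (\<phi> T) = \<phi> (S + T)"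
  "S \<in> ops \<Longrightarrow> smult B c (\<phi> S) = \<phi> (cscale_op c o\<^sub>L S)"
  "S \<in> ops \<Longrightarrow> adj B (\<phi> S) = \<phi> (adj_op S)"
  "S \<in> ops \<Longrightarrow> cnorm B (\<phi> S) = norm S"
  using inj by (simp_all add: op_algebra_def Let_def)

lemma ring_B: "ring B"
proof (rule ringI)
  show "abelian_group B"
  proof (rule abelian_groupI)
    fix x assume "x \<in> carrier B"
    then obtain S where S: "S \<in> ops" "x = \<phi> S" by (auto simp: B_simps)
    then have "add B (\<phi> (- S)) x = zero B" by (simp add: B_simps ops_uminus)
    then show "\<exists>y\<in>carrier B. add B y x = zero B"
      using S ops_uminus by (intro bexI[of _ "\<phi> (- S)"]) (auto simp: B_simps)
  qed (auto simp: B_simps ops_add ops_zero add_ac)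
  show "Group.monoid B"
    by (rule monoidI) (auto simp: B_simps ops_compose ops_id compose_simps(5))
qed (auto simp: B_simps ops_compose ops_add compose_simps)

lemma B_minus:
  assumes "S \<in> ops" "T \<in> ops" shows "a_minus B (\<phi> S) (\<phi> T) = \<phi> (S - T)"
proof -
  interpret ring B by (rule ring_B)
  have "a_inv B (\<phi> T) = \<phi> (- T)"
    using assms ops_uminus[OF assms(2)] by (intro minus_equality) (auto simp: B_simps)
  then show ?thesis using assms ops_uminus[OF assms(2)] by (simp add: a_minus_def B_simps)
qed

lemma B_dist: "\<lbrakk>S \<in> ops; T \<in> ops\<rbrakk> \<Longrightarrow> cdist B (\<phi> S) (\<phi> T) = dist S T"
  by (simp add: cdist_def B_minus B_simps ops_diff dist_norm)

lemma B_Metric_space: "Metric_space (carrier B) (cdist B)"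
proof
  show "0 \<le> cdist B x y" for x y
  proof (cases "x \<in> carrier B \<and> y \<in> carrier B")
    case True then show ?thesis by (auto simp: B_simps B_dist)
  qed (auto simp: cdist_def)
  show "cdist B x y = cdist B y x" for x y
  proof (cases "x \<in> carrier B \<and> y \<in> carrier B")
    case True then show ?thesis by (auto simp: B_simps B_dist dist_commute)
  qed (auto simp: cdist_def)
  show "cdist B x y = 0 \<longleftrightarrow> x = y" if "x \<in> carrier B" "y \<in> carrier B" for x y
    using that inj by (auto simp: B_simps B_dist inj_on_def)
  show "cdist B x z \<le> cdist B x y + cdist B y z" if "x \<in> carrier B" "y \<in> carrier B" "z \<in> carrier B" for x y z
    using that by (auto simp: B_simps B_dist dist_triangle)
qed

lemma B_complete: "Metric_space.mcomplete (carrier B) (cdist B)"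
proof -
  interpret M: Metric_space "carrier B" "cdist B" by (rule B_Metric_space)
  show ?thesis unfolding M.mcomplete_def
  proof (intro allI impI)
    fix x assume x: "M.MCauchy x"
    then have "x n \<in> carrier B" for n by (auto simp: M.MCauchy_def)
    then have "\<forall>n. \<exists>S\<in>ops. x n = \<phi> S" by (auto simp: B_simps)
    then obtain S where S: "\<And>n. S n \<in> ops" "\<And>n. x n = \<phi> (S n)" by metis
    have "Cauchy S"
    proof (rule metric_CauchyI)
      fix e :: real assume "0 < e"
      then have "\<exists>N. \<forall>n n'. N \<le> n \<longrightarrow> N \<le> n' \<longrightarrow> cdist B (x n) (x n') < e" using x unfolding M.MCauchy_def by blast
      then show "\<exists>M. \<forall>m\<ge>M. \<forall>n\<ge>M. dist (S m) (S n) < e" using S by (simp add: B_dist)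
    qed
    then obtain L where L: "S \<longlonglongrightarrow> L" using Cauchy_convergent unfolding convergent_def by blast
    have Lo: "L \<in> ops" using ops_limit[OF S(1) L] .
    have "limitin M.mtopology x (\<phi> L) sequentially"
      unfolding M.limitin_metric_dist_null
    proof (intro conjI always_eventually allI)
      show "\<phi> L \<in> carrier B" "x n \<in> carrier B" for n using Lo S by (auto simp: B_simps)
      show "(\<lambda>n. cdist B (x n) (\<phi> L)) \<longlonglongrightarrow> 0"
        using L S Lo tendsto_dist_iff[of S L] by (simp add: B_dist)
    qed
    then show "\<exists>l. limitin M.mtopology x l sequentially" by blast
  qed
qed

lemma B_cstar: "unital_cstar_algebra B"
proof (intro unital_cstar_algebra.intro unital_cstar_algebra_axioms.intro ring_B B_complete)
  fix x y c d assume "x \<in> carrier B"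
  then obtain S where S: "S \<in> ops" "x = \<phi> S" by (auto simp: B_simps)
  note sc = ops_compose(1)[OF ops_cscale(1) S(1)]
  have cc: "cscale_op c o\<^sub>L cscale_op d = cscale_op (c * d)" "cscale_op (c + d) = cscale_op c + cscale_op d" for c d
    by (rule blinfun_eqI; simp add: cscale_simps plus_blinfun.rep_eq)+
  show "smult B c x \<in> carrier B" "smult B 1 x = x" "adj B x \<in> carrier B" "adj B (adj B x) = x"
    "smult B c (smult B d x) = smult B (c * d) x" "smult B (c + d) x = add B (smult B c x) (smult B d x)"
    "0 \<le> cnorm B x" "cnorm B (smult B c x) = cmod c * cnorm B x" "cnorm B x = 0 \<longleftrightarrow> x = zero B"
    using S sc inj ops_adj[OF S(1)] inj_on_eq_iff[OF inj S(1) ops_zero]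
    by (simp_all add: B_simps cscale_op_one norm_cscale_compose cc compose_simps flip: compose_simps(5))
  show "adj B (smult B c x) = smult B (cnj c) (adj B x)"
    using S sc ops_adj[OF S(1)] ops_commute[OF ops_adj(1)[OF S(1)], of "cnj c"]
    by (simp add: B_simps ops_compose(2)[OF ops_cscale(1) S(1)] ops_cscale)
  show "cnorm B (mult B (adj B x) x) = (cnorm B x)\<^sup>2"
    using S ops_adj[OF S(1)] adjoints_square(1)[OF ops_adjoints[OF S(1)]] by (simp add: B_simps ops_compose)
  assume "y \<in> carrier B"
  then obtain T where T: "T \<in> ops" "y = \<phi> T" by (auto simp: B_simps)
  note tc = ops_compose(1)[OF ops_cscale(1) T(1)]
  show "smult B c (add B x y) = add B (smult B c x) (smult B c y)"
    "mult B (smult B c x) y = smult B c (mult B x y)"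
    "adj B (add B x y) = add B (adj B x) (adj B y)" "adj B (mult B x y) = mult B (adj B y) (adj B x)"
    "cnorm B (add B x y) \<le> cnorm B x + cnorm B y" "cnorm B (mult B x y) \<le> cnorm B x * cnorm B y"
    using S T sc tc ops_adj[OF S(1)] ops_adj[OF T(1)]
    by (simp_all add: B_simps ops_add ops_compose compose_simps norm_triangle_ineq norm_blinfun_compose)
  have "S o\<^sub>L (cscale_op c o\<^sub>L T) = cscale_op c o\<^sub>L (S o\<^sub>L T)"
    using ops_commute[OF S(1), of c] by (metis compose_simps(5))
  then show "mult B x (smult B c y) = smult B c (mult B x y)"
    using S T tc by (simp add: B_simps ops_compose)
qed

end

text \<open>
  The encoding that will be used is the matrix of an operator. It is injective on \<open>ops\<close> because the
  values on the unit vectors determine the adjoint.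
\<close>

definition unit_vector :: "'i \<Rightarrow> 'i ell2" where
  "unit_vector k = Abs_ell2 (\<lambda>i. if i = k then 1 else 0)"

lemma coord_unit_vector: "coord (unit_vector k) i = (if i = k then 1 else 0)"
proof -
  have "(\<lambda>i. (cmod (if i = k then 1 else 0))\<^sup>2) summable_on UNIV \<longleftrightarrow> (\<lambda>i. (cmod (if i = k then 1 else 0))\<^sup>2) summable_on {k}"
    by (rule summable_on_cong_neutral) auto
  then have "(\<lambda>i. (cmod (if i = k then 1 else 0))\<^sup>2) summable_on UNIV" by simp
  then show ?thesis by (simp add: unit_vector_def coord_Abs)
qed

lemma inner_unit_vector: "inner x (cscale c (unit_vector k)) = inner (coord x k) c"
proof -
  have "inner x (cscale c (unit_vector k)) = infsum (\<lambda>i. inner (coord x i) (coord (cscale c (unit_vector k)) i)) {k}"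
    unfolding inner_ell2_def by (rule infsum_cong_neutral) (auto simp: coord_cscale coord_unit_vector)
  then show ?thesis by (simp add: coord_cscale coord_unit_vector)
qed

lemma ell2_eq_by_unit_vectors:
  assumes "\<And>c k. inner x (cscale c (unit_vector k)) = inner y (cscale c (unit_vector k))" shows "x = y"
proof (rule ell2_eqI)
  fix k
  have "inner (coord x k) c = inner (coord y k) c" for c using assms[of c k] by (simp add: inner_unit_vector)
  then show "coord x k = coord y k" by (metis vector_eq_rdot)
qed

lemma ops_apply_cscale: "S \<in> ops \<Longrightarrow> blinfun_apply S (cscale c x) = cscale c (blinfun_apply S x)"
  using arg_cong[OF ops_commute, of S "\<lambda>T. blinfun_apply T x"] by simp

lemma ops_eq_by_unit_vectors:
  assumes "S \<in> ops" "T \<in> ops" and eq: "\<And>k. blinfun_apply S (unit_vector k) = blinfun_apply T (unit_vector k)"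
  shows "S = T"
proof -
  \<comment> \<open>equality on unit vectors passes to the adjoints, and from there back to the operators\<close>
  have adj_eq: "blinfun_apply (adj_op S) x = blinfun_apply (adj_op T) x"
    if S: "S \<in> ops" and T: "T \<in> ops" and eq: "\<And>k. blinfun_apply S (unit_vector k) = blinfun_apply T (unit_vector k)"
    for S T :: "'a op" and x
  proof (rule ell2_eq_by_unit_vectors)
    fix c k
    have "inner (blinfun_apply (adj_op S) x) (cscale c (unit_vector k)) = inner x (blinfun_apply S (cscale c (unit_vector k)))"
      using adjoints_sym[OF ops_adjoints[OF S]] by (simp add: adjoints_def)
    also have "\<dots> = inner x (blinfun_apply T (cscale c (unit_vector k)))"
      by (simp add: ops_apply_cscale[OF S] ops_apply_cscale[OF T] eq)
    also have "\<dots> = inner (blinfun_apply (adj_op T) x) (cscale c (unit_vector k))"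
      using adjoints_sym[OF ops_adjoints[OF T]] by (simp add: adjoints_def)
    finally show "inner (blinfun_apply (adj_op S) x) (cscale c (unit_vector k)) = inner (blinfun_apply (adj_op T) x) (cscale c (unit_vector k))" .
  qed
  have "adj_op S = adj_op T" by (rule blinfun_eqI) (rule adj_eq[OF assms])
  then show ?thesis using ops_adj(2) assms by metis
qed

definition matrix_of_op :: "'i::countable op \<Rightarrow> nat \<Rightarrow> nat \<Rightarrow> complex" where
  "matrix_of_op S j k = coord (blinfun_apply S (unit_vector (from_nat j))) (from_nat k)"

lemma inj_matrix_of_op: "inj_on (matrix_of_op :: 'i::countable op \<Rightarrow> _) ops"
proof (rule inj_onI)
  fix S T :: "'i op" assume o: "S \<in> ops" "T \<in> ops" and eq: "matrix_of_op S = matrix_of_op T"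
  have "blinfun_apply S (unit_vector i) = blinfun_apply T (unit_vector i)" for i
  proof (rule ell2_eqI)
    fix k
    show "coord (blinfun_apply S (unit_vector i)) k = coord (blinfun_apply T (unit_vector i)) k"
      using fun_cong[OF fun_cong[OF eq, of "to_nat i"], of "to_nat k"] by (simp add: matrix_of_op_def)
  qed
  then show "S = T" using ops_eq_by_unit_vectors o by blast
qed

subsection \<open>Weighted shifts\<close>

text \<open>
  The weighted shift \<open>U\<close> maps the unit vector of \<open>i\<close> to \<open>p i\<close> times the unit vector of \<open>f i\<close>, and \<open>V\<close> is its
  adjoint.
\<close>

locale weighted_shift =
  fixes f :: "'i \<Rightarrow> 'i" and p :: "'i \<Rightarrow> complex"
  assumes f: "inj f" and p: "\<And>i. cmod (p i) = 1"
begin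

definition fwd :: "'i ell2 \<Rightarrow> 'i ell2" where
  "fwd x = Abs_ell2 (\<lambda>k. if k \<in> range f then p (inv_into UNIV f k) * coord x (inv_into UNIV f k) else 0)"

definition bwd :: "'i ell2 \<Rightarrow> 'i ell2" where
  "bwd x = Abs_ell2 (\<lambda>i. cnj (p i) * coord x (f i))"

lemma fwd_summable: "(\<lambda>k. (cmod (if k \<in> range f then p (inv_into UNIV f k) * coord x (inv_into UNIV f k) else 0))\<^sup>2) summable_on UNIV"
  and fwd_infsum: "infsum (\<lambda>k. (cmod (if k \<in> range f then p (inv_into UNIV f k) * coord x (inv_into UNIV f k) else 0))\<^sup>2) UNIV = (norm x)\<^sup>2"
proof -
  let ?g = "\<lambda>k. (cmod (if k \<in> range f then p (inv_into UNIV f k) * coord x (inv_into UNIV f k) else 0))\<^sup>2"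
  have g: "?g \<circ> f = (\<lambda>i. (cmod (coord x i))\<^sup>2)" using f p by (auto simp: norm_mult)
  have "?g summable_on UNIV \<longleftrightarrow> ?g summable_on (f ` UNIV)" by (rule summable_on_cong_neutral) auto
  also have "\<dots> \<longleftrightarrow> (?g \<circ> f) summable_on UNIV" by (rule summable_on_reindex[OF f])
  finally show "?g summable_on UNIV" unfolding g using coord_summable by blast
  have "infsum ?g UNIV = infsum ?g (f ` UNIV)" by (rule infsum_cong_neutral) auto
  also have "\<dots> = infsum (?g \<circ> f) UNIV" by (rule infsum_reindex[OF f])
  finally show "infsum ?g UNIV = (norm x)\<^sup>2" unfolding g norm_ell2_square .
qed

lemma bwd_summable: "(\<lambda>i. (cmod (cnj (p i) * coord x (f i)))\<^sup>2) summable_on UNIV"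
  and bwd_infsum: "infsum (\<lambda>i. (cmod (cnj (p i) * coord x (f i)))\<^sup>2) UNIV \<le> (norm x)\<^sup>2"
proof -
  let ?g = "\<lambda>k. (cmod (coord x k))\<^sup>2"
  have g: "(\<lambda>i. (cmod (cnj (p i) * coord x (f i)))\<^sup>2) = ?g \<circ> f" using p by (auto simp: norm_mult)
  have s: "?g summable_on (f ` UNIV)" by (rule summable_on_subset_banach[OF coord_summable]) simp
  show "(\<lambda>i. (cmod (cnj (p i) * coord x (f i)))\<^sup>2) summable_on UNIV"
    unfolding g using s summable_on_reindex[OF f] by blast
  have "infsum (?g \<circ> f) UNIV = infsum ?g (f ` UNIV)" by (rule infsum_reindex[OF f, symmetric])
  also have "\<dots> \<le> infsum ?g UNIV" by (rule infsum_mono2[OF s coord_summable]) auto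
  finally show "infsum (\<lambda>i. (cmod (cnj (p i) * coord x (f i)))\<^sup>2) UNIV \<le> (norm x)\<^sup>2"
    unfolding g norm_ell2_square .
qed

lemma coord_fwd: "coord (fwd x) (f i) = p i * coord x i" "k \<notin> range f \<Longrightarrow> coord (fwd x) k = 0"
  using f by (simp_all add: fwd_def coord_Abs[OF fwd_summable])

lemma coord_bwd: "coord (bwd x) i = cnj (p i) * coord x (f i)"
  by (simp add: bwd_def coord_Abs[OF bwd_summable])

lemma coord_fwd_if: "coord (fwd x) k = (if k \<in> range f then p (inv_into UNIV f k) * coord x (inv_into UNIV f k) else 0)"
  by (simp add: fwd_def coord_Abs[OF fwd_summable])

definition U :: "'i op" where "U = Blinfun fwd"
definition V :: "'i op" where "V = Blinfun bwd"

lemma U [simp]: "blinfun_apply U x = fwd x"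
proof -
  have "bounded_linear fwd"
  proof (rule bounded_linear_intro)
    show "fwd (x + y) = fwd x + fwd y" "fwd (r *\<^sub>R x) = r *\<^sub>R fwd x" for x y r
      by (rule ell2_eqI; simp add: coord_fwd_if coord_ops algebra_simps)+
    have "(norm (fwd x))\<^sup>2 = (norm x)\<^sup>2" for x
      using fwd_infsum[of x] unfolding norm_ell2_square coord_fwd_if .
    then show "norm (fwd x) \<le> norm x * 1" for x by (simp add: power2_eq_iff_nonneg)
  qed
  then show ?thesis by (simp add: U_def bounded_linear_Blinfun_apply)
qed

lemma V [simp]: "blinfun_apply V x = bwd x"
proof -
  have "bounded_linear bwd"
  proof (rule bounded_linear_intro)
    show "bwd (x + y) = bwd x + bwd y" "bwd (r *\<^sub>R x) = r *\<^sub>R bwd x" for x y r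
      by (rule ell2_eqI; simp add: coord_bwd coord_ops algebra_simps)+
    have "(norm (bwd x))\<^sup>2 \<le> (norm x)\<^sup>2" for x
      using bwd_infsum[of x] unfolding norm_ell2_square[of "bwd x"] coord_bwd .
    then show "norm (bwd x) \<le> norm x * 1" for x
      using power2_le_imp_le[of "norm (bwd x)" "norm x"] by simp
  qed
  then show ?thesis by (simp add: V_def bounded_linear_Blinfun_apply)
qed

lemma adjoints_UV: "adjoints U V"
  unfolding adjoints_def
proof (intro allI)
  fix x y
  let ?g = "\<lambda>k. inner (coord (fwd x) k) (coord y k)"
  have "inner (blinfun_apply U x) y = infsum ?g (f ` UNIV)"
    unfolding U inner_ell2_def by (rule infsum_cong_neutral) (auto simp: coord_fwd(2))
  also have "\<dots> = infsum (?g \<circ> f) UNIV" by (rule infsum_reindex[OF f])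
  also have "\<dots> = inner x (blinfun_apply V y)"
    unfolding V inner_ell2_def
    by (rule infsum_cong) (simp add: coord_fwd(1) coord_bwd inner_complex_def algebra_simps)
  finally show "inner (blinfun_apply U x) y = inner x (blinfun_apply V y)" .
qed

lemma U_ops: "U \<in> ops"
proof (rule opsI[OF _ adjoints_UV])
  fix c
  show "U o\<^sub>L cscale_op c = cscale_op c o\<^sub>L U"
    by (rule blinfun_eqI, rule ell2_eqI) (simp add: coord_fwd_if coord_cscale)
qed

lemma adj_U: "adj_op U = V"
  by (rule adj_op_eq[OF adjoints_UV])

end

subsection \<open>A representation by isometries with full ranges\<close>

context
  fixes n m :: nat and q :: complex
  assumes n: "0 < n" and m: "0 < m" and q: "cmod q = 1"
begin

lemma norm_q_powi: "cmod (q powi k) = 1"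
  using q by (simp add: norm_power_int)

lemma shift_s: "j < n \<Longrightarrow> weighted_shift (\<lambda>(x, k :: int, y :: nat). (n * x + j, k + 1, y)) (\<lambda>_. 1)"
  using n by unfold_locales (auto simp: inj_def)

lemma shift_t: "r < m \<Longrightarrow> weighted_shift (\<lambda>(x :: nat, k, y). (x, k, m * y + r)) (\<lambda>(x, k, y). q powi k)"
  using m norm_q_powi by unfold_locales (auto simp: inj_def)

text \<open>
  On the Hilbert space with basis \<open>(x, k, y)\<close> the isometries act on \<open>x\<close> and \<open>y\<close> by appending a digit
  in base \<open>n\<close> and base \<open>m\<close>; every natural number has a last digit, so the ranges exhaust the space. The integer
  \<open>k\<close> counts the applications of the first family, and the weight \<open>q powi k\<close> of the second family
  turns this into the commutation relation.
\<close>

definition rep_s :: "nat \<Rightarrow> (nat \<times> int \<times> nat) op" where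
  "rep_s j = weighted_shift.U (\<lambda>(x, k, y). (n * x + j, k + 1, y)) (\<lambda>_. 1)"

definition rep_t :: "nat \<Rightarrow> (nat \<times> int \<times> nat) op" where
  "rep_t r = weighted_shift.U (\<lambda>(x, k, y). (x, k, m * y + r)) (\<lambda>(x, k, y). q powi k)"

lemma rep_ops: "j < n \<Longrightarrow> rep_s j \<in> ops" "r < m \<Longrightarrow> rep_t r \<in> ops"
  unfolding rep_s_def rep_t_def
  by (erule weighted_shift.U_ops[OF shift_s]) (erule weighted_shift.U_ops[OF shift_t])

lemma coord_rep_s:
  assumes j: "j < n"
  shows "coord (blinfun_apply (rep_s j) z) (a, k, y) = (if a mod n = j then coord z (a div n, k - 1, y) else 0)"
proof (cases "a mod n = j")
  case True
  then have "a = n * (a div n) + j" by (metis mult_div_mod_eq)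
  then show ?thesis using True weighted_shift.coord_fwd(1)[OF shift_s[OF j], of z "(a div n, k - 1, y)"]
    by (simp add: rep_s_def weighted_shift.U[OF shift_s[OF j]])
next
  case False
  then have "(a, k, y) \<notin> range (\<lambda>(x, k, y). (n * x + j, k + 1, y))" using j by auto
  then show ?thesis using weighted_shift.coord_fwd(2)[OF shift_s[OF j], of "(a, k, y)" z] False
    by (simp add: rep_s_def weighted_shift.U[OF shift_s[OF j]])
qed

lemma coord_rep_t:
  assumes r: "r < m"
  shows "coord (blinfun_apply (rep_t r) z) (x, k, b) = (if b mod m = r then q powi k * coord z (x, k, b div m) else 0)"
proof (cases "b mod m = r")
  case True
  then have "b = m * (b div m) + r" by (metis mult_div_mod_eq)
  then show ?thesis using True weighted_shift.coord_fwd(1)[OF shift_t[OF r], of z "(x, k, b div m)"]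
    by (simp add: rep_t_def weighted_shift.U[OF shift_t[OF r]])
next
  case False
  then have "(x, k, b) \<notin> range (\<lambda>(x, k, y). (x, k, m * y + r))" using r by auto
  then show ?thesis using weighted_shift.coord_fwd(2)[OF shift_t[OF r], of "(x, k, b)" z] False
    by (simp add: rep_t_def weighted_shift.U[OF shift_t[OF r]])
qed

lemma coord_adj_rep_s:
  "j < n \<Longrightarrow> coord (blinfun_apply (adj_op (rep_s j)) z) (x, k, y) = coord z (n * x + j, k + 1, y)"
  using weighted_shift.coord_bwd[OF shift_s, of j z "(x, k, y)"]
  by (simp add: rep_s_def weighted_shift.adj_U[OF shift_s] weighted_shift.V[OF shift_s])

lemma coord_adj_rep_t:
  "r < m \<Longrightarrow> coord (blinfun_apply (adj_op (rep_t r)) z) (x, k, y) = cnj (q powi k) * coord z (x, k, m * y + r)"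
  using weighted_shift.coord_bwd[OF shift_t, of r z "(x, k, y)"]
  by (simp add: rep_t_def weighted_shift.adj_U[OF shift_t] weighted_shift.V[OF shift_t])

lemma op_eqI:
  "(\<And>z x k y. coord (blinfun_apply S z) (x, k, y) = coord (blinfun_apply T z) (x, k, y)) \<Longrightarrow> S = T"
  for S T :: "(nat \<times> int \<times> nat) op"
  by (rule blinfun_eqI, rule ell2_eqI) (metis surj_pair)

lemma rep_relations:
  "\<lbrakk>i < n; j < n\<rbrakk> \<Longrightarrow> adj_op (rep_s i) o\<^sub>L rep_s j = (if i = j then id_blinfun else 0)"
  "\<lbrakk>r < m; l < m\<rbrakk> \<Longrightarrow> adj_op (rep_t r) o\<^sub>L rep_t l = (if r = l then id_blinfun else 0)"
  "\<lbrakk>j < n; r < m\<rbrakk> \<Longrightarrow> adj_op (rep_s j) o\<^sub>L rep_t r = cscale_op q o\<^sub>L (rep_t r o\<^sub>L adj_op (rep_s j))"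
proof -
  have qq: "cnj q powi k * q powi k = 1" for k
    using norm_q_powi complex_norm_square[of "q powi k"] by (simp add: mult.commute)
  have "q \<noteq> 0" using q by auto
  then have qs: "q powi (k + 1) = q * q powi k" for k by (simp add: power_int_add)
  show "adj_op (rep_s i) o\<^sub>L rep_s j = (if i = j then id_blinfun else 0)" if "i < n" "j < n"
    by (rule op_eqI) (use that in \<open>auto simp: coord_rep_s coord_adj_rep_s coord_ops\<close>)
  show "adj_op (rep_t r) o\<^sub>L rep_t l = (if r = l then id_blinfun else 0)" if "r < m" "l < m"
    by (rule op_eqI) (use that in \<open>auto simp: coord_rep_t coord_adj_rep_t coord_ops qq simp flip: mult.assoc\<close>)
  show "adj_op (rep_s j) o\<^sub>L rep_t r = cscale_op q o\<^sub>L (rep_t r o\<^sub>L adj_op (rep_s j))" if "j < n" "r < m"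
    by (rule op_eqI) (use that in \<open>simp add: coord_rep_t coord_adj_rep_s coord_cscale qs\<close>)
qed

text \<open>
  The ranges of the isometries of each family span the space.
\<close>

lemma zero_if_adj_rep_zero:
  fixes Z :: "(nat \<times> int \<times> nat) op"
  shows "(\<And>j. j < n \<Longrightarrow> adj_op (rep_s j) o\<^sub>L Z = 0) \<Longrightarrow> Z = 0"
    and "(\<And>r. r < m \<Longrightarrow> adj_op (rep_t r) o\<^sub>L Z = 0) \<Longrightarrow> Z = 0"
proof -
  assume 0: "adj_op (rep_s j) o\<^sub>L Z = 0" if "j < n" for j
  show "Z = 0"
  proof (rule op_eqI)
    fix z a k y
    have j: "a mod n < n" using n by simp
    show "coord (blinfun_apply Z z) (a, k, y) = coord (blinfun_apply 0 z) (a, k, y)"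
      using coord_adj_rep_s[OF j, of "blinfun_apply Z z" "a div n" "k - 1" y]
        arg_cong[OF 0[OF j], of "\<lambda>T. coord (blinfun_apply T z) (a div n, k - 1, y)"]
      by (simp add: coord_ops)
  qed
next
  have q0: "q \<noteq> 0" using q by auto
  assume 0: "adj_op (rep_t r) o\<^sub>L Z = 0" if "r < m" for r
  show "Z = 0"
  proof (rule op_eqI)
    fix z x k b
    have r: "b mod m < m" using m by simp
    show "coord (blinfun_apply Z z) (x, k, b) = coord (blinfun_apply 0 z) (x, k, b)"
      using coord_adj_rep_t[OF r, of "blinfun_apply Z z" x k "b div m"] q0
        arg_cong[OF 0[OF r], of "\<lambda>T. coord (blinfun_apply T z) (x, k, b div m)"]
      by (simp add: coord_ops)
  qed
qed

end

lemma full_representation: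
  assumes n: "2 \<le> n" and m: "2 \<le> m" and q: "cmod q = 1"
  obtains B :: "(nat \<Rightarrow> nat \<Rightarrow> complex) cstar" and s t
  where "unital_cstar_algebra B" "E_relations n m q B s t" "\<one>\<^bsub>B\<^esub> \<noteq> \<zero>\<^bsub>B\<^esub>"
    "range_sum B n s = \<one>\<^bsub>B\<^esub>" "range_sum B m t = \<one>\<^bsub>B\<^esub>"
proof -
  let ?e = "unit_vector (0, 0, 0) :: (nat \<times> int \<times> nat) ell2"
  let ?\<phi> = "matrix_of_op :: (nat \<times> int \<times> nat) op \<Rightarrow> nat \<Rightarrow> nat \<Rightarrow> complex"
  interpret op_encoding ?\<phi> by (rule op_encoding.intro[OF inj_matrix_of_op])
  interpret B: unital_cstar_algebra B by (rule B_cstar)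
  have nm: "0 < n" "0 < m" using n m by auto
  let ?s = "\<lambda>i. ?\<phi> (rep_s n (i - 1))" and ?t = "\<lambda>r. ?\<phi> (rep_t m q (r - 1))"
  have o: "i \<in> {1..n} \<Longrightarrow> rep_s n (i - 1) \<in> ops" "r \<in> {1..m} \<Longrightarrow> rep_t m q (r - 1) \<in> ops" for i r
    using rep_ops[OF nm q] by auto
  have ao: "i \<in> {1..n} \<Longrightarrow> adj_op (rep_s n (i - 1)) \<in> ops" "r \<in> {1..m} \<Longrightarrow> adj_op (rep_t m q (r - 1)) \<in> ops" for i r
    using ops_adj(1) o by blast+
  have rel: "E_relations n m q B ?s ?t"
    unfolding E_relations_def
    using o ao rep_relations[OF nm q] by (auto simp: B_simps ops_compose eq_diff_iff)
  interpret E: E_family B n m q ?s ?t by unfold_locales (rule n m q rel)+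
  have range_full: "w = \<zero>\<^bsub>B\<^esub>" if w: "w \<in> carrier B"
    and 0: "(\<forall>i\<in>{1..n}. adj B (?s i) \<otimes>\<^bsub>B\<^esub> w = \<zero>\<^bsub>B\<^esub>) \<or> (\<forall>r\<in>{1..m}. adj B (?t r) \<otimes>\<^bsub>B\<^esub> w = \<zero>\<^bsub>B\<^esub>)" for w
  proof -
    obtain Z where Z: "Z \<in> ops" "w = ?\<phi> Z" using w by (auto simp: B_simps)
    have zero: "X o\<^sub>L Z = 0" if "X \<in> ops" "?\<phi> (X o\<^sub>L Z) = ?\<phi> 0" for X
      using inj_onD[OF inj_matrix_of_op that(2) ops_compose(1)[OF that(1) Z(1)] ops_zero] .
    have "(\<forall>i\<in>{1..n}. adj_op (rep_s n (i - 1)) o\<^sub>L Z = 0) \<or> (\<forall>r\<in>{1..m}. adj_op (rep_t m q (r - 1)) o\<^sub>L Z = 0)"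
      using 0 o ao Z by (auto simp: B_simps intro!: zero)
    \<comment> \<open>the letters start at 1, the digits at 0\<close>
    then have "(\<forall>j<n. adj_op (rep_s n j) o\<^sub>L Z = 0) \<or> (\<forall>r<m. adj_op (rep_t m q r) o\<^sub>L Z = 0)"
      by (metis Suc_leI atLeastAtMost_iff diff_Suc_1 le_add1 plus_1_eq_Suc)
    then have "Z = 0" using zero_if_adj_rep_zero[OF nm q] by blast
    then show ?thesis using Z by (simp add: B_simps)
  qed
  have "\<one>\<^bsub>B\<^esub> \<ominus>\<^bsub>B\<^esub> E.S.amp \<one>\<^bsub>B\<^esub> = \<zero>\<^bsub>B\<^esub>" "\<one>\<^bsub>B\<^esub> \<ominus>\<^bsub>B\<^esub> E.T.amp \<one>\<^bsub>B\<^esub> = \<zero>\<^bsub>B\<^esub>"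
    by (rule range_full; force simp: B.r_distr_diff E.S.adj_T_amp E.T.adj_T_amp)+
  then have "range_sum B n ?s = \<one>\<^bsub>B\<^esub>" "range_sum B m ?t = \<one>\<^bsub>B\<^esub>"
    unfolding E.range_sum_s E.range_sum_t by (auto simp: B.diff_eq_zero_iff)
  moreover have "\<one>\<^bsub>B\<^esub> \<noteq> \<zero>\<^bsub>B\<^esub>"
  proof
    assume "\<one>\<^bsub>B\<^esub> = \<zero>\<^bsub>B\<^esub>"
    then have "?\<phi> id_blinfun = ?\<phi> 0" by (simp add: B_simps)
    then have "(id_blinfun :: (nat \<times> int \<times> nat) op) = 0"
      by (rule inj_onD[OF inj_matrix_of_op _ ops_id(1) ops_zero])
    then have "?e = 0" by (metis blinfun.zero_left id_blinfun.rep_eq)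
    then have "coord ?e (0, 0, 0) = 0" by (simp add: coord_ops)
    then show False by (simp add: coord_unit_vector)
  qed
  ultimately show thesis using that[of B ?s ?t] B_cstar rel by blast
qed

section \<open>The largest ideal\<close>

theorem corollary4p17:
  fixes n m :: nat and q :: complex
    and A :: "'a cstar" and s t :: "nat \<Rightarrow> 'a"
  assumes "n \<ge> 2" and "m \<ge> 2" and "cmod q = 1"
    and "is_E n m q A s t"
  shows "closed_ideal (M_ideal n m A s t) A \<and>
    M_ideal n m A s t \<noteq> carrier A \<and>
    (\<forall>J. closed_ideal J A \<and> J \<noteq> carrier A \<longrightarrow> J \<subseteq> M_ideal n m A s t)"
proof -
  have A: "unital_cstar_algebra A" and rel: "E_relations n m q A s t"
    and gen: "cstar_generated_by A (s ` {1..n} \<union> t ` {1..m})"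
    and univ: "E_universal_for TYPE('a) n m q A s t"
    and univ': "E_universal_for TYPE(nat \<Rightarrow> nat \<Rightarrow> complex) n m q A s t"
    using assms(4) by (auto simp: is_E_def)
  interpret universal_E_family A n m q s t
    by (intro universal_E_family.intro E_family.intro E_family_axioms.intro universal_E_family_axioms.intro
        A assms(1-3) rel gen univ)
  have "M_ideal n m A s t \<noteq> carrier A"
  proof -
    obtain B :: "(nat \<Rightarrow> nat \<Rightarrow> complex) cstar" and s' t'
      where B: "unital_cstar_algebra B" "E_relations n m q B s' t'" "\<one>\<^bsub>B\<^esub> \<noteq> \<zero>\<^bsub>B\<^esub>"
        "range_sum B n s' = \<one>\<^bsub>B\<^esub>" "range_sum B m t' = \<one>\<^bsub>B\<^esub>"
      using full_representation[OF assms(1-3)] by blast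
    obtain h where h: "h \<in> star_hom A B"
      and hs: "\<forall>i\<in>{1..n}. h (s i) = s' i" and ht: "\<forall>r\<in>{1..m}. h (t r) = t' r"
      using univ' B(1,2) unfolding E_universal_for_def by blast
    show ?thesis by (rule M_ideal_proper[OF B(1,3) h hs B(4) ht B(5)])
  qed
  then show ?thesis
    using M_ideal_closed proper_ideal_subset[OF _ _ M_ideal_closed M_ideal_defects] by blast
qed

end
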